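(* Let $\mathcal{C}=\mathrm{Vect}_\Gamma\oplus\mathrm{Vect}_{\Gamma/2\Gamma}$ be the $\mathbb{Z}_2$-crossed ribbon fusion category described in the context, attached to a discriminant form $(\Gamma,Q)$ and data $(\sigma,\omega,\bar\delta,\varepsilon,q,\alpha,\beta)$. Let $\Gamma_2=\{a\in\Gamma\mid 2a=0\}$. The simple objects of the equivariantisation $\mathcal{C}/\!/\mathbb{Z}_2$, up to isomorphism, are given by: 1. $2|\Gamma_2|$ invertible objects (of quantum dimension $1$) indexed by $\Gamma_2\times\{\pm1\}$. They are given by $X_{a,s}:=\mathbb{C}_a$ with equivariant structure $\varphi_g=s\,\mathrm{id}_{\mathbb{C}_a}$ for $a\in\Gamma_2$ and $s\in\{\pm1\}$. 2. $\tfrac12(|\Gamma|-|\Gamma_2|)=\tfrac12|\Gamma|(1-1/|2\Gamma|)$ simple objects of quantum dimension $2$ indexed by the set of unordered pairs $\{\{a,-a\}\mid a\in\Gamma\setminus\Gamma_2\}$. They are given by $Y_{\{a,-a\}}:=\mathbb{C}_a\oplus\mathbb{C}_{-a}$ for $a\in\Gamma\setminus\Gamma_2$, with the equivariant structure given by interchanging the direct summands. 3. $2|\Gamma_2|$ simple objects of quantum dimension $(|\Gamma|/|\Gamma_2|)^{1/2}=|2\Gamma|^{1/2}$ indexed by $\Gamma/2\Gamma\times\{\pm1\}$. They are given by $Z_{\bar x,s}:=\mathsf{X}^{\bar x}$ with equivariant structure $\varphi_g=s\,\mathrm{id}_{\mathsf{X}^{\bar x}}$ for $\bar x\in\Gamma/2\Gamma$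 and $s\in\{\pm1\}$.
   Context: All categories are $\mathbb{C}$-linear. **Input data.** A discriminant form $(\Gamma,Q)$ is a finite abelian group $\Gamma$ (written additively) with a nondegenerate quadratic form $Q\colon\Gamma\to\mathbb{C}^\times$: $Q(na)=Q(a)^{n^2}$ for $n\in\mathbb{Z}$, and $B_Q(a,b)=Q(a+b)Q(a)^{-1}Q(b)^{-1}$ is bimultiplicative and nondegenerate. Fix functions $\sigma\colon\Gamma^2\to\mathbb{C}^\times$, $\omega\colon\Gamma^3\to\{\pm1\}$ with: $\sigma(a,a)=Q(a)$; $\sigma(a,0)=\sigma(0,a)=1$; $\sigma(a,b)=\sigma(b,a)$; $\omega(a,b,c)=\sigma(a,b+c)\sigma(a,b)^{-1}\sigma(a,c)^{-1}$; and for fixed $b,c$ the map $\omega(\cdot,b,c)\colon\Gamma\to\{\pm1\}$ is a group homomorphism (so it factors through $\Gamma/2\Gamma$, and we allow the first argument of $\omega$ to lie in $\Gamma/2\Gamma$). For $x\in\Gamma$, $\bar x$ denotes its class in $\Gamma/2\Gamma$. Fix $\bar\delta\in\Gamma/2\Gamma$ and $q\colon\Gamma\to\mathbb{C}^\times$ with $q(a)^2=Q(a)$ and $q(a+b)q(a)^{-1}q(b)^{-1}=\sigma(a,b)\,\omega(a+b,a,b)\,\omega(\bar\delta,a,b)$ for all $a,b\in\Gamma$. Fix $\varepsilon\in\{\pm1\}$, a square root $\alpha$ of $\varepsilon\,G_{\bar\delta}(\Gamma,q^{-1})$, where $G_{\bar\delta}(\Gamma,q^{-1})=|2\Gamma|^{-1/2}\sum_{a\in\bar\delta}q(a)^{-1}$,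 and a choice $\beta=\pm\alpha^{-1}$. (The ribbon twist below yields positive quantum dimensions if and only if $\alpha\beta=\varepsilon$.) **The category $\mathcal{C}=\mathcal{C}_1\oplus\mathcal{C}_g$** (with $G=\langle g\rangle\cong\mathbb{Z}_2$). It is semisimple, with simple objects $\mathbb{C}_a$ ($a\in\Gamma$) in $\mathcal{C}_1$ and $\mathsf{X}^{\bar x}$ ($\bar x\in\Gamma/2\Gamma$) in $\mathcal{C}_g$. Tensor product: $\mathbb{C}_a\otimes\mathbb{C}_b=\mathbb{C}_{a+b}$, $\mathbb{C}_a\otimes\mathsf{X}^{\bar x}=\mathsf{X}^{\bar a+\bar x}=\mathsf{X}^{\bar x}\otimes\mathbb{C}_a$, $\mathsf{X}^{\bar x}\otimes\mathsf{X}^{\bar y}=\bigoplus_{t\in\bar\delta+\bar x+\bar y}\mathbb{C}_t$. Associator $(A\otimes B)\otimes C\to A\otimes(B\otimes C)$ (with $e_t$ the basis vector of the summand $\mathbb{C}_t$ of a product of two $\mathsf{X}$'s): - $(\mathbb{C}_a,\mathbb{C}_b,\mathbb{C}_c)$: $\omega(a,b,c)$; - $(\mathsf{X}^{\bar x},\mathbb{C}_a,\mathbb{C}_b)$: $\omega(\bar x+\bar\delta,a,b)$; - $(\mathbb{C}_a,\mathsf{X}^{\bar x},\mathbb{C}_b)$: $\sigma(a,b)$; - $(\mathbb{C}_a,\mathbb{C}_b,\mathsf{X}^{\bar x})$: $\omega(\bar a+\bar b+\bar x,a,b)$; - $(\mathbb{C}_a,\mathsf{X}^{\bar x},\mathsf{X}^{\bar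 y})$: $e_{a+t}\mapsto\omega(\bar a+\bar x,a,t)\,e_a\otimes e_t$; - $(\mathsf{X}^{\bar x},\mathsf{X}^{\bar y},\mathbb{C}_a)$: $e_t\otimes e_a\mapsto\omega(\bar x,t,a)\,e_{t+a}$; - $(\mathsf{X}^{\bar x},\mathbb{C}_a,\mathsf{X}^{\bar y})$: $e_t\mapsto\sigma(a,t)\,e_t$; - $(\mathsf{X}^{\bar x},\mathsf{X}^{\bar y},\mathsf{X}^{\bar z})$: the map $\bigoplus_{t\in\bar\delta+\bar x+\bar y}\mathsf{X}^{\bar t+\bar z}\to\bigoplus_{r\in\bar\delta+\bar y+\bar z}\mathsf{X}^{\bar x+\bar r}$ whose component from the $t$-summand to the $r$-summand is $\varepsilon|2\Gamma|^{-1/2}\sigma(t,r)^{-1}$. $\mathbb{Z}_2$-action: $g_*\mathbb{C}_a=\mathbb{C}_{-a}$, $g_*\mathsf{X}^{\bar x}=\mathsf{X}^{\bar x}$, strict composition ($g_*g_*=\mathrm{id}$), tensor structure $\tau^g\colon g_*(A\otimes B)\to g_*A\otimes g_*B$: $\omega(a,b,-b)$ on $(\mathbb{C}_a,\mathbb{C}_b)$; $\omega(\bar a+\bar x,a,-a)$ on $(\mathbb{C}_a,\mathsf{X}^{\bar x})$; $\omega(\bar x+\bar\delta,a,-a)$ on $(\mathsf{X}^{\bar x},\mathbb{C}_a)$; $\omega(\bar x,t,-t)$ on the summand $t$ of $(\mathsf{X}^{\bar x},\mathsf{X}^{\bar y})$. $\mathbb{Z}_2$-braiding $c_{A,B}\colon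 A\otimes B\to h_*(B)\otimes A$ for $A\in\mathcal{C}_h$: $\sigma(a,b)$ on $\mathbb{C}_a\otimes\mathbb{C}_b$; $q(a)^{-1}$ on $\mathbb{C}_a\otimes\mathsf{X}^{\bar x}$; $q(a)^{-1}\omega(\bar x+\bar a,a,-a)$ on $\mathsf{X}^{\bar x}\otimes\mathbb{C}_a\to\mathbb{C}_{-a}\otimes\mathsf{X}^{\bar x}$; $\alpha q(t)$ on the summand $\mathbb{C}_t$ of $\mathsf{X}^{\bar x}\otimes\mathsf{X}^{\bar y}\to\mathsf{X}^{\bar y}\otimes\mathsf{X}^{\bar x}$. $\mathbb{Z}_2$-ribbon twist $\theta_A\colon A\to h_*A$ for $A\in\mathcal{C}_h$: $\theta_{\mathbb{C}_a}=\sigma(a,a)$, $\theta_{\mathsf{X}^{\bar x}}=\beta$. These data define a braided $\mathbb{Z}_2$-crossed fusion category with a $\mathbb{Z}_2$-ribbon structure (this may be taken as given). **Equivariantisation.** Objects of $\mathcal{C}/\!/\mathbb{Z}_2$ are pairs $(X,\varphi)$ with $X\in\mathcal{C}$ and an isomorphism $\varphi_g\colon g_*X\to X$ with $\varphi_g\circ g_*(\varphi_g)=\mathrm{id}_X$; morphisms $f\colon(X,\varphi)\to(Y,\varphi')$ satisfy $\varphi'_g\circ g_*(f)=f\circ\varphi_g$; $(X,\varphi)\otimes(Y,\varphi')=(X\otimes Y,(\varphi_g\otimes\varphi'_g)\circ\tau^g_{X,Y})$. Its braiding is, on the component $X_h\in\mathcal{C}_h$ of $X$, $(\varphi'_h\otimes\mathrm{id})\circ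 c_{X_h,Y}$ (with $\varphi'_1=\mathrm{id}$), and its ribbon twist on $(X,\varphi)$ is $\bigoplus_h\varphi_h\circ\theta_{X_h}$. It is a (pseudo-unitary) modular tensor category.
   Formalization: The quantum dimension |2Γ|^{1/2} of Z_{x,s} is asserted when αβ=ε; when αβ=−ε, where the ribbon trace is negative (e.g. Γ trivial, ε=α=1, β=−1 gives −1), the value −|2Γ|^{1/2} is stated instead. *)

theory Defs
  imports Complex_Main "HOL-Library.Set_Algebras" "HOL-Library.Cardinality"
begin

section \<open>Discriminant forms and the input data\<close>

definition zmult :: "int \<Rightarrow> 'g::ab_group_add \<Rightarrow> 'g" where
  "zmult n a = (if 0 \<le> n then ((+) a ^^ nat n) 0 else - ((+) a ^^ nat (- n)) 0)"

definition polar :: "('g::ab_group_add \<Rightarrow> complex) \<Rightarrow> 'g \<Rightarrow> 'g \<Rightarrow> complex" where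
  "polar Q a b = Q (a + b) / (Q a * Q b)"

definition discriminant_form :: "('g::{ab_group_add,finite} \<Rightarrow> complex) \<Rightarrow> bool" where
  "discriminant_form Q \<longleftrightarrow>
     (\<forall>a. Q a \<noteq> 0) \<and>
     (\<forall>n a. Q (zmult n a) = Q a powi (n\<^sup>2)) \<and>
     (\<forall>a b c. polar Q (a + b) c = polar Q a c * polar Q b c) \<and>
     (\<forall>a b c. polar Q a (b + c) = polar Q a b * polar Q a c) \<and>
     (\<forall>a. (\<forall>b. polar Q a b = 1) \<longrightarrow> a = 0)"

definition dbl :: "'g::ab_group_add set" where
  "dbl = range (\<lambda>a. a + a)"

definition tors2 :: "'g::ab_group_add set" where
  "tors2 = {a. a + a = 0}"

text \<open>Elements of \<open>\<Gamma>/2\<Gamma>\<close> are the cosets themselves, as sets; their sum is the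
  elementwise sum of sets, and \<open>a +o x\<close> is the sum of the class of \<open>a\<close> with \<open>x\<close>.\<close>

definition cosets2 :: "'g::ab_group_add set set" where
  "cosets2 = range (\<lambda>a. a +o dbl)"

record 'g crossed_data =
  dQ :: "'g \<Rightarrow> complex"
  dsigma :: "'g \<Rightarrow> 'g \<Rightarrow> complex"
  domega :: "'g \<Rightarrow> 'g \<Rightarrow> 'g \<Rightarrow> complex"
  ddelta :: "'g set"
  deps :: complex
  dq :: "'g \<Rightarrow> complex"
  dalpha :: complex
  dbeta :: complex

text \<open>\<open>\<omega>\<close> with first argument in \<open>\<Gamma>/2\<Gamma>\<close>: the value on any representative
  (\<open>\<omega>\<close> is a homomorphism to \<open>{1,-1}\<close> in its first argument).\<close>

definition omc :: "'g crossed_data \<Rightarrow> 'g set \<Rightarrow> 'g \<Rightarrow> 'g \<Rightarrow> complex" where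
  "omc D x b c = domega D (SOME a. a \<in> x) b c"

definition norm2 :: "'g::{ab_group_add,finite} crossed_data \<Rightarrow> complex" where
  "norm2 D = complex_of_real (1 / sqrt (real (card (dbl :: 'g set))))"

definition gauss_sum :: "'g::{ab_group_add,finite} crossed_data \<Rightarrow> complex" where
  "gauss_sum D = norm2 D * (\<Sum>a\<in>ddelta D. inverse (dq D a))"

definition valid_data :: "'g::{ab_group_add,finite} crossed_data \<Rightarrow> bool" where
  "valid_data D \<longleftrightarrow>
     discriminant_form (dQ D) \<and>
     (\<forall>a b. dsigma D a b \<noteq> 0) \<and>
     (\<forall>a b c. domega D a b c \<in> {1, -1}) \<and>
     (\<forall>a. dsigma D a a = dQ D a) \<and>
     (\<forall>a. dsigma D a 0 = 1 \<and> dsigma D 0 a = 1) \<and>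
     (\<forall>a b. dsigma D a b = dsigma D b a) \<and>
     (\<forall>a b c. domega D a b c = dsigma D a (b + c) / (dsigma D a b * dsigma D a c)) \<and>
     (\<forall>a a' b c. domega D (a + a') b c = domega D a b c * domega D a' b c) \<and>
     ddelta D \<in> cosets2 \<and>
     (\<forall>a. dq D a \<noteq> 0) \<and>
     (\<forall>a. (dq D a)\<^sup>2 = dQ D a) \<and>
     (\<forall>a b. dq D (a + b) / (dq D a * dq D b) =
        dsigma D a b * domega D (a + b) a b * omc D (ddelta D) a b) \<and>
     deps D \<in> {1, -1} \<and>
     (dalpha D)\<^sup>2 = deps D * gauss_sum D \<and>
     (dbeta D = inverse (dalpha D) \<or> dbeta D = - inverse (dalpha D))"


section \<open>The underlying semisimple category\<close>

datatype 'g simple = Cob 'g | Xob "'g set"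

text \<open>The semisimple category \<open>Vect\<^sub>\<Gamma> \<oplus> Vect\<^bsub>\<Gamma>/2\<Gamma>\<^esub>\<close> is realised as the category of finite formal
  direct sums of the simple objects. An object is a finite partial map from labels to simple
  objects; a morphism is a complex matrix indexed by labels whose nonzero entries connect
  labels carrying the same simple object. The label \<open>Tens i j t\<close> stands for the summand \<open>t\<close> in
  the product of the \<open>i\<close>-th summand of the first and the \<open>j\<close>-th summand of the second factor
  (all fusion multiplicities are at most one).\<close>

datatype 'g label = Atom nat | Tens "'g label" "'g label" "'g simple"

type_synonym 'g cobj = "'g label \<Rightarrow> 'g simple option"

record 'g arrow =
  src :: "'g cobj"
  tgt :: "'g cobj"
  mat :: "'g label \<Rightarrow> 'g label \<Rightarrow> complex"

definition is_cobj :: "'g::ab_group_add cobj \<Rightarrow> bool" where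
  "is_cobj V \<longleftrightarrow> finite (dom V) \<and> ran V \<subseteq> range Cob \<union> Xob ` cosets2"

definition chom :: "'g cobj \<Rightarrow> 'g cobj \<Rightarrow> 'g arrow set" where
  "chom V W = {f. src f = V \<and> tgt f = W \<and>
     (\<forall>w v. mat f w v \<noteq> 0 \<longrightarrow> v \<in> dom V \<and> W w = V v)}"

text \<open>The morphism with matrix \<open>m\<close>, where row index = target label, column index = source
  label, and all entries not connecting equal simple objects are discarded.\<close>

definition arr :: "'g cobj \<Rightarrow> 'g cobj \<Rightarrow> ('g label \<Rightarrow> 'g label \<Rightarrow> complex) \<Rightarrow> 'g arrow" where
  "arr V W m = \<lparr>src = V, tgt = W,
     mat = (\<lambda>w v. if v \<in> dom V \<and> W w = V v then m w v else 0)\<rparr>"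

definition idm :: "'g cobj \<Rightarrow> 'g arrow" where
  "idm V = arr V V (\<lambda>w v. if w = v then 1 else 0)"

definition compm :: "'g arrow \<Rightarrow> 'g arrow \<Rightarrow> 'g arrow" (infixr "\<bullet>" 65) where
  "g \<bullet> f = \<lparr>src = src f, tgt = tgt g,
     mat = (\<lambda>w u. \<Sum>v\<in>dom (tgt f). mat g w v * mat f v u)\<rparr>"

definition addm :: "'g arrow \<Rightarrow> 'g arrow \<Rightarrow> 'g arrow" where
  "addm f g = f\<lparr>mat := (\<lambda>w v. mat f w v + mat g w v)\<rparr>"

definition scalem :: "complex \<Rightarrow> 'g arrow \<Rightarrow> 'g arrow" where
  "scalem c f = f\<lparr>mat := (\<lambda>w v. c * mat f w v)\<rparr>"

definition is_inverse :: "'g arrow \<Rightarrow> 'g arrow \<Rightarrow> bool" where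
  "is_inverse f g \<longleftrightarrow> g \<in> chom (tgt f) (src f) \<and> g \<bullet> f = idm (src f) \<and> f \<bullet> g = idm (tgt f)"

definition invm :: "'g arrow \<Rightarrow> 'g arrow" where
  "invm f = (THE g. is_inverse f g)"


section \<open>Tensor product and associator\<close>

fun fus :: "'g::{ab_group_add,finite} crossed_data \<Rightarrow> 'g simple \<Rightarrow> 'g simple \<Rightarrow> 'g simple set" where
  "fus D (Cob a) (Cob b) = {Cob (a + b)}"
| "fus D (Cob a) (Xob x) = {Xob (a +o x)}"
| "fus D (Xob x) (Cob a) = {Xob (a +o x)}"
| "fus D (Xob x) (Xob y) = Cob ` (ddelta D + x + y)"

definition tensor :: "'g::{ab_group_add,finite} crossed_data \<Rightarrow> 'g cobj \<Rightarrow> 'g cobj \<Rightarrow> 'g cobj" where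
  "tensor D V W = (\<lambda>l. case l of Atom n \<Rightarrow> None
     | Tens i j t \<Rightarrow> (case (V i, W j) of
           (Some A, Some B) \<Rightarrow> if t \<in> fus D A B then Some t else None
         | _ \<Rightarrow> None))"

definition tensorm :: "'g::{ab_group_add,finite} crossed_data \<Rightarrow> 'g arrow \<Rightarrow> 'g arrow \<Rightarrow> 'g arrow" where
  "tensorm D f g = arr (tensor D (src f) (src g)) (tensor D (tgt f) (tgt g))
     (\<lambda>w v. case (w, v) of
        (Tens i' j' t', Tens i j t) \<Rightarrow> mat f i' i * mat g j' j
      | _ \<Rightarrow> 0)"

definition cunit :: "'g::zero cobj" where
  "cunit = [Atom 0 \<mapsto> Cob 0]"

text \<open>The unit constraints are identities up to relabelling.\<close>

definition lunit :: "'g::{ab_group_add,finite} crossed_data \<Rightarrow> 'g cobj \<Rightarrow> 'g arrow" where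
  "lunit D V = arr (tensor D cunit V) V
     (\<lambda>w v. case v of Tens u i t \<Rightarrow> if w = i then 1 else 0 | _ \<Rightarrow> 0)"

definition runit :: "'g::{ab_group_add,finite} crossed_data \<Rightarrow> 'g cobj \<Rightarrow> 'g arrow" where
  "runit D V = arr (tensor D V cunit) V
     (\<lambda>w v. case v of Tens i u t \<Rightarrow> if w = i then 1 else 0 | _ \<Rightarrow> 0)"

text \<open>\<open>assoc_coeff D A B C t r s\<close> is the matrix entry of
  \<open>(A \<otimes> B) \<otimes> C \<rightarrow> A \<otimes> (B \<otimes> C)\<close> from the summand \<open>s \<subseteq> t \<otimes> C\<close>, \<open>t \<subseteq> A \<otimes> B\<close>, to the summand
  \<open>s \<subseteq> A \<otimes> r\<close>, \<open>r \<subseteq> B \<otimes> C\<close>. The remaining argument patterns never occur.\<close>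

fun assoc_coeff :: "'g::{ab_group_add,finite} crossed_data \<Rightarrow> 'g simple \<Rightarrow> 'g simple \<Rightarrow> 'g simple
    \<Rightarrow> 'g simple \<Rightarrow> 'g simple \<Rightarrow> 'g simple \<Rightarrow> complex" where
  "assoc_coeff D (Cob a) (Cob b) (Cob c) _ _ _ = domega D a b c"
| "assoc_coeff D (Xob x) (Cob a) (Cob b) _ _ _ = omc D (x + ddelta D) a b"
| "assoc_coeff D (Cob a) (Xob x) (Cob b) _ _ _ = dsigma D a b"
| "assoc_coeff D (Cob a) (Cob b) (Xob x) _ _ _ = omc D ((a + b) +o x) a b"
| "assoc_coeff D (Cob a) (Xob x) (Xob y) _ (Cob t) _ = omc D (a +o x) a t"
| "assoc_coeff D (Xob x) (Xob y) (Cob a) (Cob t) _ _ = omc D x t a"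
| "assoc_coeff D (Xob x) (Cob a) (Xob y) _ _ (Cob t) = dsigma D a t"
| "assoc_coeff D (Xob x) (Xob y) (Xob z) (Cob t) (Cob r) _ =
     deps D * norm2 D * inverse (dsigma D t r)"
| "assoc_coeff D _ _ _ _ _ _ = 0"

definition associator :: "'g::{ab_group_add,finite} crossed_data \<Rightarrow>
    'g cobj \<Rightarrow> 'g cobj \<Rightarrow> 'g cobj \<Rightarrow> 'g arrow" where
  "associator D U V W = arr (tensor D (tensor D U V) W) (tensor D U (tensor D V W))
     (\<lambda>w v. case (w, v) of
        (Tens i' (Tens j' k' r) s', Tens (Tens i j t) k s) \<Rightarrow>
          if i' = i \<and> j' = j \<and> k' = k
          then assoc_coeff D (the (U i)) (the (V j)) (the (W k)) t r s else 0
      | _ \<Rightarrow> 0)"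


section \<open>Group action, crossed braiding and crossed twist\<close>

datatype z2 = One | Gen

fun sact :: "z2 \<Rightarrow> 'g::ab_group_add simple \<Rightarrow> 'g simple" where
  "sact One A = A"
| "sact Gen (Cob a) = Cob (- a)"
| "sact Gen (Xob x) = Xob x"

definition act :: "z2 \<Rightarrow> 'g::ab_group_add cobj \<Rightarrow> 'g cobj" where
  "act h V = (\<lambda>i. map_option (sact h) (V i))"

definition actm :: "z2 \<Rightarrow> 'g::ab_group_add arrow \<Rightarrow> 'g arrow" where
  "actm h f = \<lparr>src = act h (src f), tgt = act h (tgt f), mat = mat f\<rparr>"

text \<open>Entry of \<open>\<tau>\<^sup>g\<close> on the summand \<open>t\<close> of the product of two simple objects.\<close>

fun tau_coeff :: "'g::{ab_group_add,finite} crossed_data \<Rightarrow> 'g simple \<Rightarrow> 'g simple \<Rightarrow> 'g simple \<Rightarrow> complex" where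
  "tau_coeff D (Cob a) (Cob b) _ = domega D a b (- b)"
| "tau_coeff D (Cob a) (Xob x) _ = omc D (a +o x) a (- a)"
| "tau_coeff D (Xob x) (Cob a) _ = omc D (x + ddelta D) a (- a)"
| "tau_coeff D (Xob x) (Xob y) (Cob t) = omc D x t (- t)"
| "tau_coeff D (Xob x) (Xob y) (Xob _) = 0"

definition tau :: "'g::{ab_group_add,finite} crossed_data \<Rightarrow> 'g cobj \<Rightarrow> 'g cobj \<Rightarrow> 'g arrow" where
  "tau D V W = arr (act Gen (tensor D V W)) (tensor D (act Gen V) (act Gen W))
     (\<lambda>w v. case (w, v) of
        (Tens i' j' t', Tens i j t) \<Rightarrow>
          if i' = i \<and> j' = j then tau_coeff D (the (V i)) (the (W j)) t else 0
      | _ \<Rightarrow> 0)"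

fun grade :: "'g simple \<Rightarrow> z2" where
  "grade (Cob a) = One"
| "grade (Xob x) = Gen"

definition component :: "z2 \<Rightarrow> 'g cobj \<Rightarrow> 'g cobj" where
  "component h V = (\<lambda>i. case V i of None \<Rightarrow> None | Some A \<Rightarrow> if grade A = h then Some A else None)"

definition incl :: "z2 \<Rightarrow> 'g cobj \<Rightarrow> 'g arrow" where
  "incl h V = arr (component h V) V (\<lambda>w v. if w = v then 1 else 0)"

definition proj :: "z2 \<Rightarrow> 'g cobj \<Rightarrow> 'g arrow" where
  "proj h V = arr V (component h V) (\<lambda>w v. if w = v then 1 else 0)"

fun braid_coeff :: "'g::{ab_group_add,finite} crossed_data \<Rightarrow> 'g simple \<Rightarrow> 'g simple \<Rightarrow> 'g simple \<Rightarrow> complex" where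
  "braid_coeff D (Cob a) (Cob b) _ = dsigma D a b"
| "braid_coeff D (Cob a) (Xob x) _ = inverse (dq D a)"
| "braid_coeff D (Xob x) (Cob a) _ = inverse (dq D a) * omc D (a +o x) a (- a)"
| "braid_coeff D (Xob x) (Xob y) (Cob t) = dalpha D * dq D t"
| "braid_coeff D (Xob x) (Xob y) (Xob _) = 0"

text \<open>\<open>cbraid D h V W : V \<otimes> W \<rightarrow> h\<^sub>* W \<otimes> V\<close> and \<open>ctwist D h V : V \<rightarrow> h\<^sub>* V\<close>, for \<open>V\<close> homogeneous
  of degree \<open>h\<close>.\<close>

definition cbraid :: "'g::{ab_group_add,finite} crossed_data \<Rightarrow> z2 \<Rightarrow> 'g cobj \<Rightarrow> 'g cobj \<Rightarrow> 'g arrow" where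
  "cbraid D h V W = arr (tensor D V W) (tensor D (act h W) V)
     (\<lambda>w v. case (w, v) of
        (Tens j' i' t', Tens i j t) \<Rightarrow>
          if i' = i \<and> j' = j then braid_coeff D (the (V i)) (the (W j)) t else 0
      | _ \<Rightarrow> 0)"

fun twist_coeff :: "'g::{ab_group_add,finite} crossed_data \<Rightarrow> 'g simple \<Rightarrow> complex" where
  "twist_coeff D (Cob a) = dsigma D a a"
| "twist_coeff D (Xob x) = dbeta D"

definition ctwist :: "'g::{ab_group_add,finite} crossed_data \<Rightarrow> z2 \<Rightarrow> 'g cobj \<Rightarrow> 'g arrow" where
  "ctwist D h V = arr V (act h V) (\<lambda>w v. if w = v then twist_coeff D (the (V v)) else 0)"


section \<open>The equivariantisation\<close>

record 'g eobj =
  und :: "'g cobj"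
  eqv :: "'g arrow"

definition is_eobj :: "'g::ab_group_add eobj \<Rightarrow> bool" where
  "is_eobj X \<longleftrightarrow> is_cobj (und X) \<and>
     eqv X \<in> chom (act Gen (und X)) (und X) \<and>
     (\<exists>\<psi>. is_inverse (eqv X) \<psi>) \<and>
     eqv X \<bullet> actm Gen (eqv X) = idm (und X)"

definition ehom :: "'g::ab_group_add eobj \<Rightarrow> 'g eobj \<Rightarrow> 'g arrow set" where
  "ehom X Y = {f \<in> chom (und X) (und Y). eqv Y \<bullet> actm Gen f = f \<bullet> eqv X}"

definition is_eiso :: "'g::ab_group_add eobj \<Rightarrow> 'g eobj \<Rightarrow> 'g arrow \<Rightarrow> bool" where
  "is_eiso X Y f \<longleftrightarrow> f \<in> ehom X Y \<and> (\<exists>g\<in>ehom Y X. is_inverse f g)"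

definition eisomorphic :: "'g::ab_group_add eobj \<Rightarrow> 'g eobj \<Rightarrow> bool" where
  "eisomorphic X Y \<longleftrightarrow> (\<exists>f. is_eiso X Y f)"

definition iso_class :: "'g::ab_group_add eobj \<Rightarrow> 'g eobj set" where
  "iso_class X = {Y. is_eobj Y \<and> eisomorphic X Y}"

definition emono :: "'g::ab_group_add eobj \<Rightarrow> 'g eobj \<Rightarrow> 'g arrow \<Rightarrow> bool" where
  "emono X Y m \<longleftrightarrow> m \<in> ehom X Y \<and>
     (\<forall>U f g. is_eobj U \<and> f \<in> ehom U X \<and> g \<in> ehom U X \<and> m \<bullet> f = m \<bullet> g \<longrightarrow> f = g)"

definition is_zero_obj :: "'g eobj \<Rightarrow> bool" where
  "is_zero_obj X \<longleftrightarrow> und X = Map.empty"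

text \<open>A nonzero object whose only subobjects are zero and itself.\<close>

definition esimple :: "'g::ab_group_add eobj \<Rightarrow> bool" where
  "esimple X \<longleftrightarrow> is_eobj X \<and> \<not> is_zero_obj X \<and>
     (\<forall>U m. is_eobj U \<and> emono U X m \<longrightarrow> is_zero_obj U \<or> is_eiso U X m)"

definition etensor :: "'g::{ab_group_add,finite} crossed_data \<Rightarrow> 'g eobj \<Rightarrow> 'g eobj \<Rightarrow> 'g eobj" where
  "etensor D X Y = \<lparr>und = tensor D (und X) (und Y),
     eqv = tensorm D (eqv X) (eqv Y) \<bullet> tau D (und X) (und Y)\<rparr>"

definition eunit :: "'g::ab_group_add eobj" where
  "eunit = \<lparr>und = cunit, eqv = arr (act Gen cunit) cunit (\<lambda>w v. if w = v then 1 else 0)\<rparr>"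

definition einvertible :: "'g::{ab_group_add,finite} crossed_data \<Rightarrow> 'g eobj \<Rightarrow> bool" where
  "einvertible D X \<longleftrightarrow> (\<exists>Y. is_eobj Y \<and>
     eisomorphic (etensor D X Y) eunit \<and> eisomorphic (etensor D Y X) eunit)"

fun eqv_at :: "'g eobj \<Rightarrow> z2 \<Rightarrow> 'g arrow" where
  "eqv_at X One = idm (und X)"
| "eqv_at X Gen = eqv X"

definition ebraid_part :: "'g::{ab_group_add,finite} crossed_data \<Rightarrow> 'g eobj \<Rightarrow> 'g eobj \<Rightarrow> z2 \<Rightarrow> 'g arrow" where
  "ebraid_part D X Y h =
     tensorm D (eqv_at Y h) (incl h (und X))
       \<bullet> cbraid D h (component h (und X)) (und Y)
       \<bullet> tensorm D (proj h (und X)) (idm (und Y))"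

definition ebraid :: "'g::{ab_group_add,finite} crossed_data \<Rightarrow> 'g eobj \<Rightarrow> 'g eobj \<Rightarrow> 'g arrow" where
  "ebraid D X Y = addm (ebraid_part D X Y One) (ebraid_part D X Y Gen)"

definition etwist_part :: "'g::{ab_group_add,finite} crossed_data \<Rightarrow> 'g eobj \<Rightarrow> z2 \<Rightarrow> 'g arrow" where
  "etwist_part D X h =
     eqv_at X h \<bullet> actm h (incl h (und X)) \<bullet> ctwist D h (component h (und X)) \<bullet> proj h (und X)"

definition etwist :: "'g::{ab_group_add,finite} crossed_data \<Rightarrow> 'g eobj \<Rightarrow> 'g arrow" where
  "etwist D X = addm (etwist_part D X One) (etwist_part D X Gen)"

text \<open>\<open>Y\<close> is a dual of \<open>X\<close> with evaluation \<open>e : Y \<otimes> X \<rightarrow> 1\<close> and coevaluation \<open>k : 1 \<rightarrow> X \<otimes> Y\<close>.\<close>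

definition is_dual :: "'g::{ab_group_add,finite} crossed_data \<Rightarrow> 'g eobj \<Rightarrow> 'g eobj \<Rightarrow> 'g arrow \<Rightarrow> 'g arrow \<Rightarrow> bool" where
  "is_dual D X Y e k \<longleftrightarrow> is_eobj Y \<and>
     e \<in> ehom (etensor D Y X) eunit \<and> k \<in> ehom eunit (etensor D X Y) \<and>
     runit D (und X) \<bullet> tensorm D (idm (und X)) e \<bullet> associator D (und X) (und Y) (und X)
       \<bullet> tensorm D k (idm (und X)) \<bullet> invm (lunit D (und X)) = idm (und X) \<and>
     lunit D (und Y) \<bullet> tensorm D e (idm (und Y)) \<bullet> invm (associator D (und Y) (und X) (und Y))
       \<bullet> tensorm D (idm (und Y)) k \<bullet> invm (runit D (und Y)) = idm (und Y)"

text \<open>The quantum dimension is the categorical trace of the identity,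
  \<open>1 \<rightarrow> X \<otimes> Y \<rightarrow> X \<otimes> Y \<rightarrow> Y \<otimes> X \<rightarrow> 1\<close>, for a dual \<open>Y\<close> of \<open>X\<close>; it does not depend on the dual.\<close>

definition qdim :: "'g::{ab_group_add,finite} crossed_data \<Rightarrow> 'g eobj \<Rightarrow> complex" where
  "qdim D X = (THE d. \<exists>Y e k. is_dual D X Y e k \<and>
     e \<bullet> ebraid D X Y \<bullet> tensorm D (etwist D X) (idm (und Y)) \<bullet> k = scalem d (idm cunit))"


section \<open>The objects in the classification\<close>

definition Xobj :: "'g::ab_group_add \<Rightarrow> complex \<Rightarrow> 'g eobj" where
  "Xobj a s = (let V = [Atom 0 \<mapsto> Cob a] in
     \<lparr>und = V, eqv = arr (act Gen V) V (\<lambda>w v. if w = v then s else 0)\<rparr>)"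

definition Yobj :: "'g::ab_group_add \<Rightarrow> 'g eobj" where
  "Yobj a = (let V = [Atom 0 \<mapsto> Cob a, Atom 1 \<mapsto> Cob (- a)] in
     \<lparr>und = V, eqv = arr (act Gen V) V
        (\<lambda>w v. if (w, v) \<in> {(Atom 0, Atom 1), (Atom 1, Atom 0)} then 1 else 0)\<rparr>)"

definition Zobj :: "'g::ab_group_add set \<Rightarrow> complex \<Rightarrow> 'g eobj" where
  "Zobj x s = (let V = [Atom 0 \<mapsto> Xob x] in
     \<lparr>und = V, eqv = arr (act Gen V) V (\<lambda>w v. if w = v then s else 0)\<rparr>)"

definition X_classes :: "'g::ab_group_add eobj set set" where
  "X_classes = (\<lambda>(a, s). iso_class (Xobj a s)) ` (tors2 \<times> {1, -1})"

definition Y_classes :: "'g::ab_group_add eobj set set" where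
  "Y_classes = (\<lambda>a. iso_class (Yobj a)) ` (- tors2)"

definition Z_classes :: "'g::ab_group_add eobj set set" where
  "Z_classes = (\<lambda>(x, s). iso_class (Zobj x s)) ` (cosets2 \<times> {1, -1})"

end

theory Submission
  imports Defs
begin

text \<open>
  Let \<open>\<phi>\<close> be the equivariant structure of an object and \<open>A\<close> a simple summand of it. If \<open>g\<^sub>*A = A\<close>,
  then \<open>\<phi>\<close> restricts to an involution of the \<open>A\<close>-isotypic part, and an eigenvector of it is a
  monomorphism from \<open>A\<close> with \<open>\<phi> = \<plusminus>id\<close>. If \<open>g\<^sub>*A \<noteq> A\<close>, a summand \<open>A\<close> and its image under \<open>\<phi>\<close>
  span a copy of \<open>A \<oplus> g\<^sub>*A\<close>. So every nonzero object contains one of the listed objects, and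
  since nonzero morphisms between listed objects are invertible, these are exactly the simple ones.

  For the dimensions, let \<open>(Y, e, k)\<close> be any dual of a listed object \<open>X\<close>. The morphisms \<open>e\<close> and \<open>k\<close>
  live on the summands \<open>\<complex>\<^sub>0\<close> of \<open>Y \<otimes> X\<close> and \<open>X \<otimes> Y\<close>, and the diagonal entry at \<open>i\<close> of the first
  snake identity reads \<open>\<Sum>\<^sub>j e\<^sub>j\<^sub>i a\<^sub>i\<^sub>j k\<^sub>i\<^sub>j = 1\<close> with an associator coefficient \<open>a\<^sub>i\<^sub>j\<close>. In degree \<open>1\<close>
  this coefficient is \<open>\<omega>(a, -a, a) = \<sigma>(a, -a) \<sigma>(a, a)\<close>, the product of braiding and twist, so the
  trace counts the summands of \<open>X\<close>. In degree \<open>g\<close> it is \<open>\<epsilon> |2\<Gamma>|\<^sup>-\<^sup>1\<^sup>/\<^sup>2\<close>, while braiding and twist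
  contribute \<open>\<alpha>\<beta>\<close>, the signs from the equivariant structures cancelling by equivariance of \<open>k\<close>; so the
  trace is \<open>\<alpha>\<beta>\<epsilon> |2\<Gamma>|\<^sup>1\<^sup>/\<^sup>2\<close>. No uniqueness of duals is needed.
\<close>

section \<open>Matrices of morphisms\<close>

text \<open>Morphisms are matrices indexed by labels, so every categorical identity is checked entry
  by entry. This stays feasible because a nonzero entry connects equal simple objects, which
  collapses most sums to a few labels. \<open>qdim\<close> is a definite description, so besides the
  value for an arbitrary dual, one dual has to be exhibited. The obstacle there is the second snake
  identity, which contains the inverse of an associator. In degree 1 that associator is a signed
  bijection of labels. For three objects of degree g it is a full square matrix indexed by
  2\<Gamma>, inverted by orthogonality of the characters \<sigma>(t, .) of 2\<Gamma>. Here
  nondegeneracy of Q enters: \<sigma>(t, 2b) = B_Q(t, b) for t in 2\<Gamma>, so only t = 0 gives the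
  trivial character. The object X_(a,s) need not be its own dual: \<tau> contributes the sign
  \<omega>(a, a, a), by which s has to be corrected. The dual label of a coset x is \<delta> + x,
  because \<Gamma>/2\<Gamma> has exponent 2.\<close>

lemma src_arr [simp]: "src (arr V W m) = V"
  and tgt_arr [simp]: "tgt (arr V W m) = W"
  by (simp_all add: arr_def)

lemma mat_arr: "mat (arr V W m) w v = (if v \<in> dom V \<and> W w = V v then m w v else 0)"
  by (simp add: arr_def)

lemma arr_chom [simp]: "arr V W m \<in> chom V W"
  by (simp add: chom_def mat_arr)

lemma src_idm [simp]: "src (idm V) = V"
  and tgt_idm [simp]: "tgt (idm V) = V"
  by (simp_all add: idm_def)

lemma mat_idm: "mat (idm V) w v = (if w = v \<and> v \<in> dom V then 1 else 0)"
  by (auto simp: idm_def mat_arr)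

lemma idm_chom [simp]: "idm V \<in> chom V V"
  by (simp add: idm_def)

lemma src_compm [simp]: "src (g \<bullet> f) = src f"
  and tgt_compm [simp]: "tgt (g \<bullet> f) = tgt g"
  by (simp_all add: compm_def)

lemma mat_compm: "mat (g \<bullet> f) w u = (\<Sum>v\<in>dom (tgt f). mat g w v * mat f v u)"
  by (simp add: compm_def)

lemma chom_src: "f \<in> chom V W \<Longrightarrow> src f = V"
  and chom_tgt: "f \<in> chom V W \<Longrightarrow> tgt f = W"
  by (simp_all add: chom_def)

lemma chom_nonzero:
  assumes "f \<in> chom V W" "mat f w v \<noteq> 0"
  shows "v \<in> dom V" "W w = V v" "w \<in> dom W"
proof -
  show v: "v \<in> dom V" and w: "W w = V v"
    using assms unfolding chom_def by blast+
  then show "w \<in> dom W"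
    by (simp add: domIff)
qed

text \<open>Entries between different simple objects vanish on both sides, so only those between
  equal ones remain to be compared.\<close>

lemma arrow_eqI:
  assumes "f \<in> chom V W" "g \<in> chom V W"
    and "\<And>w v. v \<in> dom V \<Longrightarrow> W w = V v \<Longrightarrow> mat f w v = mat g w v"
  shows "f = g"
proof -
  have "mat f w v = mat g w v" for w v
    using assms(3)[of v w] chom_nonzero(1,2)[OF assms(1), of w v]
      chom_nonzero(1,2)[OF assms(2), of w v] by fastforce
  then show ?thesis
    using assms(1,2) by (cases f; cases g) (auto simp: chom_def)
qed

lemma compm_chom:
  assumes "f \<in> chom U V" "g \<in> chom V W"
  shows "g \<bullet> f \<in> chom U W"
proof -
  have "u \<in> dom U \<and> W w = U u" if nz: "mat (g \<bullet> f) w u \<noteq> 0" for w u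
  proof -
    obtain v where "mat g w v * mat f v u \<noteq> 0"
      using nz unfolding mat_compm by (meson sum.neutral)
    then show ?thesis
      using chom_nonzero[OF assms(1), of v u] chom_nonzero[OF assms(2), of w v] by auto
  qed
  then show ?thesis
    using assms by (simp add: chom_def)
qed

text \<open>Both sides are double sums over the same index sets, the domains of \<open>tgt f\<close>
  and \<open>tgt g\<close>, so regrouping is legitimate for arbitrary arrows.\<close>

lemma compm_assoc: "(h \<bullet> g) \<bullet> f = h \<bullet> g \<bullet> f"
proof -
  have "mat ((h \<bullet> g) \<bullet> f) w u = mat (h \<bullet> g \<bullet> f) w u" for w u
  proof -
    have "mat ((h \<bullet> g) \<bullet> f) w u =
        (\<Sum>x\<in>dom (tgt f). \<Sum>v\<in>dom (tgt g). mat h w v * mat g v x * mat f x u)"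
      by (simp add: mat_compm sum_distrib_right)
    also have "\<dots> = (\<Sum>v\<in>dom (tgt g). \<Sum>x\<in>dom (tgt f). mat h w v * mat g v x * mat f x u)"
      by (rule sum.swap)
    also have "\<dots> = mat (h \<bullet> g \<bullet> f) w u"
      by (simp add: mat_compm sum_distrib_left mult.assoc)
    finally show ?thesis .
  qed
  then have "mat ((h \<bullet> g) \<bullet> f) = mat (h \<bullet> g \<bullet> f)"
    by blast
  then show ?thesis
    by (simp add: compm_def)
qed

text \<open>Collapses the sum over all middle labels to a parametrised family containing the
  support. The family may leave \<open>dom V\<close>, because rows of \<open>f\<close> outside
  \<open>dom V\<close> are zero.\<close>

lemma mat_compm_reindex:
  assumes f: "f \<in> chom U V" and fin: "finite (dom V)" "finite J" and inj: "inj_on h J"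
    and zero: "\<And>v. v \<notin> h ` J \<Longrightarrow> mat g w v * mat f v u = 0"
  shows "mat (g \<bullet> f) w u = (\<Sum>j\<in>J. mat g w (h j) * mat f (h j) u)"
proof -
  have "mat (g \<bullet> f) w u = (\<Sum>v\<in>dom V \<union> h ` J. mat g w v * mat f v u)"
    unfolding mat_compm chom_tgt[OF f]
  proof (rule sum.mono_neutral_left)
    show "\<forall>v\<in>dom V \<union> h ` J - dom V. mat g w v * mat f v u = 0"
      using chom_nonzero(3)[OF f, of _ u] by (metis DiffD2 mult_zero_right)
  qed (use fin in auto)
  also have "\<dots> = (\<Sum>v\<in>h ` J. mat g w v * mat f v u)"
    using fin zero by (intro sum.mono_neutral_right) auto
  also have "\<dots> = (\<Sum>j\<in>J. mat g w (h j) * mat f (h j) u)"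
    by (simp add: sum.reindex[OF inj])
  finally show ?thesis .
qed

lemma mat_compm_single:
  assumes "f \<in> chom U V" "finite (dom V)"
    and "\<And>v. v \<noteq> v0 \<Longrightarrow> mat g w v * mat f v u = 0"
  shows "mat (g \<bullet> f) w u = mat g w v0 * mat f v0 u"
  using mat_compm_reindex[OF assms(1,2), of "{v0}" "\<lambda>v. v" g w u] assms(3) by simp

lemma mat_compm_nonzero:
  assumes "mat (g \<bullet> f) w u \<noteq> 0"
  obtains v where "mat g w v \<noteq> 0" "mat f v u \<noteq> 0"
  using assms unfolding mat_compm by (metis (no_types, lifting) mult_zero_left mult_zero_right sum.neutral)

lemma compm_idm_left:
  assumes "f \<in> chom V W" "finite (dom W)"
  shows "idm W \<bullet> f = f"
proof (rule arrow_eqI[OF compm_chom[OF assms(1) idm_chom] assms(1)])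
  fix w v
  show "mat (idm W \<bullet> f) w v = mat f w v"
    using chom_nonzero(3)[OF assms(1), of w v]
    by (subst mat_compm_single[OF assms, of w]) (auto simp: mat_idm)
qed

lemma compm_idm_right:
  assumes "f \<in> chom V W" "finite (dom V)"
  shows "f \<bullet> idm V = f"
proof (rule arrow_eqI[OF compm_chom[OF idm_chom assms(1)] assms(1)])
  fix w v
  assume "v \<in> dom V"
  then show "mat (f \<bullet> idm V) w v = mat f w v"
    by (subst mat_compm_single[OF idm_chom assms(2), of v]) (auto simp: mat_idm)
qed

lemma sum_idm:
  assumes "finite (dom V)" "j' \<in> dom V"
  shows "(\<Sum>j\<in>dom V. mat (idm V) j' j * F j) = F j'"
proof -
  have "(\<Sum>j\<in>dom V. mat (idm V) j' j * F j) = (\<Sum>j\<in>dom V. if j' = j then F j else 0)"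
    by (rule sum.cong) (auto simp: mat_idm)
  then show ?thesis
    using assms by simp
qed

text \<open>Uniqueness allows any exhibited inverse to replace the definite description
  \<open>invm\<close>.\<close>

lemma is_inverse_unique:
  assumes f: "f \<in> chom V W" and fin: "finite (dom V)" "finite (dom W)"
    and g: "is_inverse f g" and h: "is_inverse f h"
  shows "g = h"
proof -
  have V: "src f = V" "tgt f = W"
    using f by (simp_all add: chom_def)
  have "g = g \<bullet> idm W"
    using g fin V by (subst compm_idm_right[of _ _ V]) (auto simp: is_inverse_def)
  also have "\<dots> = (g \<bullet> f) \<bullet> h"
    using h V by (simp add: is_inverse_def compm_assoc)
  also have "\<dots> = h"
    using g h V fin by (subst compm_idm_left[of _ W, symmetric]) (auto simp: is_inverse_def)
  finally show ?thesis .
qed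

lemma invm_eq:
  assumes "f \<in> chom V W" "finite (dom V)" "finite (dom W)" "is_inverse f g"
  shows "invm f = g"
  unfolding invm_def using is_inverse_unique[OF assms(1-3)] assms(4) by blast

section \<open>The group action on morphisms\<close>

lemma dom_act [simp]: "dom (act h V) = dom V"
  by (auto simp: act_def)

lemma act_One [simp]: "act One V = V"
proof
  show "act One V i = V i" for i
    by (cases "V i") (simp_all add: act_def)
qed

lemma sact_sact [simp]: "sact h (sact h A) = A"
  by (cases h; cases A) auto

lemma act_act [simp]: "act h (act h V) = V"
proof
  show "act h (act h V) i = V i" for i
    by (cases "V i") (simp_all add: act_def)
qed

lemma sact_inject [simp]: "sact h A = sact h B \<longleftrightarrow> A = B"
  by (metis sact_sact)

lemma act_eq_iff: "act h V w = act h W v \<longleftrightarrow> V w = W v"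
  by (cases "V w"; cases "W v") (auto simp: act_def)

lemma act_Some: "V i = Some A \<Longrightarrow> act h V i = Some (sact h A)"
  by (simp add: act_def)

lemma src_actm [simp]: "src (actm h f) = act h (src f)"
  and tgt_actm [simp]: "tgt (actm h f) = act h (tgt f)"
  and mat_actm [simp]: "mat (actm h f) = mat f"
  by (simp_all add: actm_def)

lemma actm_chom: "f \<in> chom V W \<Longrightarrow> actm h f \<in> chom (act h V) (act h W)"
  by (auto simp: chom_def act_eq_iff)

lemma actm_compm: "actm h (g \<bullet> f) = actm h g \<bullet> actm h f"
  by (simp add: actm_def compm_def)

lemma actm_idm: "actm h (idm V) = idm (act h V)"
  using actm_chom[OF idm_chom] by (rule arrow_eqI) (auto simp: mat_idm)

section \<open>Isomorphism classes in the equivariantisation\<close>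

lemma ehom_chom: "f \<in> ehom X Y \<Longrightarrow> f \<in> chom (und X) (und Y)"
  by (simp add: ehom_def)

lemma is_eobj_finite: "is_eobj X \<Longrightarrow> finite (dom (und X))"
  by (simp add: is_eobj_def is_cobj_def)

lemma is_eobj_chom: "is_eobj X \<Longrightarrow> eqv X \<in> chom (act Gen (und X)) (und X)"
  by (simp add: is_eobj_def)

lemma ehom_compm:
  assumes "f \<in> ehom X Y" "g \<in> ehom Y Z"
  shows "g \<bullet> f \<in> ehom X Z"
proof -
  have "eqv Z \<bullet> actm Gen (g \<bullet> f) = (eqv Z \<bullet> actm Gen g) \<bullet> actm Gen f"
    by (simp add: actm_compm compm_assoc)
  also have "\<dots> = g \<bullet> eqv Y \<bullet> actm Gen f"
    using assms(2) by (simp add: ehom_def compm_assoc)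
  also have "\<dots> = (g \<bullet> f) \<bullet> eqv X"
    using assms(1) by (simp add: ehom_def compm_assoc)
  finally show ?thesis
    using compm_chom[OF assms[THEN ehom_chom]] by (simp add: ehom_def)
qed

lemma idm_ehom:
  assumes "is_eobj X"
  shows "idm (und X) \<in> ehom X X"
  using compm_idm_right[OF is_eobj_chom[OF assms]] compm_idm_left[OF is_eobj_chom[OF assms]]
    is_eobj_finite[OF assms]
  by (simp add: ehom_def actm_idm)

lemma is_eiso_refl:
  assumes "is_eobj X"
  shows "is_eiso X X (idm (und X))"
  using idm_ehom[OF assms] compm_idm_left[OF idm_chom is_eobj_finite[OF assms]]
  unfolding is_eiso_def is_inverse_def by (intro conjI bexI[of _ "idm (und X)"]) simp_all

lemma is_eisoI:
  assumes "f \<in> ehom X Y" "g \<in> ehom Y X" "g \<bullet> f = idm (und X)" "f \<bullet> g = idm (und Y)"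
  shows "is_eiso X Y f"
proof -
  have "is_inverse f g"
    using assms ehom_chom[OF assms(2)]
      chom_src[OF ehom_chom[OF assms(1)]] chom_tgt[OF ehom_chom[OF assms(1)]]
    by (simp add: is_inverse_def)
  then show ?thesis
    using assms(1,2) unfolding is_eiso_def by blast
qed

lemma is_eisoE:
  assumes "is_eiso X Y f"
  obtains g where "f \<in> ehom X Y" "g \<in> ehom Y X" "g \<bullet> f = idm (und X)" "f \<bullet> g = idm (und Y)"
proof -
  obtain g where g: "f \<in> ehom X Y" "g \<in> ehom Y X" "is_inverse f g"
    using assms unfolding is_eiso_def by blast
  then show thesis
    using that[of g] chom_src[OF ehom_chom[OF g(1)]] chom_tgt[OF ehom_chom[OF g(1)]]
    by (simp add: is_inverse_def)
qed

lemma eisomorphic_sym: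
  assumes "eisomorphic X Y"
  shows "eisomorphic Y X"
  using assms unfolding eisomorphic_def by (blast elim: is_eisoE intro: is_eisoI)

lemma eisomorphic_trans:
  assumes "is_eobj X" "is_eobj Z" "eisomorphic X Y" "eisomorphic Y Z"
  shows "eisomorphic X Z"
proof -
  obtain f g where f: "f \<in> ehom X Y" "g \<in> ehom Y X" "g \<bullet> f = idm (und X)" "f \<bullet> g = idm (und Y)"
    using assms(3) unfolding eisomorphic_def by (blast elim: is_eisoE)
  obtain h k where h: "h \<in> ehom Y Z" "k \<in> ehom Z Y" "k \<bullet> h = idm (und Y)" "h \<bullet> k = idm (und Z)"
    using assms(4) unfolding eisomorphic_def by (blast elim: is_eisoE)
  note fc = f(1,2)[THEN ehom_chom] and hc = h(1,2)[THEN ehom_chom]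
  \<comment> \<open>\<open>und Y\<close> is not known to be finite here, so its identity is absorbed
    by writing it as \<open>f \<bullet> g\<close> or \<open>k \<bullet> h\<close> and moving the
    cancellation to \<open>X\<close> and \<open>Z\<close>.\<close>
  have l: "idm (und Y) \<bullet> f = f" "idm (und Y) \<bullet> k = k"
  proof -
    have "(f \<bullet> g) \<bullet> f = f"
      unfolding compm_assoc f(3) using compm_idm_right[OF fc(1)] is_eobj_finite[OF assms(1)] by simp
    then show "idm (und Y) \<bullet> f = f"
      by (simp add: f)
    have "(k \<bullet> h) \<bullet> k = k"
      unfolding compm_assoc h(4) using compm_idm_right[OF hc(2)] is_eobj_finite[OF assms(2)] by simp
    then show "idm (und Y) \<bullet> k = k"
      by (simp add: h)
  qed
  have "(g \<bullet> k) \<bullet> (h \<bullet> f) = g \<bullet> (k \<bullet> h) \<bullet> f"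
    by (simp only: compm_assoc)
  moreover have "(h \<bullet> f) \<bullet> (g \<bullet> k) = h \<bullet> (f \<bullet> g) \<bullet> k"
    by (simp only: compm_assoc)
  ultimately have "is_eiso X Z (h \<bullet> f)"
    using f h l ehom_compm[OF f(1) h(1)] ehom_compm[OF h(2) f(2)]
    by (intro is_eisoI[where g = "g \<bullet> k"]) simp_all
  then show ?thesis
    unfolding eisomorphic_def by blast
qed

lemma eisomorphic_refl: "is_eobj X \<Longrightarrow> eisomorphic X X"
  using is_eiso_refl unfolding eisomorphic_def by blast

lemma iso_class_eq_iff:
  assumes "is_eobj X" "is_eobj Y"
  shows "iso_class X = iso_class Y \<longleftrightarrow> eisomorphic X Y"
proof
  assume "iso_class X = iso_class Y"
  then show "eisomorphic X Y"
    using assms eisomorphic_refl[of Y] by (auto simp: iso_class_def)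
next
  assume "eisomorphic X Y"
  then show "iso_class X = iso_class Y"
    using assms eisomorphic_trans eisomorphic_sym unfolding iso_class_def by blast
qed

section \<open>The simple objects\<close>

text \<open>Covers \<open>Xobj\<close>, \<open>Zobj\<close> and the unit at once: all of them carry
  a single simple object and a scalar as equivariant structure.\<close>

definition Sobj :: "'g::ab_group_add simple \<Rightarrow> complex \<Rightarrow> 'g eobj" where
  "Sobj A s = \<lparr>und = [Atom 0 \<mapsto> A],
     eqv = arr (act Gen [Atom 0 \<mapsto> A]) [Atom 0 \<mapsto> A] (\<lambda>w v. if w = v then s else 0)\<rparr>"

lemma Xobj_eq: "Xobj a s = Sobj (Cob a) s"
  by (simp add: Xobj_def Sobj_def Let_def)

lemma Zobj_eq: "Zobj x s = Sobj (Xob x) s"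
  by (simp add: Zobj_def Sobj_def Let_def)

lemma eunit_eq: "eunit = Sobj (Cob 0) 1"
  by (simp add: eunit_def Sobj_def cunit_def)

lemma und_Sobj [simp]: "und (Sobj A s) = [Atom 0 \<mapsto> A]"
  by (simp add: Sobj_def)

lemma eqv_Sobj_chom:
  "eqv (Sobj A s) \<in> chom (act Gen [Atom 0 \<mapsto> A]) [Atom 0 \<mapsto> A]"
  by (simp add: Sobj_def)

lemma mat_eqv_Sobj:
  assumes "sact Gen A = A"
  shows "mat (eqv (Sobj A s)) w v = (if w = Atom 0 \<and> v = Atom 0 then s else 0)"
  using assms by (auto simp: Sobj_def mat_arr act_def)

lemma und_Yobj: "und (Yobj a) = [Atom 0 \<mapsto> Cob a, Atom 1 \<mapsto> Cob (- a)]"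
  by (simp add: Yobj_def Let_def)

lemma dom_und_Yobj [simp]: "dom (und (Yobj a)) = {Atom 0, Atom 1}"
  by (auto simp: und_Yobj)

lemma und_Yobj_0 [simp]: "und (Yobj a) (Atom 0) = Some (Cob a)"
  and und_Yobj_1 [simp]: "und (Yobj a) (Atom (Suc 0)) = Some (Cob (- a))"
  by (simp_all add: und_Yobj)

lemma und_Yobj_Some_iff:
  "und (Yobj a) v = Some A \<longleftrightarrow> v = Atom 0 \<and> A = Cob a \<or> v = Atom 1 \<and> A = Cob (- a)"
  by (auto simp: und_Yobj)

lemma eqv_Yobj_chom: "eqv (Yobj a) \<in> chom (act Gen (und (Yobj a))) (und (Yobj a))"
  by (simp add: Yobj_def Let_def)

lemma mat_eqv_Yobj:
  "mat (eqv (Yobj a)) w v =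
     (if w = Atom 0 \<and> v = Atom 1 \<or> w = Atom 1 \<and> v = Atom 0 then 1 else 0)"
  by (auto simp: Yobj_def Let_def mat_arr act_def)

lemma not_tors2_iff: "a \<notin> tors2 \<longleftrightarrow> - a \<noteq> a"
  by (simp add: tors2_def) (metis add.commute add_eq_0_iff)

text \<open>The involution condition already provides the inverse of \<phi>, namely its image under
  the action; acting on the condition once more gives the composite in the other order.\<close>

lemma is_eobjI:
  assumes "is_cobj (und X)" "eqv X \<in> chom (act Gen (und X)) (und X)"
    and "eqv X \<bullet> actm Gen (eqv X) = idm (und X)"
  shows "is_eobj X"
proof -
  have "actm Gen (eqv X) \<bullet> actm Gen (actm Gen (eqv X)) = idm (act Gen (und X))"
    using arg_cong[OF assms(3), of "actm Gen"] by (simp add: actm_compm actm_idm)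
  moreover have "actm Gen (actm Gen (eqv X)) = eqv X"
    by (simp add: actm_def)
  ultimately have "is_inverse (eqv X) (actm Gen (eqv X))"
    using assms actm_chom[OF assms(2), of Gen] by (simp add: is_inverse_def chom_src chom_tgt)
  then show ?thesis
    using assms by (auto simp: is_eobj_def)
qed

text \<open>\<open>Xob\<close> accepts any set of group elements; only cosets of 2\<Gamma> give
  simple objects of the category.\<close>

definition csimple :: "'g::ab_group_add simple \<Rightarrow> bool" where
  "csimple A \<longleftrightarrow> A \<in> range Cob \<union> Xob ` cosets2"

lemma csimple_Cob [simp]: "csimple (Cob a)"
  and csimple_Xob [simp]: "csimple (Xob x) \<longleftrightarrow> x \<in> cosets2"
  by (auto simp: csimple_def)

lemma is_eobj_csimple: "is_eobj V \<Longrightarrow> und V i = Some A \<Longrightarrow> csimple A"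
  by (auto simp: is_eobj_def is_cobj_def csimple_def ran_def)

lemma is_eobj_Sobj:
  assumes "sact Gen A = A" "csimple A" "s \<in> {1, -1}"
  shows "is_eobj (Sobj A s)"
proof (rule is_eobjI)
  show "is_cobj (und (Sobj A s))"
    using assms by (auto simp: is_cobj_def csimple_def)
  show c: "eqv (Sobj A s) \<in> chom (act Gen (und (Sobj A s))) (und (Sobj A s))"
    using eqv_Sobj_chom by simp
  have a: "actm Gen (eqv (Sobj A s)) \<in> chom (und (Sobj A s)) (act Gen (und (Sobj A s)))"
    using actm_chom[OF c, of Gen] by simp
  show "eqv (Sobj A s) \<bullet> actm Gen (eqv (Sobj A s)) = idm (und (Sobj A s))"
  proof (rule arrow_eqI[OF compm_chom[OF a c] idm_chom])
    fix w v
    show "mat (eqv (Sobj A s) \<bullet> actm Gen (eqv (Sobj A s))) w v = mat (idm (und (Sobj A s))) w v"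
      using assms by (subst mat_compm_single[OF a, of "Atom 0"]) (auto simp: mat_eqv_Sobj mat_idm)
  qed
qed

lemma is_eobj_Yobj: "is_eobj (Yobj a)"
proof (rule is_eobjI)
  show "is_cobj (und (Yobj a))"
    by (auto simp: is_cobj_def ran_def und_Yobj_Some_iff)
  note c = eqv_Yobj_chom[of a]
  show "eqv (Yobj a) \<in> chom (act Gen (und (Yobj a))) (und (Yobj a))"
    by (rule c)
  have a: "actm Gen (eqv (Yobj a)) \<in> chom (und (Yobj a)) (act Gen (und (Yobj a)))"
    using actm_chom[OF c, of Gen] by simp
  show "eqv (Yobj a) \<bullet> actm Gen (eqv (Yobj a)) = idm (und (Yobj a))"
  proof (rule arrow_eqI[OF compm_chom[OF a c] idm_chom])
    fix w v
    show "mat (eqv (Yobj a) \<bullet> actm Gen (eqv (Yobj a))) w v = mat (idm (und (Yobj a))) w v"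
      by (auto simp: mat_compm chom_tgt[OF c] mat_eqv_Yobj mat_idm)
  qed
qed

text \<open>The candidates for the simple objects, split by whether the action fixes the underlying
  simple object. No crossed data appear, since the action on single objects does not involve
  them.\<close>

inductive elementary :: "'g::ab_group_add eobj \<Rightarrow> bool" where
  Sobj: "\<lbrakk>sact Gen A = A; csimple A; s \<in> {1, -1}\<rbrakk> \<Longrightarrow> elementary (Sobj A s)"
| Yobj: "a \<notin> tors2 \<Longrightarrow> elementary (Yobj a)"

lemma elementary_is_eobj: "elementary T \<Longrightarrow> is_eobj T"
  by (auto elim!: elementary.cases intro: is_eobj_Sobj is_eobj_Yobj)

subsection \<open>Schur's lemma\<close>

lemma ehom_eqv_entry:
  assumes "g \<in> ehom T S"
  shows "mat (eqv S \<bullet> actm Gen g) w v = mat (g \<bullet> eqv T) w v"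
  using assms by (simp add: ehom_def)

text \<open>Such a morphism is a scalar c between equal simple objects, and equivariance reads t c =
  c s; hence c \<noteq> 0 forces s = t, and 1/c gives the inverse.\<close>

lemma Sobj_schur:
  assumes A: "sact Gen A = A" "csimple A" "s \<in> {1, -1}" and B: "sact Gen B = B"
    and g: "g \<in> ehom (Sobj A s) (Sobj B t)" "mat g w v \<noteq> 0"
  shows "B = A" "t = s" "is_eiso (Sobj A s) (Sobj B t) g"
proof -
  note gc = ehom_chom[OF g(1)]
  have wv: "w = Atom 0" "v = Atom 0"
    using chom_nonzero[OF gc g(2)] by auto
  then show BA: "B = A"
    using chom_nonzero(2)[OF gc g(2)] by simp
  define c where "c = mat g (Atom 0) (Atom 0)"
  have c: "c \<noteq> 0"
    using g(2) wv by (simp add: c_def)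
  have mg: "mat g w v = (if w = Atom 0 \<and> v = Atom 0 then c else 0)" for w v
  proof (cases "mat g w v = 0")
    case False
    then show ?thesis
      using chom_nonzero(1,3)[OF gc False] by (simp add: c_def split: if_splits)
  qed (auto simp: c_def)
  have "t * c = c * s"
    using ehom_eqv_entry[OF g(1), of "Atom 0" "Atom 0"] BA A(1)
    by (simp add: mat_compm mg mat_eqv_Sobj chom_tgt[OF eqv_Sobj_chom] chom_tgt[OF gc])
  then show ts: "t = s"
    using c by simp
  define h where "h = arr [Atom 0 \<mapsto> A] [Atom 0 \<mapsto> A] (\<lambda>_ _. inverse c)"
  have hc: "h \<in> chom [Atom 0 \<mapsto> A] [Atom 0 \<mapsto> A]"
    by (simp add: h_def)
  have mh: "mat h w v = (if w = Atom 0 \<and> v = Atom 0 then inverse c else 0)" for w v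
    by (auto simp: h_def mat_arr split: if_splits)
  have gc': "g \<in> chom [Atom 0 \<mapsto> A] [Atom 0 \<mapsto> A]"
    using gc BA by simp
  have "eqv (Sobj A s) \<bullet> actm Gen h = h \<bullet> eqv (Sobj A s)"
    by (rule arrow_eqI[OF compm_chom[OF actm_chom[OF hc] eqv_Sobj_chom]
          compm_chom[OF eqv_Sobj_chom hc]])
      (auto simp: mat_compm mh mat_eqv_Sobj[OF A(1)] chom_tgt[OF eqv_Sobj_chom] chom_tgt[OF hc])
  then have he: "h \<in> ehom (Sobj A s) (Sobj A s)"
    using hc by (simp add: ehom_def)
  have "h \<bullet> g = idm [Atom 0 \<mapsto> A]"
    by (rule arrow_eqI[OF compm_chom[OF gc' hc] idm_chom])
      (use c in \<open>auto simp: mat_compm mg mh mat_idm chom_tgt[OF gc']\<close>)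
  moreover have "g \<bullet> h = idm [Atom 0 \<mapsto> A]"
    by (rule arrow_eqI[OF compm_chom[OF hc gc'] idm_chom])
      (use c in \<open>auto simp: mat_compm mg mh mat_idm chom_tgt[OF hc]\<close>)
  ultimately show "is_eiso (Sobj A s) (Sobj B t) g"
    using g(1) he BA ts by (intro is_eisoI[where g = h]) simp_all
qed

text \<open>Equivariance means commuting with the interchange, so a morphism is p times the identity
  matrix plus r times the interchange matrix; a \<noteq> -a excludes that both p and r are
  nonzero.\<close>

lemma Yobj_schur:
  assumes a: "a \<notin> tors2" and g: "g \<in> ehom (Yobj a) (Yobj b)" "mat g w v \<noteq> 0"
  shows "b = a \<or> b = - a" "is_eiso (Yobj a) (Yobj b) g"
proof -
  note gc = ehom_chom[OF g(1)]
  have na: "- a \<noteq> a" "a \<noteq> - a"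
    using a by (auto simp: not_tors2_iff)
  show ba: "b = a \<or> b = - a"
    using chom_nonzero[OF gc g(2)] by (auto simp: minus_equation_iff[of b])
  have g11: "mat g (Atom 1) (Atom 1) = mat g (Atom 0) (Atom 0)"
    and g01: "mat g (Atom 0) (Atom 1) = mat g (Atom 1) (Atom 0)"
    using ehom_eqv_entry[OF g(1), of "Atom 0" "Atom 1"] ehom_eqv_entry[OF g(1), of "Atom 0" "Atom 0"]
    by (simp_all add: mat_compm mat_eqv_Yobj chom_tgt[OF eqv_Yobj_chom] chom_tgt[OF gc])
  define p where "p = mat g (Atom 0) (Atom 0)"
  define r where "r = mat g (Atom 0) (Atom 1)"
  have gz: "mat g w v = 0" if "w \<notin> {Atom 0, Atom 1} \<or> v \<notin> {Atom 0, Atom 1}" for w v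
    using chom_nonzero(1,3)[OF gc, of w v] that unfolding dom_und_Yobj by blast
  have mg: "mat g w v = (if w = Atom 0 \<and> v = Atom 0 \<or> w = Atom 1 \<and> v = Atom 1 then p
      else if w = Atom 0 \<and> v = Atom 1 \<or> w = Atom 1 \<and> v = Atom 0 then r else 0)" for w v
    using gz[of w v] g11 g01 by (auto simp: p_def r_def)
  have pb: "p \<noteq> 0 \<Longrightarrow> b = a"
    using chom_nonzero(2)[OF gc, of "Atom 0" "Atom 0"] by (simp add: p_def)
  have rb: "r \<noteq> 0 \<Longrightarrow> b = - a"
    using chom_nonzero(2)[OF gc, of "Atom 0" "Atom 1"] by (simp add: r_def)
  have nz: "p \<noteq> 0 \<or> r \<noteq> 0"
    using g(2) mg by (auto split: if_splits)
  have pr: "p = 0 \<or> r = 0"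
    using pb rb na by auto
  \<comment> \<open>With only one of p and r nonzero, the inverse matrix has the same shape, which
    also makes it equivariant.\<close>
  define p' where "p' = (if b = a then inverse p else 0)"
  define r' where "r' = (if b = a then 0 else inverse r)"
  define h where "h = arr (und (Yobj b)) (und (Yobj a)) (\<lambda>w v. if w = v then p' else r')"
  have hc: "h \<in> chom (und (Yobj b)) (und (Yobj a))"
    by (simp add: h_def)
  have mh: "mat h w v = (if w = Atom 0 \<and> v = Atom 0 \<or> w = Atom 1 \<and> v = Atom 1 then p'
      else if w = Atom 0 \<and> v = Atom 1 \<or> w = Atom 1 \<and> v = Atom 0 then r' else 0)" for w v
    using ba na by (auto simp: h_def mat_arr und_Yobj p'_def r'_def)
  have "eqv (Yobj a) \<bullet> actm Gen h = h \<bullet> eqv (Yobj b)"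
    by (rule arrow_eqI[OF compm_chom[OF actm_chom[OF hc] eqv_Yobj_chom]
          compm_chom[OF eqv_Yobj_chom hc]])
      (auto simp: mat_compm mh mat_eqv_Yobj chom_tgt[OF eqv_Yobj_chom] chom_tgt[OF hc])
  then have he: "h \<in> ehom (Yobj b) (Yobj a)"
    using hc by (simp add: ehom_def)
  have inv: "p' * p + r' * r = 1" "p' * r + r' * p = 0" "p * p' + r * r' = 1" "p * r' + r * p' = 0"
    using nz pr pb rb na by (auto simp: p'_def r'_def)
  have "h \<bullet> g = idm (und (Yobj a))"
    by (rule arrow_eqI[OF compm_chom[OF gc hc] idm_chom])
      (use inv in \<open>auto simp: mat_compm mg mh mat_idm chom_tgt[OF gc] add.commute\<close>)
  moreover have "g \<bullet> h = idm (und (Yobj b))"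
    by (rule arrow_eqI[OF compm_chom[OF hc gc] idm_chom])
      (use inv in \<open>auto simp: mat_compm mg mh mat_idm chom_tgt[OF hc] add.commute\<close>)
  ultimately show "is_eiso (Yobj a) (Yobj b) g"
    using g(1) he by (intro is_eisoI[where g = h])
qed

lemma Sobj_Yobj_schur:
  assumes "sact Gen A = A" "a \<notin> tors2"
  shows "g \<in> ehom (Sobj A s) (Yobj a) \<Longrightarrow> mat g w v = 0"
    and "g \<in> ehom (Yobj a) (Sobj A s) \<Longrightarrow> mat g w v = 0"
proof -
  have A: "A \<noteq> Cob a" "A \<noteq> Cob (- a)"
    using assms by (auto simp: not_tors2_iff)
  show "mat g w v = 0" if "g \<in> ehom (Sobj A s) (Yobj a)"
  proof (rule ccontr)
    assume "mat g w v \<noteq> 0"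
    from chom_nonzero(1,2)[OF ehom_chom[OF that] this] have "und (Yobj a) w = Some A"
      by (auto split: if_splits)
    then show False
      using A by (simp add: und_Yobj_Some_iff)
  qed
  show "mat g w v = 0" if "g \<in> ehom (Yobj a) (Sobj A s)"
  proof (rule ccontr)
    assume "mat g w v \<noteq> 0"
    from chom_nonzero(2,3)[OF ehom_chom[OF that] this] have "und (Yobj a) v = Some A"
      by (auto split: if_splits)
    then show False
      using A by (simp add: und_Yobj_Some_iff)
  qed
qed

lemma elementary_schur:
  assumes "elementary T" "elementary S" "g \<in> ehom T S" "mat g w v \<noteq> 0"
  shows "is_eiso T S g"
  using assms(1,2)
proof (cases rule: elementary.cases[case_product elementary.cases])
  case (Sobj_Sobj A s B t)
  then show ?thesis using assms Sobj_schur(3)[of A s B g t w v] by simp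
next
  case (Sobj_Yobj A s a)
  then show ?thesis using assms Sobj_Yobj_schur(1)[of A a g s w v] by simp
next
  case (Yobj_Sobj a A s)
  then show ?thesis using assms Sobj_Yobj_schur(2)[of A a g s w v] by simp
next
  case (Yobj_Yobj a b)
  then show ?thesis using assms Yobj_schur(2)[of a g b w v] by simp
qed

subsection \<open>Every nonzero object contains an elementary one\<close>

lemma eqv_involution:
  assumes "is_eobj V"
  shows "(\<Sum>x\<in>dom (und V). mat (eqv V) w x * mat (eqv V) x v) =
    (if w = v \<and> v \<in> dom (und V) then 1 else 0)"
proof -
  have "mat (eqv V \<bullet> actm Gen (eqv V)) w v = mat (idm (und V)) w v"
    using assms by (simp add: is_eobj_def)
  then show ?thesis
    by (simp add: mat_compm mat_idm chom_tgt[OF is_eobj_chom[OF assms]])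
qed

lemma exists_mono_generic:
  assumes V: "is_eobj V" "und V i = Some (Cob a)" and a: "a \<notin> tors2"
  shows "\<exists>m. emono (Yobj a) V m"
proof -
  note ec = is_eobj_chom[OF V(1)] and fin = is_eobj_finite[OF V(1)]
  have na: "- a \<noteq> a"
    using a by (simp add: not_tors2_iff)
  have i: "i \<in> dom (und V)"
    using V(2) by auto
  \<comment> \<open>Column 0 is the basis vector at \<open>i\<close> and column 1 its image under
    \<phi>, so interchanging the columns amounts to applying \<phi>.\<close>
  define m where "m = arr (und (Yobj a)) (und V)
    (\<lambda>w v. if v = Atom 0 then (if w = i then 1 else 0) else mat (eqv V) w i)"
  have mc: "m \<in> chom (und (Yobj a)) (und V)"
    by (simp add: m_def)
  have m0: "mat m w (Atom 0) = (if w = i then 1 else 0)" for w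
    using V(2) by (auto simp: m_def mat_arr)
  have m1: "mat m w (Atom 1) = mat (eqv V) w i" for w
    using chom_nonzero(2)[OF ec, of w i] V(2) act_Some[of "und V" i _ Gen, OF V(2)] by (auto simp: m_def mat_arr)
  have mo: "mat m w v = 0" if "v \<notin> {Atom 0, Atom 1}" for w v
    using chom_nonzero(1)[OF mc, of w v] that unfolding dom_und_Yobj by blast
  \<comment> \<open>Since \<phi> has no entry from \<open>i\<close> to itself, row \<open>i\<close>
    of \<open>m\<close> isolates the first coordinate of a morphism into
    \<open>Yobj a\<close>.\<close>
  have eii: "mat (eqv V) i i = 0"
    using chom_nonzero(2)[OF ec, of i i] na act_Some[of "und V" i _ Gen, OF V(2)] V(2) by fastforce
  have "eqv V \<bullet> actm Gen m = m \<bullet> eqv (Yobj a)"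
  proof (rule arrow_eqI[OF compm_chom[OF actm_chom[OF mc] ec] compm_chom[OF eqv_Yobj_chom mc]])
    fix w v
    assume "v \<in> dom (act Gen (und (Yobj a)))"
    then consider "v = Atom 0" | "v = Atom 1"
      by auto
    then show "mat (eqv V \<bullet> actm Gen m) w v = mat (m \<bullet> eqv (Yobj a)) w v"
    proof cases
      case 1
      have "mat (eqv V \<bullet> actm Gen m) w v = mat (eqv V) w i"
        using fin i by (simp add: mat_compm chom_tgt[OF mc] 1 m0 if_distrib cong: if_cong)
      moreover have "mat (m \<bullet> eqv (Yobj a)) w v = mat (eqv V) w i"
        using m1[of w] by (simp add: mat_compm chom_tgt[OF eqv_Yobj_chom] mat_eqv_Yobj 1)
      ultimately show ?thesis by simp
    next
      case 2
      have "mat (eqv V \<bullet> actm Gen m) w v = (if w = i then 1 else 0)"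
        using eqv_involution[OF V(1), of w i] i m1 by (simp add: mat_compm chom_tgt[OF mc] 2)
      moreover have "mat (m \<bullet> eqv (Yobj a)) w v = (if w = i then 1 else 0)"
        by (simp add: mat_compm chom_tgt[OF eqv_Yobj_chom] mat_eqv_Yobj 2 m0)
      ultimately show ?thesis by simp
    qed
  qed
  then have me: "m \<in> ehom (Yobj a) V"
    using mc by (simp add: ehom_def)
  have "f = g" if U: "is_eobj U" and f: "f \<in> ehom U (Yobj a)" and g: "g \<in> ehom U (Yobj a)"
    and eq: "m \<bullet> f = m \<bullet> g" for U f g
  proof -
    note fc = ehom_chom[OF f] and gc = ehom_chom[OF g]
    have mf: "mat (m \<bullet> h) w u = (if w = i then 1 else 0) * mat h (Atom 0) u
        + mat (eqv V) w i * mat h (Atom 1) u" if "h \<in> chom (und U) (und (Yobj a))" for h w u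
      using m1[of w] by (simp add: mat_compm chom_tgt[OF that] m0)
    have 0: "mat f (Atom 0) u = mat g (Atom 0) u" for u
      using mf[OF fc, of i u] mf[OF gc, of i u] eq eii by simp
    have 1: "mat f (Atom 1) u = mat g (Atom 1) u" for u
    proof -
      \<comment> \<open>Column \<open>i\<close> of \<phi> is nonzero because \<phi> is an
        involution; a row where it does not vanish recovers the second coordinate.\<close>
      obtain w where "mat (eqv V) w i \<noteq> 0"
        using eqv_involution[OF V(1), of i i] i
        by (metis (no_types, lifting) mult_zero_right sum.neutral zero_neq_one)
      then show ?thesis
        using mf[OF fc, of w u] mf[OF gc, of w u] eq 0[of u] by simp
    qed
    show ?thesis
      using 0 1 by (intro arrow_eqI[OF fc gc]) (auto simp: und_Yobj split: if_splits)
  qed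
  then show ?thesis
    using me unfolding emono_def by blast
qed

lemma exists_mono_fixed:
  assumes V: "is_eobj V" "und V i = Some A" and A: "sact Gen A = A"
  shows "\<exists>s\<in>{1, -1}. \<exists>m. emono (Sobj A s) V m"
proof -
  note ec = is_eobj_chom[OF V(1)] and fin = is_eobj_finite[OF V(1)]
  have i: "i \<in> dom (und V)"
    using V(2) by auto
  \<comment> \<open>This is e_i + s \<phi>(e_i), an eigenvector for s because \<phi> is an
    involution. Its coordinates at \<open>i\<close> for s = 1 and s = -1 add up to 2, so one of them
    is nonzero.\<close>
  define vec where "vec s w = (if w = i then 1 else 0) + s * mat (eqv V) w i" for s w
  have "vec 1 i + vec (-1) i = 2"
    by (simp add: vec_def)
  then obtain s where s: "s \<in> {1, -1}" "vec s i \<noteq> 0"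
    by (metis add.right_neutral insertI1 insertI2 zero_neq_numeral)
  have vA: "und V w = Some A" if "vec s w \<noteq> 0" for w
  proof (cases "w = i")
    case False
    then have "mat (eqv V) w i \<noteq> 0"
      using that by (simp add: vec_def)
    then show ?thesis
      using chom_nonzero(2)[OF ec] act_Some[of "und V" i _ Gen, OF V(2)] A by simp
  qed (use V(2) in simp)
  have ev: "(\<Sum>x\<in>dom (und V). mat (eqv V) w x * vec s x) = s * vec s w" for w
  proof -
    have "(\<Sum>x\<in>dom (und V). mat (eqv V) w x * vec s x) =
        (\<Sum>x\<in>dom (und V). (if x = i then mat (eqv V) w x else 0))
        + s * (\<Sum>x\<in>dom (und V). mat (eqv V) w x * mat (eqv V) x i)"
      unfolding sum_distrib_left sum.distrib[symmetric]
      by (rule sum.cong) (auto simp: vec_def algebra_simps)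
    also have "\<dots> = mat (eqv V) w i + s * (if w = i then 1 else 0)"
      using fin i by (simp add: eqv_involution[OF V(1)])
    also have "\<dots> = s * vec s w"
      using s(1) by (auto simp: vec_def algebra_simps)
    finally show ?thesis .
  qed
  define m where "m = arr [Atom 0 \<mapsto> A] (und V) (\<lambda>w v. vec s w)"
  have mc: "m \<in> chom [Atom 0 \<mapsto> A] (und V)"
    by (simp add: m_def)
  have mm: "mat m w v = (if v = Atom 0 then vec s w else 0)" for w v
    using vA[of w] by (auto simp: m_def mat_arr)
  have "eqv V \<bullet> actm Gen m = m \<bullet> eqv (Sobj A s)"
    by (rule arrow_eqI[OF compm_chom[OF actm_chom[OF mc] ec] compm_chom[OF eqv_Sobj_chom mc]])
      (auto simp: mat_compm chom_tgt[OF mc] chom_tgt[OF eqv_Sobj_chom] mm ev mat_eqv_Sobj[OF A])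
  then have me: "m \<in> ehom (Sobj A s) V"
    using mc by (simp add: ehom_def)
  have "f = g" if U: "is_eobj U" and f: "f \<in> ehom U (Sobj A s)" and g: "g \<in> ehom U (Sobj A s)"
    and eq: "m \<bullet> f = m \<bullet> g" for U f g
  proof (rule arrow_eqI[OF ehom_chom[OF f] ehom_chom[OF g]])
    fix w u
    assume u: "u \<in> dom (und U)" "und (Sobj A s) w = und U u"
    then have "w = Atom 0"
      by (auto split: if_splits)
    moreover have "mat (m \<bullet> h) i u = vec s i * mat h (Atom 0) u" if "h \<in> ehom U (Sobj A s)" for h
      by (simp add: mat_compm chom_tgt[OF ehom_chom[OF that]] mm)
    ultimately show "mat f w u = mat g w u"
      using s(2) f g eq by (metis mult_cancel_left)
  qed
  then have "emono (Sobj A s) V m"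
    using me unfolding emono_def by blast
  then show ?thesis
    using s(1) by blast
qed

lemma exists_elementary_mono:
  assumes "is_eobj V" "\<not> is_zero_obj V"
  obtains T m where "elementary T" "emono T V m"
proof -
  obtain i A where i: "und V i = Some A"
    using assms(2) unfolding is_zero_obj_def by (meson not_Some_eq ext)
  show ?thesis
  proof (cases "sact Gen A = A")
    case True
    then show ?thesis
      using exists_mono_fixed[OF assms(1) i] is_eobj_csimple[OF assms(1) i] elementary.Sobj that
      by blast
  next
    case False
    then obtain a where "A = Cob a" "a \<notin> tors2"
      by (cases A) (auto simp: not_tors2_iff)
    then show ?thesis
      using exists_mono_generic[OF assms(1)] i elementary.Yobj that by blast
  qed
qed

lemma elementary_nonzero: "elementary T \<Longrightarrow> \<not> is_zero_obj T"
  by (auto elim!: elementary.cases simp: is_zero_obj_def und_Yobj fun_eq_iff)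

text \<open>If the composite were zero, cancelling \<open>m\<close> against the zero morphism would
  give f = 0, and cancelling \<open>f\<close> would then make the identity of \<open>T\<close>
  zero.\<close>

lemma emono_nonzero:
  assumes T: "is_eobj T" "\<not> is_zero_obj T" and f: "emono T V f" and V: "is_eobj V"
    and U: "is_eobj U" and m: "emono V U m"
  obtains w v where "mat (m \<bullet> f) w v \<noteq> 0"
proof (rule ccontr)
  assume "\<not> thesis"
  then have mf0: "mat (m \<bullet> f) w v = 0" for w v
    using that by blast
  have fe: "f \<in> ehom T V" and me: "m \<in> ehom V U"
    using f m by (simp_all add: emono_def)
  define z where "z W = arr (und T) (und W) (\<lambda>_ _. 0)" for W :: "'a eobj"
  have zc: "z W \<in> chom (und T) (und W)" and zm: "mat (z W) w v = 0" for W w v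
    by (simp_all add: z_def mat_arr)
  have ze: "z W \<in> ehom T W" if "is_eobj W" for W
  proof -
    have "eqv W \<bullet> actm Gen (z W) = z W \<bullet> eqv T"
      by (rule arrow_eqI[OF compm_chom[OF actm_chom[OF zc] is_eobj_chom[OF that]]
            compm_chom[OF is_eobj_chom[OF T(1)] zc]]) (simp add: mat_compm zm)
    then show ?thesis
      using zc by (simp add: ehom_def)
  qed
  have "m \<bullet> f = m \<bullet> z V"
    by (rule arrow_eqI[OF compm_chom[OF ehom_chom[OF fe] ehom_chom[OF me]]
          compm_chom[OF zc ehom_chom[OF me]]]) (use mf0 in \<open>simp add: mat_compm[of m "z V"] zm\<close>)
  then have fz: "f = z V"
    using m T(1) fe ze[OF V] unfolding emono_def by blast
  have "f \<bullet> idm (und T) = f \<bullet> z T"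
    by (rule arrow_eqI[OF compm_chom[OF idm_chom ehom_chom[OF fe]]
          compm_chom[OF zc ehom_chom[OF fe]]]) (simp add: fz mat_compm zm)
  then have "idm (und T) = z T"
    using f T(1) idm_ehom[OF T(1)] ze[OF T(1)] unfolding emono_def by blast
  then have "mat (idm (und T)) w w = 0" for w
    by (simp add: zm)
  then have "w \<notin> dom (und T)" for w
    by (metis mat_idm zero_neq_one)
  then have "und T = Map.empty"
    by blast
  then show False
    using T(2) by (simp add: is_zero_obj_def)
qed

text \<open>An elementary object inside the subobject \<open>U\<close> maps to \<open>S\<close> by a
  nonzero composite, which Schur's lemma inverts. So \<open>m\<close> has a right inverse, and a
  monomorphism with a right inverse is an isomorphism.\<close>

lemma elementary_esimple:
  assumes S: "elementary S"
  shows "esimple S"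
proof -
  have "is_eiso U S m" if U: "is_eobj U" "\<not> is_zero_obj U" and m: "emono U S m" for U m
  proof -
    obtain T f where T: "elementary T" and f: "emono T U f"
      using exists_elementary_mono[OF U] by blast
    have fe: "f \<in> ehom T U" and me: "m \<in> ehom U S"
      using f m by (simp_all add: emono_def)
    obtain w v where "mat (m \<bullet> f) w v \<noteq> 0"
      using emono_nonzero[OF elementary_is_eobj[OF T] elementary_nonzero[OF T] f U(1)
          elementary_is_eobj[OF S] m] by blast
    then have "is_eiso T S (m \<bullet> f)"
      using elementary_schur[OF T S ehom_compm[OF fe me]] by blast
    then obtain h where h: "h \<in> ehom S T" "(m \<bullet> f) \<bullet> h = idm (und S)"
      by (blast elim: is_eisoE)
    have fh: "f \<bullet> h \<in> ehom S U"
      by (rule ehom_compm[OF h(1) fe])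
    \<comment> \<open>Cancelling \<open>m\<close> on the left of this equation turns its right
      inverse into a two-sided one.\<close>
    have "m \<bullet> (f \<bullet> h) \<bullet> m = ((m \<bullet> f) \<bullet> h) \<bullet> m"
      by (simp only: compm_assoc)
    also have "\<dots> = m \<bullet> idm (und U)"
      unfolding h(2) using ehom_chom[OF me] is_eobj_finite[OF elementary_is_eobj[OF S]]
        is_eobj_finite[OF U(1)] by (simp add: compm_idm_left compm_idm_right)
    finally have "(f \<bullet> h) \<bullet> m = idm (und U)"
      using m U(1) ehom_compm[OF me fh] idm_ehom[OF U(1)] unfolding emono_def by blast
    then show ?thesis
      using h(2) by (intro is_eisoI[OF me fh]) (simp_all only: compm_assoc)
  qed
  then show ?thesis
    unfolding esimple_def using elementary_is_eobj[OF S] elementary_nonzero[OF S] by blast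
qed

lemma esimple_elementary:
  assumes "esimple V"
  obtains T where "elementary T" "eisomorphic T V"
proof -
  obtain T m where T: "elementary T" "emono T V m"
    using exists_elementary_mono[of V] assms unfolding esimple_def by blast
  then have "is_eiso T V m"
    using assms elementary_is_eobj elementary_nonzero unfolding esimple_def by blast
  then show thesis
    using T that unfolding eisomorphic_def by blast
qed

subsection \<open>Isomorphisms between elementary objects\<close>

text \<open>Composing with the inverse produces a diagonal entry 1, so the isomorphism has a nonzero
  entry; this is the form in which Schur's lemma can be applied.\<close>

lemma eisomorphic_nonzero:
  assumes "is_eobj T" "\<not> is_zero_obj T" "eisomorphic T S"
  obtains g w v where "g \<in> ehom T S" "mat g w v \<noteq> 0"
proof -
  obtain g h where g: "g \<in> ehom T S" "h \<bullet> g = idm (und T)"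
    using assms(3) unfolding eisomorphic_def by (blast elim: is_eisoE)
  obtain v where v: "v \<in> dom (und T)"
    using assms(2) by (fastforce simp: is_zero_obj_def)
  then have "mat (h \<bullet> g) v v \<noteq> 0"
    by (simp add: g(2) mat_idm)
  then show thesis
    using that g(1) by (blast elim: mat_compm_nonzero)
qed

lemma eisomorphic_Sobj_iff:
  assumes "sact Gen A = A" "csimple A" "s \<in> {1, -1}" "sact Gen B = B"
  shows "eisomorphic (Sobj A s) (Sobj B t) \<longleftrightarrow> A = B \<and> s = t"
proof
  assume "eisomorphic (Sobj A s) (Sobj B t)"
  then show "A = B \<and> s = t"
    using eisomorphic_nonzero[OF is_eobj_Sobj[OF assms(1-3)] elementary_nonzero[OF elementary.Sobj[OF assms(1-3)]]]
      Sobj_schur(1,2)[OF assms] by metis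
qed (use assms eisomorphic_refl is_eobj_Sobj in blast)

lemma not_eisomorphic_Sobj_Yobj:
  assumes "sact Gen A = A" "csimple A" "s \<in> {1, -1}" "a \<notin> tors2"
  shows "\<not> eisomorphic (Sobj A s) (Yobj a)"
  using eisomorphic_nonzero[OF is_eobj_Sobj[OF assms(1-3)] elementary_nonzero[OF elementary.Sobj[OF assms(1-3)]]]
    Sobj_Yobj_schur(1)[OF assms(1,4)] by metis

lemma eisomorphic_Yobj_iff:
  assumes "a \<notin> tors2"
  shows "eisomorphic (Yobj a) (Yobj b) \<longleftrightarrow> b = a \<or> b = - a"
proof
  assume "eisomorphic (Yobj a) (Yobj b)"
  then show "b = a \<or> b = - a"
    using eisomorphic_nonzero[OF is_eobj_Yobj elementary_nonzero[OF elementary.Yobj[OF assms]]]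
      Yobj_schur(1)[OF assms] by metis
next
  have na: "- a \<noteq> a"
    using assms by (simp add: not_tors2_iff)
  \<comment> \<open>\<open>arr\<close> discards entries between different simple objects; as a
    \<noteq> -a, the constant matrix becomes the interchange of the two summands.\<close>
  define g where "g = arr (und (Yobj a)) (und (Yobj (- a))) (\<lambda>_ _. 1)"
  have gc: "g \<in> chom (und (Yobj a)) (und (Yobj (- a)))"
    by (simp add: g_def)
  have mg: "mat g w v = (if w = Atom 0 \<and> v = Atom 1 \<or> w = Atom 1 \<and> v = Atom 0 then 1 else 0)" for w v
    using na by (auto simp: g_def mat_arr und_Yobj)
  have "eqv (Yobj (- a)) \<bullet> actm Gen g = g \<bullet> eqv (Yobj a)"
    by (rule arrow_eqI[OF compm_chom[OF actm_chom[OF gc] eqv_Yobj_chom]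
          compm_chom[OF eqv_Yobj_chom gc]])
      (auto simp: mat_compm mg mat_eqv_Yobj chom_tgt[OF eqv_Yobj_chom] chom_tgt[OF gc])
  then have "is_eiso (Yobj a) (Yobj (- a)) g"
    using gc mg[of "Atom 0" "Atom 1"]
    by (intro Yobj_schur(2)[OF assms, of _ _ "Atom 0" "Atom 1"]) (auto simp: ehom_def)
  then show "b = a \<or> b = - a \<Longrightarrow> eisomorphic (Yobj a) (Yobj b)"
    using eisomorphic_refl[OF is_eobj_Yobj] unfolding eisomorphic_def by blast
qed

section \<open>Tensor products\<close>

lemma finite_UNIV_simple [simp]: "finite (A :: 'g::finite simple set)"
proof -
  have "(UNIV :: 'g simple set) = range Cob \<union> range Xob"
    by (auto intro: simple.exhaust)
  moreover have "finite (range (Cob :: 'g \<Rightarrow> _) \<union> range (Xob :: 'g set \<Rightarrow> _))"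
    by (intro finite_UnI finite_imageI finite)
  ultimately have "finite (UNIV :: 'g simple set)"
    by metis
  then show ?thesis
    by (rule rev_finite_subset) simp
qed

lemma tensor_Some_iff:
  "tensor D V W l = Some t \<longleftrightarrow>
     (\<exists>i j A B. l = Tens i j t \<and> V i = Some A \<and> W j = Some B \<and> t \<in> fus D A B)"
  by (auto simp: tensor_def split: label.splits option.splits)

lemma tensor_Atom [simp]: "tensor D V W (Atom n) = None"
  by (simp add: tensor_def)

lemma tensor_cong: "V i = V' i' \<Longrightarrow> W j = W' j' \<Longrightarrow> tensor D V W (Tens i j t) = tensor D V' W' (Tens i' j' t)"
  by (simp add: tensor_def split: option.splits)

lemma tensor_value: "tensor D V W (Tens i j t) = Some t' \<Longrightarrow> t' = t"
  by (auto simp: tensor_Some_iff)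

lemma tensor_dom_iff: "Tens i j t \<in> dom (tensor D V W) \<longleftrightarrow> tensor D V W (Tens i j t) = Some t"
  by (auto simp: tensor_Some_iff dom_def)

lemma finite_dom_tensor [simp]:
  assumes "finite (dom V)" "finite (dom W)"
  shows "finite (dom (tensor D V W))"
proof (rule finite_subset)
  show "dom (tensor D V W) \<subseteq> (\<lambda>(i, j, t). Tens i j t) ` (dom V \<times> dom W \<times> UNIV)"
    by (auto simp: dom_def tensor_Some_iff image_def)
  show "finite ((\<lambda>(i, j, t). Tens i j t) ` (dom V \<times> dom W \<times> (UNIV :: 'a simple set)))"
    using assms by simp
qed

lemma tensorm_chom:
  "f \<in> chom V V' \<Longrightarrow> g \<in> chom W W' \<Longrightarrow> tensorm D f g \<in> chom (tensor D V W) (tensor D V' W')"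
  by (simp add: tensorm_def chom_src chom_tgt)

text \<open>A nonzero product of entries forces the factors at source and target to agree, so a
  target label is present exactly when the source label is, and the typing conditions inside
  \<open>arr\<close> reduce to a single one.\<close>

lemma mat_tensorm:
  assumes f: "f \<in> chom V V'" and g: "g \<in> chom W W'"
  shows "mat (tensorm D f g) (Tens i' j' t') (Tens i j t) =
    (if t' = t \<and> tensor D V W (Tens i j t) = Some t then mat f i' i * mat g j' j else 0)"
proof (cases "mat f i' i * mat g j' j = 0")
  case True
  then show ?thesis
    by (simp add: tensorm_def mat_arr)
next
  case False
  then have "V' i' = V i" "W' j' = W j"
    using chom_nonzero(2)[OF f] chom_nonzero(2)[OF g] by auto
  then have "tensor D V' W' (Tens i' j' t') = tensor D V W (Tens i j t')"
    by (rule tensor_cong)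
  then have "(Tens i j t \<in> dom (tensor D V W)
      \<and> tensor D V' W' (Tens i' j' t') = tensor D V W (Tens i j t))
    \<longleftrightarrow> t' = t \<and> tensor D V W (Tens i j t) = Some t"
    unfolding tensor_dom_iff using tensor_value[of D V W i j t' t] by metis
  then show ?thesis
    using f g by (simp add: tensorm_def mat_arr chom_src chom_tgt)
qed

lemma mat_tensorm_nonzero:
  assumes "f \<in> chom V V'" "g \<in> chom W W'" "mat (tensorm D f g) w v \<noteq> 0"
  obtains i' j' i j t where "w = Tens i' j' t" "v = Tens i j t" "mat f i' i \<noteq> 0" "mat g j' j \<noteq> 0"
    "tensor D V W (Tens i j t) = Some t"
proof -
  obtain i' j' t' i j t where wv: "w = Tens i' j' t'" "v = Tens i j t"
    using assms(3) by (auto simp: tensorm_def mat_arr split: if_splits label.splits)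
  then show thesis
    using assms(3) that unfolding wv mat_tensorm[OF assms(1,2)] by (simp split: if_splits)
qed

lemma tensorm_idm: "tensorm D (idm V) (idm W) = idm (tensor D V W)"
proof (rule arrow_eqI[OF tensorm_chom[OF idm_chom idm_chom] idm_chom])
  fix w v
  assume "v \<in> dom (tensor D V W)" "tensor D V W w = tensor D V W v"
  then obtain t where v: "tensor D V W v = Some t" and w: "tensor D V W w = Some t"
    by auto
  obtain i j where i: "v = Tens i j t" "i \<in> dom V" "j \<in> dom W"
    using v by (auto simp: tensor_Some_iff)
  moreover obtain i' j' where "w = Tens i' j' t"
    using w by (auto simp: tensor_Some_iff)
  ultimately show "mat (tensorm D (idm V) (idm W)) w v = mat (idm (tensor D V W)) w v"
    using v by (auto simp: mat_tensorm[OF idm_chom idm_chom] mat_idm)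
qed

subsection \<open>Unit constraints\<close>

lemma cunit_Some_iff [simp]: "cunit u = Some A \<longleftrightarrow> u = Atom 0 \<and> A = Cob 0"
  by (auto simp: cunit_def)

lemma dom_cunit [simp]: "dom cunit = {Atom 0}"
  by (simp add: cunit_def)

lemma fus_unit [simp]: "fus D (Cob 0) A = {A}" "fus D A (Cob 0) = {A}"
  by (cases A; simp add: set_zero_plus)+

lemma tensor_cunit_left:
  "tensor D cunit V l = Some t \<longleftrightarrow> (\<exists>i. l = Tens (Atom 0) i t \<and> V i = Some t)"
  by (auto simp: tensor_Some_iff)

lemma tensor_cunit_right:
  "tensor D V cunit l = Some t \<longleftrightarrow> (\<exists>i. l = Tens i (Atom 0) t \<and> V i = Some t)"
  by (auto simp: tensor_Some_iff)

definition lunit_inv :: "'g::{ab_group_add,finite} crossed_data \<Rightarrow> 'g cobj \<Rightarrow> 'g arrow" where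
  "lunit_inv D V = arr V (tensor D cunit V)
     (\<lambda>w v. case w of Tens u i t \<Rightarrow> if v = i then 1 else 0 | _ \<Rightarrow> 0)"

definition runit_inv :: "'g::{ab_group_add,finite} crossed_data \<Rightarrow> 'g cobj \<Rightarrow> 'g arrow" where
  "runit_inv D V = arr V (tensor D V cunit)
     (\<lambda>w v. case w of Tens i u t \<Rightarrow> if v = i then 1 else 0 | _ \<Rightarrow> 0)"

lemma mat_lunit:
  "mat (lunit D V) w v = (if \<exists>t. v = Tens (Atom 0) w t \<and> V w = Some t then 1 else 0)"
proof (cases "\<exists>i t. v = Tens (Atom 0) i t \<and> V i = Some t")
  case True
  then obtain i t where v: "v = Tens (Atom 0) i t" "V i = Some t"
    by blast
  then have "tensor D cunit V v = Some t"
    by (simp add: tensor_cunit_left)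
  then show ?thesis
    using v by (auto simp: lunit_def mat_arr)
next
  case False
  then have "v \<notin> dom (tensor D cunit V)"
    by (auto simp: tensor_cunit_left)
  then show ?thesis
    using False by (auto simp: lunit_def mat_arr)
qed

lemma mat_runit:
  "mat (runit D V) w v = (if \<exists>t. v = Tens w (Atom 0) t \<and> V w = Some t then 1 else 0)"
proof (cases "\<exists>i t. v = Tens i (Atom 0) t \<and> V i = Some t")
  case True
  then obtain i t where v: "v = Tens i (Atom 0) t" "V i = Some t"
    by blast
  then have "tensor D V cunit v = Some t"
    by (simp add: tensor_cunit_right)
  then show ?thesis
    using v by (auto simp: runit_def mat_arr)
next
  case False
  then have "v \<notin> dom (tensor D V cunit)"
    by (auto simp: tensor_cunit_right)
  then show ?thesis
    using False by (auto simp: runit_def mat_arr)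
qed

lemma mat_lunit_inv:
  "mat (lunit_inv D V) w v = (if \<exists>t. w = Tens (Atom 0) v t \<and> V v = Some t then 1 else 0)"
proof (cases "\<exists>i t. w = Tens (Atom 0) i t \<and> V i = Some t")
  case True
  then obtain i t where w: "w = Tens (Atom 0) i t" "V i = Some t"
    by blast
  then have "tensor D cunit V w = Some t"
    by (simp add: tensor_cunit_left)
  then show ?thesis
    using w by (auto simp: lunit_inv_def mat_arr)
next
  case False
  then have "w \<notin> dom (tensor D cunit V)"
    by (auto simp: tensor_cunit_left)
  then show ?thesis
    using False by (auto simp: lunit_inv_def mat_arr domIff)
qed

lemma mat_runit_inv:
  "mat (runit_inv D V) w v = (if \<exists>t. w = Tens v (Atom 0) t \<and> V v = Some t then 1 else 0)"
proof (cases "\<exists>i t. w = Tens i (Atom 0) t \<and> V i = Some t")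
  case True
  then obtain i t where w: "w = Tens i (Atom 0) t" "V i = Some t"
    by blast
  then have "tensor D V cunit w = Some t"
    by (simp add: tensor_cunit_right)
  then show ?thesis
    using w by (auto simp: runit_inv_def mat_arr)
next
  case False
  then have "w \<notin> dom (tensor D V cunit)"
    by (auto simp: tensor_cunit_right)
  then show ?thesis
    using False by (auto simp: runit_inv_def mat_arr domIff)
qed

lemma lunit_chom: "lunit D V \<in> chom (tensor D cunit V) V"
  and runit_chom: "runit D V \<in> chom (tensor D V cunit) V"
  and lunit_inv_chom: "lunit_inv D V \<in> chom V (tensor D cunit V)"
  and runit_inv_chom: "runit_inv D V \<in> chom V (tensor D V cunit)"
  by (simp_all add: lunit_def runit_def lunit_inv_def runit_inv_def)

lemma invm_lunit:
  assumes fin: "finite (dom V)"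
  shows "invm (lunit D V) = lunit_inv D V"
proof (rule invm_eq[OF lunit_chom _ fin])
  show fin': "finite (dom (tensor D cunit V))"
    using fin by simp
  have "lunit_inv D V \<bullet> lunit D V = idm (tensor D cunit V)"
  proof (rule arrow_eqI[OF compm_chom[OF lunit_chom lunit_inv_chom] idm_chom])
    fix w v
    assume "v \<in> dom (tensor D cunit V)"
    then obtain i t where v: "v = Tens (Atom 0) i t" "V i = Some t"
      by (auto simp: tensor_cunit_left)
    then have "mat (lunit_inv D V \<bullet> lunit D V) w v = mat (lunit_inv D V) w i * mat (lunit D V) i v"
      by (intro mat_compm_single[OF lunit_chom fin]) (simp add: mat_lunit)
    then show "mat (lunit_inv D V \<bullet> lunit D V) w v = mat (idm (tensor D cunit V)) w v"
      using v by (auto simp: mat_lunit mat_lunit_inv mat_idm tensor_cunit_left dom_def)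
  qed
  moreover have "lunit D V \<bullet> lunit_inv D V = idm V"
  proof (rule arrow_eqI[OF compm_chom[OF lunit_inv_chom lunit_chom] idm_chom])
    fix w v
    assume "v \<in> dom V"
    then obtain t where v: "V v = Some t"
      by auto
    have "mat (lunit D V \<bullet> lunit_inv D V) w v =
        mat (lunit D V) w (Tens (Atom 0) v t) * mat (lunit_inv D V) (Tens (Atom 0) v t) v"
      by (rule mat_compm_single[OF lunit_inv_chom fin']) (auto simp: mat_lunit_inv v)
    then show "mat (lunit D V \<bullet> lunit_inv D V) w v = mat (idm V) w v"
      using v by (auto simp: mat_lunit mat_lunit_inv mat_idm)
  qed
  ultimately show "is_inverse (lunit D V) (lunit_inv D V)"
    by (simp add: is_inverse_def lunit_inv_def lunit_def)
qed

lemma invm_runit: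
  assumes fin: "finite (dom V)"
  shows "invm (runit D V) = runit_inv D V"
proof (rule invm_eq[OF runit_chom _ fin])
  show fin': "finite (dom (tensor D V cunit))"
    using fin by simp
  have "runit_inv D V \<bullet> runit D V = idm (tensor D V cunit)"
  proof (rule arrow_eqI[OF compm_chom[OF runit_chom runit_inv_chom] idm_chom])
    fix w v
    assume "v \<in> dom (tensor D V cunit)"
    then obtain i t where v: "v = Tens i (Atom 0) t" "V i = Some t"
      by (auto simp: tensor_cunit_right)
    then have "mat (runit_inv D V \<bullet> runit D V) w v = mat (runit_inv D V) w i * mat (runit D V) i v"
      by (intro mat_compm_single[OF runit_chom fin]) (simp add: mat_runit)
    then show "mat (runit_inv D V \<bullet> runit D V) w v = mat (idm (tensor D V cunit)) w v"
      using v by (auto simp: mat_runit mat_runit_inv mat_idm tensor_cunit_right dom_def)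
  qed
  moreover have "runit D V \<bullet> runit_inv D V = idm V"
  proof (rule arrow_eqI[OF compm_chom[OF runit_inv_chom runit_chom] idm_chom])
    fix w v
    assume "v \<in> dom V"
    then obtain t where v: "V v = Some t"
      by auto
    have "mat (runit D V \<bullet> runit_inv D V) w v =
        mat (runit D V) w (Tens v (Atom 0) t) * mat (runit_inv D V) (Tens v (Atom 0) t) v"
      by (rule mat_compm_single[OF runit_inv_chom fin']) (auto simp: mat_runit_inv v)
    then show "mat (runit D V \<bullet> runit_inv D V) w v = mat (idm V) w v"
      using v by (auto simp: mat_runit mat_runit_inv mat_idm)
  qed
  ultimately show "is_inverse (runit D V) (runit_inv D V)"
    by (simp add: is_inverse_def runit_inv_def runit_def)
qed

subsection \<open>The associator\<close>

lemma associator_chom: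
  "associator D U V W \<in> chom (tensor D (tensor D U V) W) (tensor D U (tensor D V W))"
  by (simp add: associator_def)

lemma mat_associator_nonzero:
  assumes "mat (associator D U V W) w v \<noteq> 0"
  obtains i j k t r s where "v = Tens (Tens i j t) k s" "w = Tens i (Tens j k r) s"
proof -
  have v: "v \<in> dom (tensor D (tensor D U V) W)"
    and w: "tensor D U (tensor D V W) w = tensor D (tensor D U V) W v"
    using chom_nonzero[OF associator_chom assms] by simp_all
  obtain s where s: "tensor D (tensor D U V) W v = Some s"
    using v by auto
  then obtain i j t k where v': "v = Tens (Tens i j t) k s"
    by (auto simp: tensor_Some_iff)
  obtain i' j' k' r where w': "w = Tens i' (Tens j' k' r) s"
    using w s by (auto simp: tensor_Some_iff)
  show thesis
    using assms that unfolding v' w' by (auto simp: associator_def mat_arr split: if_splits)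
qed

lemma mat_associator:
  assumes "tensor D (tensor D U V) W (Tens (Tens i j t) k s) = Some s"
    and "tensor D U (tensor D V W) (Tens i (Tens j k r) s) = Some s"
  shows "mat (associator D U V W) (Tens i (Tens j k r) s) (Tens (Tens i j t) k s) =
    assoc_coeff D (the (U i)) (the (V j)) (the (W k)) t r s"
  using assms by (simp add: associator_def mat_arr domIff)

text \<open>Set to \<open>0\<close> in mixed degrees. For three objects of degree \<open>g\<close> it is the inverse of the
  Fourier-type matrix \<open>\<epsilon> |2\<Gamma>|\<^sup>-\<^sup>1\<^sup>/\<^sup>2 \<sigma>(t, r)\<^sup>-\<^sup>1\<close>.\<close>

fun assoc_inv_coeff :: "'g::{ab_group_add,finite} crossed_data \<Rightarrow> 'g simple \<Rightarrow> 'g simple \<Rightarrow> 'g simple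
    \<Rightarrow> 'g simple \<Rightarrow> 'g simple \<Rightarrow> complex" where
  "assoc_inv_coeff D (Cob a) (Cob b) (Cob c) _ _ = domega D a b c"
| "assoc_inv_coeff D (Xob x) (Xob y) (Xob z) (Cob t) (Cob r) = deps D * norm2 D * dsigma D t r"
| "assoc_inv_coeff D _ _ _ _ _ = 0"

definition assoc_inv :: "'g::{ab_group_add,finite} crossed_data \<Rightarrow>
    'g cobj \<Rightarrow> 'g cobj \<Rightarrow> 'g cobj \<Rightarrow> 'g arrow" where
  "assoc_inv D U V W = arr (tensor D U (tensor D V W)) (tensor D (tensor D U V) W)
     (\<lambda>w v. case (v, w) of
        (Tens i' (Tens j' k' r) s', Tens (Tens i j t) k s) \<Rightarrow>
          if i' = i \<and> j' = j \<and> k' = k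
          then assoc_inv_coeff D (the (U i)) (the (V j)) (the (W k)) t r else 0
      | _ \<Rightarrow> 0)"

lemma assoc_inv_chom:
  "assoc_inv D U V W \<in> chom (tensor D U (tensor D V W)) (tensor D (tensor D U V) W)"
  by (simp add: assoc_inv_def)

lemma mat_assoc_inv_nonzero:
  assumes "mat (assoc_inv D U V W) v w \<noteq> 0"
  obtains i j k t r s where "v = Tens (Tens i j t) k s" "w = Tens i (Tens j k r) s"
proof -
  have w: "w \<in> dom (tensor D U (tensor D V W))"
    and v: "tensor D (tensor D U V) W v = tensor D U (tensor D V W) w"
    using chom_nonzero[OF assoc_inv_chom assms] by simp_all
  obtain s where s: "tensor D U (tensor D V W) w = Some s"
    using w by auto
  then obtain i' j' r k' where w': "w = Tens i' (Tens j' k' r) s"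
    by (auto simp: tensor_Some_iff)
  obtain i j k t where v': "v = Tens (Tens i j t) k s"
    using v s by (auto simp: tensor_Some_iff)
  show thesis
    using assms that unfolding v' w' by (auto simp: assoc_inv_def mat_arr split: if_splits)
qed

lemma mat_assoc_inv:
  assumes "tensor D (tensor D U V) W (Tens (Tens i j t) k s) = Some s"
    and "tensor D U (tensor D V W) (Tens i (Tens j k r) s) = Some s"
  shows "mat (assoc_inv D U V W) (Tens (Tens i j t) k s) (Tens i (Tens j k r) s) =
    assoc_inv_coeff D (the (U i)) (the (V j)) (the (W k)) t r"
  using assms by (simp add: assoc_inv_def mat_arr domIff)

section \<open>Duality morphisms\<close>

lemma coev_support:
  assumes "k \<in> chom cunit (tensor D X Y)" "mat k p u \<noteq> 0"
  obtains i j where "p = Tens i j (Cob 0)" "i \<in> dom X" "j \<in> dom Y" "u = Atom 0"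
    "tensor D X Y (Tens i j (Cob 0)) = Some (Cob 0)"
proof -
  have u: "u = Atom 0" and p: "tensor D X Y p = Some (Cob 0)"
    using chom_nonzero[OF assms] by (auto simp: cunit_def)
  obtain i j where "p = Tens i j (Cob 0)" "i \<in> dom X" "j \<in> dom Y"
    using p by (auto simp: tensor_Some_iff)
  then show thesis
    using u p that by blast
qed

lemma ev_support:
  assumes "e \<in> chom (tensor D Y X) cunit" "mat e u p \<noteq> 0"
  obtains i j where "p = Tens j i (Cob 0)" "i \<in> dom X" "j \<in> dom Y" "u = Atom 0"
    "tensor D Y X (Tens j i (Cob 0)) = Some (Cob 0)"
proof -
  have u: "u = Atom 0" and p: "tensor D Y X p = Some (Cob 0)"
    using chom_nonzero[OF assms] by (auto simp: cunit_def split: if_splits)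
  obtain i j where "p = Tens j i (Cob 0)" "i \<in> dom X" "j \<in> dom Y"
    using p by (auto simp: tensor_Some_iff)
  then show thesis
    using u p that by blast
qed

text \<open>Starting from summand \<open>i\<close>, \<open>k\<close> inserts pairs (m, j) on a unit
  summand to its left, the associator rebrackets to (j, i), and \<open>e\<close> keeps only the unit
  summand of that pair. Hence only the associator entry with both intermediate summands equal to the
  unit contributes, and one sum over \<open>j\<close> remains.\<close>

lemma snake1_entry:
  assumes fX: "finite (dom X)" and fY: "finite (dom Y)"
    and e: "e \<in> chom (tensor D Y X) cunit" and k: "k \<in> chom cunit (tensor D X Y)"
    and i: "X i = Some A" and i': "X i' = Some A"
  shows "mat (runit D X \<bullet> tensorm D (idm X) e \<bullet> associator D X Y X
      \<bullet> tensorm D k (idm X) \<bullet> invm (lunit D X)) i' i =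
    (\<Sum>j\<in>dom Y. mat e (Atom 0) (Tens j i (Cob 0))
      * assoc_coeff D A (the (Y j)) A (Cob 0) (Cob 0) A * mat k (Tens i' j (Cob 0)) (Atom 0))"
proof -
  define c1 where "c1 = lunit_inv D X"
  define c2 where "c2 = tensorm D k (idm X) \<bullet> c1"
  define c3 where "c3 = associator D X Y X \<bullet> c2"
  define c4 where "c4 = tensorm D (idm X) e \<bullet> c3"
  have c1: "c1 \<in> chom X (tensor D cunit X)"
    by (simp add: c1_def lunit_inv_chom)
  have c2: "c2 \<in> chom X (tensor D (tensor D X Y) X)"
    unfolding c2_def by (rule compm_chom[OF c1 tensorm_chom[OF k idm_chom]])
  have c3: "c3 \<in> chom X (tensor D X (tensor D Y X))"
    unfolding c3_def by (rule compm_chom[OF c2 associator_chom])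
  have c4: "c4 \<in> chom X (tensor D X cunit)"
    unfolding c4_def by (rule compm_chom[OF c3 tensorm_chom[OF idm_chom e]])
  have m2: "mat c2 (Tens p l t) i = (if l = i \<and> t = A then mat k p (Atom 0) else 0)" for p l t
  proof -
    have "mat c2 (Tens p l t) i =
        mat (tensorm D k (idm X)) (Tens p l t) (Tens (Atom 0) i A) * mat c1 (Tens (Atom 0) i A) i"
      unfolding c2_def using i fX by (intro mat_compm_single[OF c1]) (auto simp: c1_def mat_lunit_inv)
    then show ?thesis
      using i by (auto simp: c1_def mat_lunit_inv mat_tensorm[OF k idm_chom] mat_idm tensor_cunit_left)
  qed
  have m2_nz: "\<exists>m j. v = Tens (Tens m j (Cob 0)) i A" if nz: "mat c2 v i \<noteq> 0" for v
  proof -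
    obtain p l t where v: "v = Tens p l t"
      using chom_nonzero(3)[OF c2 nz] by (auto simp: tensor_Some_iff)
    then show ?thesis
      using nz m2 k by (auto elim!: coev_support split: if_splits)
  qed
  have m3_nz: "\<exists>m j r. v = Tens m (Tens j i r) A" if "mat c3 v i \<noteq> 0" for v
    using that unfolding c3_def
    by (elim mat_compm_nonzero mat_associator_nonzero) (auto dest!: m2_nz)
  have m3: "mat c3 (Tens i' (Tens j i (Cob 0)) A) i =
      assoc_coeff D A (the (Y j)) A (Cob 0) (Cob 0) A * mat k (Tens i' j (Cob 0)) (Atom 0)"
    if j: "tensor D Y X (Tens j i (Cob 0)) = Some (Cob 0)" for j
  proof -
    have "mat c3 (Tens i' (Tens j i (Cob 0)) A) i =
        mat (associator D X Y X) (Tens i' (Tens j i (Cob 0)) A) (Tens (Tens i' j (Cob 0)) i A)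
          * mat c2 (Tens (Tens i' j (Cob 0)) i A) i"
      unfolding c3_def
    proof (rule mat_compm_single[OF c2])
      fix v
      assume ne: "v \<noteq> Tens (Tens i' j (Cob 0)) i A"
      show "mat (associator D X Y X) (Tens i' (Tens j i (Cob 0)) A) v * mat c2 v i = 0"
        using ne m2_nz[of v] by (auto elim!: mat_associator_nonzero)
    qed (use fX fY in simp)
    also have "mat c2 (Tens (Tens i' j (Cob 0)) i A) i = mat k (Tens i' j (Cob 0)) (Atom 0)"
      by (simp add: m2)
    also have "mat (associator D X Y X) (Tens i' (Tens j i (Cob 0)) A) (Tens (Tens i' j (Cob 0)) i A)
        * mat k (Tens i' j (Cob 0)) (Atom 0)
      = assoc_coeff D A (the (Y j)) A (Cob 0) (Cob 0) A * mat k (Tens i' j (Cob 0)) (Atom 0)"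
    \<comment> \<open>\<open>Tens i' j (Cob 0)\<close> need not be a label of the product; when it
      is absent, the entry of \<open>k\<close> is zero and both sides vanish.\<close>
    proof (cases "mat k (Tens i' j (Cob 0)) (Atom 0) = 0")
      case False
      then have "tensor D X Y (Tens i' j (Cob 0)) = Some (Cob 0)"
        using k by (auto elim: coev_support)
      then show ?thesis
        using i i' j by (subst mat_associator) (simp_all add: tensor_Some_iff)
    qed simp
    finally show ?thesis .
  qed
  have m4: "mat c4 (Tens i' (Atom 0) A) i = (\<Sum>j\<in>dom Y. mat e (Atom 0) (Tens j i (Cob 0))
      * assoc_coeff D A (the (Y j)) A (Cob 0) (Cob 0) A * mat k (Tens i' j (Cob 0)) (Atom 0))"
  proof -
    have "mat c4 (Tens i' (Atom 0) A) i = (\<Sum>j\<in>dom Y.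
        mat (tensorm D (idm X) e) (Tens i' (Atom 0) A) (Tens i' (Tens j i (Cob 0)) A)
        * mat c3 (Tens i' (Tens j i (Cob 0)) A) i)"
      unfolding c4_def
    proof (rule mat_compm_reindex[OF c3])
      fix v
      assume ne: "v \<notin> (\<lambda>j. Tens i' (Tens j i (Cob 0)) A) ` dom Y"
      show "mat (tensorm D (idm X) e) (Tens i' (Atom 0) A) v * mat c3 v i = 0"
      proof (rule ccontr)
        assume nz: "mat (tensorm D (idm X) e) (Tens i' (Atom 0) A) v * mat c3 v i \<noteq> 0"
        then obtain m p where v: "v = Tens m p A" and m: "mat (idm X) i' m \<noteq> 0"
          and p: "mat e (Atom 0) p \<noteq> 0"
          by (auto elim!: mat_tensorm_nonzero[OF idm_chom e])
        obtain j l where "p = Tens j l (Cob 0)" "j \<in> dom Y"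
          using ev_support[OF e p] by blast
        moreover have "m = i'"
          using m by (simp add: mat_idm split: if_splits)
        ultimately show False
          using ne v m3_nz[of v] nz by auto
      qed
    qed (use fX fY in \<open>auto simp: inj_on_def\<close>)
    also have "\<dots> = (\<Sum>j\<in>dom Y. mat e (Atom 0) (Tens j i (Cob 0))
      * assoc_coeff D A (the (Y j)) A (Cob 0) (Cob 0) A * mat k (Tens i' j (Cob 0)) (Atom 0))"
    proof (rule sum.cong[OF refl])
      fix j
      assume "j \<in> dom Y"
      show "mat (tensorm D (idm X) e) (Tens i' (Atom 0) A) (Tens i' (Tens j i (Cob 0)) A)
          * mat c3 (Tens i' (Tens j i (Cob 0)) A) i =
        mat e (Atom 0) (Tens j i (Cob 0))
          * assoc_coeff D A (the (Y j)) A (Cob 0) (Cob 0) A * mat k (Tens i' j (Cob 0)) (Atom 0)"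
      proof (cases "mat e (Atom 0) (Tens j i (Cob 0)) = 0")
        case False
        then have j: "tensor D Y X (Tens j i (Cob 0)) = Some (Cob 0)"
          using e by (auto elim: ev_support)
        then have "tensor D X (tensor D Y X) (Tens i' (Tens j i (Cob 0)) A) = Some A"
          using i' by (simp add: tensor_Some_iff)
        then show ?thesis
          using m3[OF j] i' by (simp add: mat_tensorm[OF idm_chom e] mat_idm domIff)
      qed (simp add: mat_tensorm[OF idm_chom e])
    qed
    finally show ?thesis .
  qed
  have "mat (runit D X \<bullet> c4) i' i = mat (runit D X) i' (Tens i' (Atom 0) A) * mat c4 (Tens i' (Atom 0) A) i"
    using i' fX by (intro mat_compm_single[OF c4]) (auto simp: mat_runit)
  also have "mat (runit D X) i' (Tens i' (Atom 0) A) = 1"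
    using i' by (simp add: mat_runit)
  finally show ?thesis
    using m4 by (simp add: c4_def c3_def c2_def c1_def invm_lunit[OF fX])
qed

text \<open>The mirror image of the first identity, with \<open>k\<close> inserted on the right. The
  inverse associator is made computable by the assumption that it equals \<open>assoc_inv\<close>,
  which is verified only for the duals that are constructed.\<close>

lemma snake2_entry:
  assumes fX: "finite (dom X)" and fY: "finite (dom Y)"
    and e: "e \<in> chom (tensor D Y X) cunit" and k: "k \<in> chom cunit (tensor D X Y)"
    and inv: "invm (associator D Y X Y) = assoc_inv D Y X Y"
    and i: "Y j = Some B" and i': "Y j' = Some B"
  shows "mat (lunit D Y \<bullet> tensorm D e (idm Y) \<bullet> invm (associator D Y X Y)
      \<bullet> tensorm D (idm Y) k \<bullet> invm (runit D Y)) j' j =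
    (\<Sum>i\<in>dom X. mat e (Atom 0) (Tens j i (Cob 0))
      * assoc_inv_coeff D B (the (X i)) B (Cob 0) (Cob 0) * mat k (Tens i j' (Cob 0)) (Atom 0))"
proof -
  define c1 where "c1 = runit_inv D Y"
  define c2 where "c2 = tensorm D (idm Y) k \<bullet> c1"
  define c3 where "c3 = assoc_inv D Y X Y \<bullet> c2"
  define c4 where "c4 = tensorm D e (idm Y) \<bullet> c3"
  have c1: "c1 \<in> chom Y (tensor D Y cunit)"
    by (simp add: c1_def runit_inv_chom)
  have c2: "c2 \<in> chom Y (tensor D Y (tensor D X Y))"
    unfolding c2_def by (rule compm_chom[OF c1 tensorm_chom[OF idm_chom k]])
  have c3: "c3 \<in> chom Y (tensor D (tensor D Y X) Y)"
    unfolding c3_def by (rule compm_chom[OF c2 assoc_inv_chom])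
  have c4: "c4 \<in> chom Y (tensor D cunit Y)"
    unfolding c4_def by (rule compm_chom[OF c3 tensorm_chom[OF e idm_chom]])
  have m2: "mat c2 (Tens l p t) j = (if l = j \<and> t = B then mat k p (Atom 0) else 0)" for p l t
  proof -
    have "mat c2 (Tens l p t) j =
        mat (tensorm D (idm Y) k) (Tens l p t) (Tens j (Atom 0) B) * mat c1 (Tens j (Atom 0) B) j"
      unfolding c2_def using i fY by (intro mat_compm_single[OF c1]) (auto simp: c1_def mat_runit_inv)
    then show ?thesis
      using i by (auto simp: c1_def mat_runit_inv mat_tensorm[OF idm_chom k] mat_idm tensor_cunit_right)
  qed
  have m2_nz: "\<exists>m l. v = Tens j (Tens m l (Cob 0)) B" if nz: "mat c2 v j \<noteq> 0" for v
  proof -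
    obtain l p t where v: "v = Tens l p t"
      using chom_nonzero(3)[OF c2 nz] by (auto simp: tensor_Some_iff)
    then show ?thesis
      using nz m2 k by (auto elim!: coev_support split: if_splits)
  qed
  have m3_nz: "\<exists>m l r. v = Tens (Tens j m r) l B" if "mat c3 v j \<noteq> 0" for v
    using that unfolding c3_def
    by (elim mat_compm_nonzero mat_assoc_inv_nonzero) (auto dest!: m2_nz)
  have m3: "mat c3 (Tens (Tens j i (Cob 0)) j' B) j =
      assoc_inv_coeff D B (the (X i)) B (Cob 0) (Cob 0) * mat k (Tens i j' (Cob 0)) (Atom 0)"
    if ji: "tensor D Y X (Tens j i (Cob 0)) = Some (Cob 0)" for i
  proof -
    have "mat c3 (Tens (Tens j i (Cob 0)) j' B) j =
        mat (assoc_inv D Y X Y) (Tens (Tens j i (Cob 0)) j' B) (Tens j (Tens i j' (Cob 0)) B)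
          * mat c2 (Tens j (Tens i j' (Cob 0)) B) j"
      unfolding c3_def
    proof (rule mat_compm_single[OF c2])
      fix v
      assume ne: "v \<noteq> Tens j (Tens i j' (Cob 0)) B"
      show "mat (assoc_inv D Y X Y) (Tens (Tens j i (Cob 0)) j' B) v * mat c2 v j = 0"
        using ne m2_nz[of v] by (auto elim!: mat_assoc_inv_nonzero)
    qed (use fX fY in simp)
    also have "mat c2 (Tens j (Tens i j' (Cob 0)) B) j = mat k (Tens i j' (Cob 0)) (Atom 0)"
      by (simp add: m2)
    also have "mat (assoc_inv D Y X Y) (Tens (Tens j i (Cob 0)) j' B) (Tens j (Tens i j' (Cob 0)) B)
        * mat k (Tens i j' (Cob 0)) (Atom 0)
      = assoc_inv_coeff D B (the (X i)) B (Cob 0) (Cob 0) * mat k (Tens i j' (Cob 0)) (Atom 0)"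
    proof (cases "mat k (Tens i j' (Cob 0)) (Atom 0) = 0")
      case False
      then have "tensor D X Y (Tens i j' (Cob 0)) = Some (Cob 0)"
        using k by (auto elim: coev_support)
      then show ?thesis
        using \<open>Y j = Some B\<close> i' ji by (subst mat_assoc_inv) (simp_all add: tensor_Some_iff)
    qed simp
    finally show ?thesis .
  qed
  have m4: "mat c4 (Tens (Atom 0) j' B) j = (\<Sum>i\<in>dom X. mat e (Atom 0) (Tens j i (Cob 0))
      * assoc_inv_coeff D B (the (X i)) B (Cob 0) (Cob 0) * mat k (Tens i j' (Cob 0)) (Atom 0))"
  proof -
    have "mat c4 (Tens (Atom 0) j' B) j = (\<Sum>i\<in>dom X.
        mat (tensorm D e (idm Y)) (Tens (Atom 0) j' B) (Tens (Tens j i (Cob 0)) j' B)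
        * mat c3 (Tens (Tens j i (Cob 0)) j' B) j)"
      unfolding c4_def
    proof (rule mat_compm_reindex[OF c3])
      fix v
      assume ne: "v \<notin> (\<lambda>i. Tens (Tens j i (Cob 0)) j' B) ` dom X"
      show "mat (tensorm D e (idm Y)) (Tens (Atom 0) j' B) v * mat c3 v j = 0"
      proof (rule ccontr)
        assume nz: "mat (tensorm D e (idm Y)) (Tens (Atom 0) j' B) v * mat c3 v j \<noteq> 0"
        then obtain m p where v: "v = Tens p m B" and m: "mat (idm Y) j' m \<noteq> 0"
          and p: "mat e (Atom 0) p \<noteq> 0"
          by (auto elim!: mat_tensorm_nonzero[OF e idm_chom])
        obtain l i where "p = Tens l i (Cob 0)" "i \<in> dom X"
          using ev_support[OF e p] by blast
        moreover have "m = j'"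
          using m by (simp add: mat_idm split: if_splits)
        ultimately show False
          using ne v m3_nz[of v] nz by auto
      qed
    qed (use fX fY in \<open>auto simp: inj_on_def\<close>)
    also have "\<dots> = (\<Sum>i\<in>dom X. mat e (Atom 0) (Tens j i (Cob 0))
      * assoc_inv_coeff D B (the (X i)) B (Cob 0) (Cob 0) * mat k (Tens i j' (Cob 0)) (Atom 0))"
    proof (rule sum.cong[OF refl])
      fix i
      assume "i \<in> dom X"
      show "mat (tensorm D e (idm Y)) (Tens (Atom 0) j' B) (Tens (Tens j i (Cob 0)) j' B)
          * mat c3 (Tens (Tens j i (Cob 0)) j' B) j =
        mat e (Atom 0) (Tens j i (Cob 0))
          * assoc_inv_coeff D B (the (X i)) B (Cob 0) (Cob 0) * mat k (Tens i j' (Cob 0)) (Atom 0)"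
      proof (cases "mat e (Atom 0) (Tens j i (Cob 0)) = 0")
        case False
        then have ji: "tensor D Y X (Tens j i (Cob 0)) = Some (Cob 0)"
          using e by (auto elim: ev_support)
        then have "tensor D (tensor D Y X) Y (Tens (Tens j i (Cob 0)) j' B) = Some B"
          using i' by (simp add: tensor_Some_iff)
        then show ?thesis
          using m3[OF ji] i' by (simp add: mat_tensorm[OF e idm_chom] mat_idm domIff)
      qed (simp add: mat_tensorm[OF e idm_chom])
    qed
    finally show ?thesis .
  qed
  have "mat (lunit D Y \<bullet> c4) j' j = mat (lunit D Y) j' (Tens (Atom 0) j' B) * mat c4 (Tens (Atom 0) j' B) j"
    using i' fY by (intro mat_compm_single[OF c4]) (auto simp: mat_lunit)
  also have "mat (lunit D Y) j' (Tens (Atom 0) j' B) = 1"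
    using i' by (simp add: mat_lunit)
  finally show ?thesis
    using m4 by (simp add: c4_def c3_def c2_def c1_def invm_runit[OF fY] inv)
qed

subsection \<open>Equivariance of evaluation and coevaluation\<close>

lemma unit_in_fus_sact: "Cob 0 \<in> fus D A B \<Longrightarrow> Cob 0 \<in> fus D (sact Gen A) (sact Gen B)"
  by (cases A; cases B) (auto simp: add_eq_0_iff)

lemma tau_chom: "tau D V W \<in> chom (act Gen (tensor D V W)) (tensor D (act Gen V) (act Gen W))"
  by (simp add: tau_def)

lemma eqv_etensor_chom:
  assumes "is_eobj X" "is_eobj Y"
  shows "eqv (etensor D X Y) \<in> chom (act Gen (tensor D (und X) (und Y))) (tensor D (und X) (und Y))"
  unfolding etensor_def
  by (simp add: compm_chom[OF tau_chom tensorm_chom[OF assms[THEN is_eobj_chom]]])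

lemma und_etensor [simp]: "und (etensor D X Y) = tensor D (und X) (und Y)"
  by (simp add: etensor_def)

text \<open>\<tau> is diagonal in the labels and the action fixes the unit summand, so the composite
  has a single term.\<close>

lemma mat_eqv_etensor_unit:
  assumes X: "is_eobj X" and Y: "is_eobj Y"
    and ij: "tensor D (und X) (und Y) (Tens i j (Cob 0)) = Some (Cob 0)"
  shows "mat (eqv (etensor D X Y)) (Tens i' j' (Cob 0)) (Tens i j (Cob 0)) =
    mat (eqv X) i' i * mat (eqv Y) j' j * tau_coeff D (the (und X i)) (the (und Y j)) (Cob 0)"
proof -
  let ?T = "tensorm D (eqv X) (eqv Y)" and ?t = "tau D (und X) (und Y)"
  have a: "act Gen (tensor D (und X) (und Y)) (Tens i j (Cob 0)) = Some (Cob 0)"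
    using ij by (simp add: act_def)
  have t: "tensor D (act Gen (und X)) (act Gen (und Y)) (Tens i j (Cob 0)) = Some (Cob 0)"
    using ij unit_in_fus_sact by (fastforce simp: tensor_Some_iff act_def)
  have "mat (?T \<bullet> ?t) (Tens i' j' (Cob 0)) (Tens i j (Cob 0)) =
      mat ?T (Tens i' j' (Cob 0)) (Tens i j (Cob 0)) * mat ?t (Tens i j (Cob 0)) (Tens i j (Cob 0))"
  proof (rule mat_compm_single[OF tau_chom])
    fix v
    assume ne: "v \<noteq> Tens i j (Cob 0)"
    have "mat ?t v (Tens i j (Cob 0)) = 0"
    proof (rule ccontr)
      assume nz: "mat ?t v (Tens i j (Cob 0)) \<noteq> 0"
      have "tensor D (act Gen (und X)) (act Gen (und Y)) v = Some (Cob 0)"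
        using chom_nonzero(2)[OF tau_chom nz] a by simp
      moreover obtain s where "v = Tens i j s"
        using nz by (auto simp: tau_def mat_arr split: if_splits label.splits)
      ultimately show False
        using ne tensor_value by fastforce
    qed
    then show "mat ?T (Tens i' j' (Cob 0)) v * mat ?t v (Tens i j (Cob 0)) = 0"
      by simp
  qed (use is_eobj_finite[OF X] is_eobj_finite[OF Y] in simp)
  moreover have "mat ?t (Tens i j (Cob 0)) (Tens i j (Cob 0)) =
      tau_coeff D (the (und X i)) (the (und Y j)) (Cob 0)"
    using ij a t by (simp add: tau_def mat_arr domIff)
  moreover have "mat ?T (Tens i' j' (Cob 0)) (Tens i j (Cob 0)) = mat (eqv X) i' i * mat (eqv Y) j' j"
    using t by (simp add: mat_tensorm[OF is_eobj_chom[OF X] is_eobj_chom[OF Y]])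
  ultimately show ?thesis
    by (simp add: etensor_def)
qed

lemma mat_eqv_eunit: "mat (eqv eunit) w v = (if w = Atom 0 \<and> v = Atom 0 then 1 else 0)"
  unfolding eunit_eq by (rule mat_eqv_Sobj) simp

lemma und_eunit [simp]: "und eunit = cunit"
  by (simp add: eunit_def)

lemma eqv_eunit_chom: "eqv eunit \<in> chom (act Gen cunit) cunit"
  by (simp add: eunit_def)

text \<open>Serves in both directions: to verify constructed coevaluations, and to read off from a
  given one the relation that removes the signs in the trace of degree g.\<close>

lemma coev_ehom_iff:
  assumes X: "is_eobj X" and Y: "is_eobj Y" and k: "k \<in> chom cunit (tensor D (und X) (und Y))"
  shows "k \<in> ehom eunit (etensor D X Y) \<longleftrightarrow>
    (\<forall>i' j'. tensor D (und X) (und Y) (Tens i' j' (Cob 0)) = Some (Cob 0) \<longrightarrow>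
      (\<Sum>i\<in>dom (und X). \<Sum>j\<in>dom (und Y). mat (eqv X) i' i * mat (eqv Y) j' j
        * tau_coeff D (the (und X i)) (the (und Y j)) (Cob 0) * mat k (Tens i j (Cob 0)) (Atom 0))
      = mat k (Tens i' j' (Cob 0)) (Atom 0))"
proof -
  note ec = eqv_etensor_chom[OF X Y, of D]
  have ak: "actm Gen k \<in> chom (act Gen cunit) (act Gen (tensor D (und X) (und Y)))"
    by (rule actm_chom[OF k])
  have L: "mat (eqv (etensor D X Y) \<bullet> actm Gen k) (Tens i' j' (Cob 0)) (Atom 0) =
      (\<Sum>i\<in>dom (und X). \<Sum>j\<in>dom (und Y). mat (eqv X) i' i * mat (eqv Y) j' j
        * tau_coeff D (the (und X i)) (the (und Y j)) (Cob 0) * mat k (Tens i j (Cob 0)) (Atom 0))"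
    for i' j'
  proof -
    have "mat (eqv (etensor D X Y) \<bullet> actm Gen k) (Tens i' j' (Cob 0)) (Atom 0) =
      (\<Sum>p\<in>dom (und X) \<times> dom (und Y).
        mat (eqv (etensor D X Y)) (Tens i' j' (Cob 0)) (Tens (fst p) (snd p) (Cob 0))
        * mat (actm Gen k) (Tens (fst p) (snd p) (Cob 0)) (Atom 0))"
    proof (rule mat_compm_reindex[OF ak])
      fix v
      assume ne: "v \<notin> (\<lambda>p. Tens (fst p) (snd p) (Cob 0)) ` (dom (und X) \<times> dom (und Y))"
      have "mat k v (Atom 0) = 0"
        using ne by (rule contrapos_np) (auto elim!: coev_support[OF k] simp: image_iff)
      then show "mat (eqv (etensor D X Y)) (Tens i' j' (Cob 0)) v * mat (actm Gen k) v (Atom 0) = 0"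
        by simp
    qed (use is_eobj_finite[OF X] is_eobj_finite[OF Y] in \<open>auto simp: inj_on_def\<close>)
    also have "\<dots> = (\<Sum>p\<in>dom (und X) \<times> dom (und Y). mat (eqv X) i' (fst p) * mat (eqv Y) j' (snd p)
        * tau_coeff D (the (und X (fst p))) (the (und Y (snd p))) (Cob 0)
        * mat k (Tens (fst p) (snd p) (Cob 0)) (Atom 0))"
    proof (rule sum.cong[OF refl])
      fix p
      show "mat (eqv (etensor D X Y)) (Tens i' j' (Cob 0)) (Tens (fst p) (snd p) (Cob 0))
          * mat (actm Gen k) (Tens (fst p) (snd p) (Cob 0)) (Atom 0)
        = mat (eqv X) i' (fst p) * mat (eqv Y) j' (snd p)
        * tau_coeff D (the (und X (fst p))) (the (und Y (snd p))) (Cob 0)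
        * mat k (Tens (fst p) (snd p) (Cob 0)) (Atom 0)"
      proof (cases "mat k (Tens (fst p) (snd p) (Cob 0)) (Atom 0) = 0")
        case False
        then have "tensor D (und X) (und Y) (Tens (fst p) (snd p) (Cob 0)) = Some (Cob 0)"
          by (auto elim: coev_support[OF k])
        then show ?thesis
          by (simp add: mat_eqv_etensor_unit[OF X Y])
      qed simp
    qed
    also have "\<dots> = (\<Sum>i\<in>dom (und X). \<Sum>j\<in>dom (und Y). mat (eqv X) i' i * mat (eqv Y) j' j
        * tau_coeff D (the (und X i)) (the (und Y j)) (Cob 0) * mat k (Tens i j (Cob 0)) (Atom 0))"
      by (simp add: sum.cartesian_product case_prod_beta)
    finally show ?thesis .
  qed
  have R: "mat (k \<bullet> eqv eunit) w (Atom 0) = mat k w (Atom 0)" for w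
    by (simp add: mat_compm chom_tgt[OF eqv_eunit_chom] mat_eqv_eunit)
  have "k \<in> ehom eunit (etensor D X Y) \<longleftrightarrow> eqv (etensor D X Y) \<bullet> actm Gen k = k \<bullet> eqv eunit"
    using k by (simp add: ehom_def)
  also have "\<dots> \<longleftrightarrow> (\<forall>i' j'. tensor D (und X) (und Y) (Tens i' j' (Cob 0)) = Some (Cob 0) \<longrightarrow>
      mat (eqv (etensor D X Y) \<bullet> actm Gen k) (Tens i' j' (Cob 0)) (Atom 0)
      = mat k (Tens i' j' (Cob 0)) (Atom 0))" (is "?l = ?r")
  proof
    assume ?l
    then show ?r by (simp add: R)
  next
    assume r: ?r
    show ?l
    proof (rule arrow_eqI[OF compm_chom[OF ak ec] compm_chom[OF eqv_eunit_chom k]])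
      fix w v
      assume "v \<in> dom (act Gen cunit)" "tensor D (und X) (und Y) w = act Gen cunit v"
      then have v: "v = Atom 0" and w: "tensor D (und X) (und Y) w = Some (Cob 0)"
        by (auto simp: act_def)
      from w obtain i' j' where "w = Tens i' j' (Cob 0)"
        by (auto simp: tensor_Some_iff)
      then show "mat (eqv (etensor D X Y) \<bullet> actm Gen k) w v = mat (k \<bullet> eqv eunit) w v"
        using r v w by (simp add: R)
    qed
  qed
  finally show ?thesis
    by (simp add: L)
qed

text \<open>A morphism to the unit lives on unit summands only. Besides evaluations this also
  handles the isomorphism from a product of two objects to the unit.\<close>

lemma ev_ehom_iff:
  assumes X: "is_eobj X" and Y: "is_eobj Y" and e: "e \<in> chom (tensor D (und Y) (und X)) cunit"
  shows "e \<in> ehom (etensor D Y X) eunit \<longleftrightarrow>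
    (\<forall>i j. tensor D (und Y) (und X) (Tens j i (Cob 0)) = Some (Cob 0) \<longrightarrow>
      mat e (Atom 0) (Tens j i (Cob 0)) =
      (\<Sum>j'\<in>dom (und Y). \<Sum>i'\<in>dom (und X). mat e (Atom 0) (Tens j' i' (Cob 0))
        * (mat (eqv Y) j' j * mat (eqv X) i' i
        * tau_coeff D (the (und Y j)) (the (und X i)) (Cob 0))))"
proof -
  note ec = eqv_etensor_chom[OF Y X, of D]
  have ae: "actm Gen e \<in> chom (act Gen (tensor D (und Y) (und X))) (act Gen cunit)"
    by (rule actm_chom[OF e])
  have R: "mat (e \<bullet> eqv (etensor D Y X)) (Atom 0) (Tens j i (Cob 0)) =
      (\<Sum>j'\<in>dom (und Y). \<Sum>i'\<in>dom (und X). mat e (Atom 0) (Tens j' i' (Cob 0))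
        * (mat (eqv Y) j' j * mat (eqv X) i' i
        * tau_coeff D (the (und Y j)) (the (und X i)) (Cob 0)))"
    if ij: "tensor D (und Y) (und X) (Tens j i (Cob 0)) = Some (Cob 0)" for i j
  proof -
    have "mat (e \<bullet> eqv (etensor D Y X)) (Atom 0) (Tens j i (Cob 0)) =
      (\<Sum>p\<in>dom (und Y) \<times> dom (und X). mat e (Atom 0) (Tens (fst p) (snd p) (Cob 0))
        * mat (eqv (etensor D Y X)) (Tens (fst p) (snd p) (Cob 0)) (Tens j i (Cob 0)))"
    proof (rule mat_compm_reindex[OF ec])
      fix v
      assume ne: "v \<notin> (\<lambda>p. Tens (fst p) (snd p) (Cob 0)) ` (dom (und Y) \<times> dom (und X))"
      have "mat e (Atom 0) v = 0"
        using ne by (rule contrapos_np) (auto elim!: ev_support[OF e] simp: image_iff)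
      then show "mat e (Atom 0) v * mat (eqv (etensor D Y X)) v (Tens j i (Cob 0)) = 0"
        by simp
    qed (use is_eobj_finite[OF X] is_eobj_finite[OF Y] in \<open>auto simp: inj_on_def\<close>)
    then show ?thesis
      by (simp add: mat_eqv_etensor_unit[OF Y X ij] sum.cartesian_product case_prod_beta)
  qed
  have L: "mat (eqv eunit \<bullet> actm Gen e) (Atom 0) w = mat e (Atom 0) w" for w
    by (simp add: mat_compm chom_tgt[OF e] mat_eqv_eunit)
  have "e \<in> ehom (etensor D Y X) eunit \<longleftrightarrow> eqv eunit \<bullet> actm Gen e = e \<bullet> eqv (etensor D Y X)"
    using e by (simp add: ehom_def)
  also have "\<dots> \<longleftrightarrow> (\<forall>i j. tensor D (und Y) (und X) (Tens j i (Cob 0)) = Some (Cob 0) \<longrightarrow>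
      mat e (Atom 0) (Tens j i (Cob 0)) =
      mat (e \<bullet> eqv (etensor D Y X)) (Atom 0) (Tens j i (Cob 0)))" (is "?l = ?r")
  proof
    assume l: ?l
    show ?r by (simp add: L flip: l)
  next
    assume r: ?r
    show ?l
    proof (rule arrow_eqI[OF compm_chom[OF ae eqv_eunit_chom] compm_chom[OF ec e]])
      fix w v
      assume "v \<in> dom (act Gen (tensor D (und Y) (und X)))"
        "cunit w = act Gen (tensor D (und Y) (und X)) v"
      then obtain t where t: "tensor D (und Y) (und X) v = Some t" "cunit w = Some (sact Gen t)"
        by (auto simp: act_def)
      then have w: "w = Atom 0" and "sact Gen t = sact Gen (Cob 0)"
        by auto
      then have "tensor D (und Y) (und X) v = Some (Cob 0)"
        using t unfolding sact_inject by simp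
      moreover from this obtain j i where "v = Tens j i (Cob 0)"
        by (auto simp: tensor_Some_iff)
      ultimately show "mat (eqv eunit \<bullet> actm Gen e) w v = mat (e \<bullet> eqv (etensor D Y X)) w v"
        using r w by (simp add: L)
    qed
  qed
  finally show ?thesis
    by (simp add: R)
qed

section \<open>Braiding, twist and trace on homogeneous objects\<close>

lemma addm_zero:
  assumes "f \<in> chom V W" "g \<in> chom V W" "\<And>w v. mat g w v = 0"
  shows "addm f g = f" "addm g f = f"
  using assms by (simp_all add: addm_def chom_def)

lemma component_eq:
  assumes "\<And>i A. V i = Some A \<Longrightarrow> grade A = h"
  shows "component h V = V" and "h' \<noteq> h \<Longrightarrow> component h' V = Map.empty"
  using assms by (auto simp: component_def fun_eq_iff split: option.splits)

lemma incl_chom: "incl h V \<in> chom (component h V) V"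
  and proj_chom: "proj h V \<in> chom V (component h V)"
  and cbraid_chom: "cbraid D h V W \<in> chom (tensor D V W) (tensor D (act h W) V)"
  and ctwist_chom: "ctwist D h V \<in> chom V (act h V)"
  by (simp_all add: incl_def proj_def cbraid_def ctwist_def)

lemma eqv_at_chom:
  assumes "is_eobj X"
  shows "eqv_at X h \<in> chom (act h (und X)) (und X)"
  using is_eobj_chom[OF assms] by (cases h) simp_all

lemma tensor_empty_left [simp]: "tensor D Map.empty W = Map.empty"
  by (auto simp: tensor_def fun_eq_iff split: label.splits)

text \<open>The part in the other degree factors through an empty source, and in degree
  \<open>h\<close> the inclusion and the projection are identities.\<close>

lemma ebraid_homogeneous:
  assumes X: "is_eobj X" and Y: "is_eobj Y"
    and gr: "\<And>i A. und X i = Some A \<Longrightarrow> grade A = h"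
  shows "ebraid D X Y = tensorm D (eqv_at Y h) (idm (und X)) \<bullet> cbraid D h (und X) (und Y)"
proof -
  have fin: "finite (dom (tensor D (und X) (und Y)))"
    using is_eobj_finite[OF X] is_eobj_finite[OF Y] by simp
  have part_chom: "ebraid_part D X Y h' \<in> chom (tensor D (und X) (und Y)) (tensor D (und Y) (und X))" for h'
    unfolding ebraid_part_def
    by (rule compm_chom[OF compm_chom[OF tensorm_chom[OF proj_chom idm_chom] cbraid_chom]
          tensorm_chom[OF eqv_at_chom[OF Y] incl_chom], unfolded compm_assoc])
  have zero: "mat (ebraid_part D X Y h') w v = 0" if "h' \<noteq> h" for h' w v
  proof -
    have "mat (cbraid D h' (component h' (und X)) (und Y)) p q = 0" for p q
      using component_eq(2)[OF gr that] by (simp add: cbraid_def mat_arr)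
    then show ?thesis
      by (simp add: ebraid_part_def mat_compm)
  qed
  have "proj h (und X) = idm (und X)" "incl h (und X) = idm (und X)"
    using component_eq(1)[OF gr] by (simp_all add: proj_def incl_def idm_def)
  then have "ebraid_part D X Y h = tensorm D (eqv_at Y h) (idm (und X)) \<bullet> cbraid D h (und X) (und Y)"
    using component_eq(1)[OF gr] compm_idm_right[OF cbraid_chom fin]
    by (simp add: ebraid_part_def tensorm_idm)
  moreover have "ebraid D X Y = ebraid_part D X Y h"
    unfolding ebraid_def using addm_zero[OF part_chom part_chom zero] by (cases h) auto
  ultimately show ?thesis by simp
qed

lemma etwist_homogeneous:
  assumes X: "is_eobj X" and gr: "\<And>i A. und X i = Some A \<Longrightarrow> grade A = h"
  shows "etwist D X = eqv_at X h \<bullet> ctwist D h (und X)"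
proof -
  have part_chom: "etwist_part D X h' \<in> chom (und X) (und X)" for h'
    unfolding etwist_part_def
    by (rule compm_chom[OF compm_chom[OF compm_chom[OF proj_chom ctwist_chom]
          actm_chom[OF incl_chom]] eqv_at_chom[OF X], unfolded compm_assoc])
  have zero: "mat (etwist_part D X h') w v = 0" if "h' \<noteq> h" for h' w v
  proof -
    have "mat (ctwist D h' (component h' (und X))) p q = 0" for p q
      using component_eq(2)[OF gr that] by (simp add: ctwist_def mat_arr)
    then show ?thesis
      by (simp add: etwist_part_def mat_compm)
  qed
  have "proj h (und X) = idm (und X)" "incl h (und X) = idm (und X)"
    using component_eq(1)[OF gr] by (simp_all add: proj_def incl_def idm_def)
  then have "etwist_part D X h = eqv_at X h \<bullet> ctwist D h (und X)"
    using component_eq(1)[OF gr] is_eobj_finite[OF X]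
    by (simp add: etwist_part_def actm_idm compm_idm_left[OF ctwist_chom] compm_idm_right[OF ctwist_chom])
  moreover have "etwist D X = etwist_part D X h"
    unfolding etwist_def using addm_zero[OF part_chom part_chom zero] by (cases h) auto
  ultimately show ?thesis by simp
qed

lemma tensor_braided:
  assumes "grade A = h" "Cob 0 \<in> fus D A B"
  shows "Cob 0 \<in> fus D (sact h B) A"
  using assms by (cases A; cases B) (auto simp: add.commute add.left_commute)

lemma mat_cbraid_nonzero:
  assumes "mat (cbraid D h X Y) w v \<noteq> 0"
  obtains i j t where "w = Tens j i t" "v = Tens i j t"
proof -
  note n = chom_nonzero[OF cbraid_chom assms]
  then obtain t where v: "tensor D X Y v = Some t" and w: "tensor D (act h Y) X w = Some t"
    by auto
  obtain i j where v': "v = Tens i j t"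
    using v by (auto simp: tensor_Some_iff)
  obtain j' i' where w': "w = Tens j' i' t"
    using w by (auto simp: tensor_Some_iff)
  show thesis
    using assms that unfolding v' w' by (auto simp: cbraid_def mat_arr split: if_splits)
qed

text \<open>The twist is diagonal and the braiding only exchanges \<open>i\<close> and
  \<open>j\<close>; the equivariant structure of \<open>Y\<close> may mix its summands, which is why
  both \<open>j\<close> and \<open>j'\<close> occur.\<close>

lemma trace_entry:
  assumes fX: "finite (dom X)" and fY: "finite (dom Y)"
    and gr: "\<And>i A. X i = Some A \<Longrightarrow> grade A = h"
    and e: "e \<in> chom (tensor D Y X) cunit" and k: "k \<in> chom cunit (tensor D X Y)"
    and tw: "tw \<in> chom X X"
    and tw_diag: "\<And>i i'. mat tw i' i = (if i' = i \<and> i \<in> dom X then \<theta> i else 0)"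
    and ph: "\<phi> \<in> chom (act h Y) Y"
  shows "mat (e \<bullet> (tensorm D \<phi> (idm X) \<bullet> cbraid D h X Y) \<bullet> tensorm D tw (idm Y) \<bullet> k) (Atom 0) (Atom 0) =
    (\<Sum>j'\<in>dom Y. \<Sum>i\<in>dom X. mat e (Atom 0) (Tens j' i (Cob 0)) * (\<Sum>j\<in>dom Y. mat \<phi> j' j
      * (braid_coeff D (the (X i)) (the (Y j)) (Cob 0) * (\<theta> i * mat k (Tens i j (Cob 0)) (Atom 0)))))"
proof -
  define c2 where "c2 = tensorm D tw (idm Y) \<bullet> k"
  define c3 where "c3 = cbraid D h X Y \<bullet> c2"
  define c4 where "c4 = tensorm D \<phi> (idm X) \<bullet> c3"
  have c2: "c2 \<in> chom cunit (tensor D X Y)"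
    unfolding c2_def by (rule compm_chom[OF k tensorm_chom[OF tw idm_chom]])
  have c3: "c3 \<in> chom cunit (tensor D (act h Y) X)"
    unfolding c3_def by (rule compm_chom[OF c2 cbraid_chom])
  have c4: "c4 \<in> chom cunit (tensor D Y X)"
    unfolding c4_def by (rule compm_chom[OF c3 tensorm_chom[OF ph idm_chom]])
  have m2: "mat c2 (Tens i j (Cob 0)) (Atom 0) = \<theta> i * mat k (Tens i j (Cob 0)) (Atom 0)" for i j
  proof -
    have "mat c2 (Tens i j (Cob 0)) (Atom 0) =
        mat (tensorm D tw (idm Y)) (Tens i j (Cob 0)) (Tens i j (Cob 0)) * mat k (Tens i j (Cob 0)) (Atom 0)"
      unfolding c2_def
    proof (rule mat_compm_single[OF k])
      fix v
      assume ne: "v \<noteq> Tens i j (Cob 0)"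
      have "mat (tensorm D tw (idm Y)) (Tens i j (Cob 0)) v = 0"
        using ne by (rule contrapos_np)
          (auto elim!: mat_tensorm_nonzero[OF tw idm_chom] simp: tw_diag mat_idm split: if_splits)
      then show "mat (tensorm D tw (idm Y)) (Tens i j (Cob 0)) v * mat k v (Atom 0) = 0"
        by simp
    qed (use fX fY in simp)
    also have "\<dots> = \<theta> i * mat k (Tens i j (Cob 0)) (Atom 0)"
    proof (cases "mat k (Tens i j (Cob 0)) (Atom 0) = 0")
      case False
      then have "tensor D X Y (Tens i j (Cob 0)) = Some (Cob 0)" "i \<in> dom X" "j \<in> dom Y"
        by (auto elim: coev_support[OF k])
      then show ?thesis
        by (simp add: mat_tensorm[OF tw idm_chom] tw_diag mat_idm)
    qed simp
    finally show ?thesis .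
  qed
  have m3: "mat c3 (Tens j i (Cob 0)) (Atom 0) = braid_coeff D (the (X i)) (the (Y j)) (Cob 0)
      * mat c2 (Tens i j (Cob 0)) (Atom 0)" for i j
  proof -
    have "mat c3 (Tens j i (Cob 0)) (Atom 0) =
        mat (cbraid D h X Y) (Tens j i (Cob 0)) (Tens i j (Cob 0)) * mat c2 (Tens i j (Cob 0)) (Atom 0)"
      unfolding c3_def
    proof (rule mat_compm_single[OF c2])
      fix v
      assume ne: "v \<noteq> Tens i j (Cob 0)"
      have "mat (cbraid D h X Y) (Tens j i (Cob 0)) v = 0"
        using ne by (rule contrapos_np) (auto elim!: mat_cbraid_nonzero)
      then show "mat (cbraid D h X Y) (Tens j i (Cob 0)) v * mat c2 v (Atom 0) = 0"
        by simp
    qed (use fX fY in simp)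
    also have "\<dots> = braid_coeff D (the (X i)) (the (Y j)) (Cob 0) * mat c2 (Tens i j (Cob 0)) (Atom 0)"
    proof (cases "mat c2 (Tens i j (Cob 0)) (Atom 0) = 0")
      case False
      then have t: "tensor D X Y (Tens i j (Cob 0)) = Some (Cob 0)"
        by (auto elim: coev_support[OF c2])
      then obtain A B where AB: "X i = Some A" "Y j = Some B" "Cob 0 \<in> fus D A B"
        by (auto simp: tensor_Some_iff)
      then have "tensor D (act h Y) X (Tens j i (Cob 0)) = Some (Cob 0)"
        using tensor_braided[OF gr[OF AB(1)] AB(3)] by (simp add: tensor_Some_iff act_def)
      then show ?thesis
        using t by (simp add: cbraid_def mat_arr domIff)
    qed simp
    finally show ?thesis .
  qed
  have m4: "mat c4 (Tens j' i (Cob 0)) (Atom 0) =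
      (\<Sum>j\<in>dom Y. mat \<phi> j' j * mat c3 (Tens j i (Cob 0)) (Atom 0))" for j' i
  proof -
    have "mat c4 (Tens j' i (Cob 0)) (Atom 0) =
      (\<Sum>j\<in>dom Y. mat (tensorm D \<phi> (idm X)) (Tens j' i (Cob 0)) (Tens j i (Cob 0))
        * mat c3 (Tens j i (Cob 0)) (Atom 0))"
      unfolding c4_def
    proof (rule mat_compm_reindex[OF c3])
      fix v
      assume ne: "v \<notin> (\<lambda>j. Tens j i (Cob 0)) ` dom Y"
      have "mat (tensorm D \<phi> (idm X)) (Tens j' i (Cob 0)) v = 0"
      proof (rule ccontr)
        assume "mat (tensorm D \<phi> (idm X)) (Tens j' i (Cob 0)) v \<noteq> 0"
        then obtain j l where v: "v = Tens j l (Cob 0)" and "mat \<phi> j' j \<noteq> 0" "mat (idm X) i l \<noteq> 0"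
          by (auto elim!: mat_tensorm_nonzero[OF ph idm_chom])
        then have "j \<in> dom Y" "l = i"
          using chom_nonzero(1)[OF ph, of j' j] by (auto simp: mat_idm split: if_splits)
        then show False
          using ne v by auto
      qed
      then show "mat (tensorm D \<phi> (idm X)) (Tens j' i (Cob 0)) v * mat c3 v (Atom 0) = 0"
        by simp
    qed (use fX fY in \<open>auto simp: inj_on_def\<close>)
    also have "\<dots> = (\<Sum>j\<in>dom Y. mat \<phi> j' j * mat c3 (Tens j i (Cob 0)) (Atom 0))"
    proof (rule sum.cong[OF refl])
      fix j
      show "mat (tensorm D \<phi> (idm X)) (Tens j' i (Cob 0)) (Tens j i (Cob 0))
          * mat c3 (Tens j i (Cob 0)) (Atom 0) = mat \<phi> j' j * mat c3 (Tens j i (Cob 0)) (Atom 0)"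
      proof (cases "mat c3 (Tens j i (Cob 0)) (Atom 0) = 0")
        case False
        then have "tensor D (act h Y) X (Tens j i (Cob 0)) = Some (Cob 0)" "i \<in> dom X"
          by (auto elim: coev_support[OF c3])
        then show ?thesis
          by (simp add: mat_tensorm[OF ph idm_chom] mat_idm)
      qed simp
    qed
    finally show ?thesis .
  qed
  have "mat (e \<bullet> c4) (Atom 0) (Atom 0) = (\<Sum>p\<in>dom Y \<times> dom X.
      mat e (Atom 0) (Tens (fst p) (snd p) (Cob 0)) * mat c4 (Tens (fst p) (snd p) (Cob 0)) (Atom 0))"
  proof (rule mat_compm_reindex[OF c4])
    fix v
    assume ne: "v \<notin> (\<lambda>p. Tens (fst p) (snd p) (Cob 0)) ` (dom Y \<times> dom X)"
    have "mat e (Atom 0) v = 0"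
      using ne by (rule contrapos_np) (auto elim!: ev_support[OF e] simp: image_iff)
    then show "mat e (Atom 0) v * mat c4 v (Atom 0) = 0"
      by simp
  qed (use fX fY in \<open>auto simp: inj_on_def\<close>)
  also have "e \<bullet> c4 = e \<bullet> (tensorm D \<phi> (idm X) \<bullet> cbraid D h X Y) \<bullet> tensorm D tw (idm Y) \<bullet> k"
    by (simp add: c4_def c3_def c2_def compm_assoc)
  finally show ?thesis
    by (simp add: m4 m3 m2 sum.cartesian_product case_prod_beta)
qed

section \<open>Dimensions of homogeneous objects\<close>

lemma snake1_chom:
  assumes "finite (dom X)" "e \<in> chom (tensor D Y X) cunit" "k \<in> chom cunit (tensor D X Y)"
  shows "runit D X \<bullet> tensorm D (idm X) e \<bullet> associator D X Y X
      \<bullet> tensorm D k (idm X) \<bullet> invm (lunit D X) \<in> chom X X"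
  unfolding invm_lunit[OF assms(1)]
  by (rule compm_chom[OF compm_chom[OF compm_chom[OF compm_chom[OF lunit_inv_chom
        tensorm_chom[OF assms(3) idm_chom]] associator_chom] tensorm_chom[OF idm_chom assms(2)]] runit_chom])

lemma snake2_chom:
  assumes "finite (dom Y)" "e \<in> chom (tensor D Y X) cunit" "k \<in> chom cunit (tensor D X Y)"
    and "invm (associator D Y X Y) = assoc_inv D Y X Y"
  shows "lunit D Y \<bullet> tensorm D e (idm Y) \<bullet> invm (associator D Y X Y)
      \<bullet> tensorm D (idm Y) k \<bullet> invm (runit D Y) \<in> chom Y Y"
  unfolding invm_runit[OF assms(1)] assms(4)
  by (rule compm_chom[OF compm_chom[OF compm_chom[OF compm_chom[OF runit_inv_chom
        tensorm_chom[OF idm_chom assms(3)]] assoc_inv_chom] tensorm_chom[OF assms(2) idm_chom]] lunit_chom])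

lemma is_dualI:
  assumes X: "is_eobj X" and Y: "is_eobj Y"
    and e: "e \<in> ehom (etensor D Y X) eunit" and k: "k \<in> ehom eunit (etensor D X Y)"
    and inv: "is_inverse (associator D (und Y) (und X) (und Y)) (assoc_inv D (und Y) (und X) (und Y))"
    and s1: "\<And>i i' A. und X i = Some A \<Longrightarrow> und X i' = Some A \<Longrightarrow>
      (\<Sum>j\<in>dom (und Y). mat e (Atom 0) (Tens j i (Cob 0))
      * assoc_coeff D A (the (und Y j)) A (Cob 0) (Cob 0) A * mat k (Tens i' j (Cob 0)) (Atom 0))
      = (if i' = i then 1 else 0)"
    and s2: "\<And>j j' B. und Y j = Some B \<Longrightarrow> und Y j' = Some B \<Longrightarrow>
      (\<Sum>i\<in>dom (und X). mat e (Atom 0) (Tens j i (Cob 0))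
      * assoc_inv_coeff D B (the (und X i)) B (Cob 0) (Cob 0) * mat k (Tens i j' (Cob 0)) (Atom 0))
      = (if j' = j then 1 else 0)"
  shows "is_dual D X Y e k"
proof -
  note fX = is_eobj_finite[OF X] and fY = is_eobj_finite[OF Y]
  have ec: "e \<in> chom (tensor D (und Y) (und X)) cunit" and kc: "k \<in> chom cunit (tensor D (und X) (und Y))"
    using ehom_chom[OF e] ehom_chom[OF k] by simp_all
  have inv': "invm (associator D (und Y) (und X) (und Y)) = assoc_inv D (und Y) (und X) (und Y)"
    using fX fY by (intro invm_eq[OF associator_chom _ _ inv]) simp_all
  have "runit D (und X) \<bullet> tensorm D (idm (und X)) e \<bullet> associator D (und X) (und Y) (und X)
       \<bullet> tensorm D k (idm (und X)) \<bullet> invm (lunit D (und X)) = idm (und X)"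
  proof (rule arrow_eqI[OF snake1_chom[OF fX ec kc] idm_chom])
    fix i' i
    assume i: "i \<in> dom (und X)" and i': "und X i' = und X i"
    obtain A where A: "und X i = Some A"
      using i by auto
    have A': "und X i' = Some A"
      using A i' by simp
    show "mat (runit D (und X) \<bullet> tensorm D (idm (und X)) e \<bullet> associator D (und X) (und Y) (und X)
       \<bullet> tensorm D k (idm (und X)) \<bullet> invm (lunit D (und X))) i' i = mat (idm (und X)) i' i"
      using i unfolding snake1_entry[OF fX fY ec kc A A'] s1[OF A A'] mat_idm by simp
  qed
  moreover have "lunit D (und Y) \<bullet> tensorm D e (idm (und Y)) \<bullet> invm (associator D (und Y) (und X) (und Y))
       \<bullet> tensorm D (idm (und Y)) k \<bullet> invm (runit D (und Y)) = idm (und Y)"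
  proof (rule arrow_eqI[OF snake2_chom[OF fY ec kc inv'] idm_chom])
    fix i' i
    assume i: "i \<in> dom (und Y)" and i': "und Y i' = und Y i"
    obtain A where A: "und Y i = Some A"
      using i by auto
    have A': "und Y i' = Some A"
      using A i' by simp
    show "mat (lunit D (und Y) \<bullet> tensorm D e (idm (und Y)) \<bullet> invm (associator D (und Y) (und X) (und Y))
       \<bullet> tensorm D (idm (und Y)) k \<bullet> invm (runit D (und Y))) i' i = mat (idm (und Y)) i' i"
      using i unfolding snake2_entry[OF fX fY ec kc inv' A A'] s2[OF A A'] mat_idm by simp
  qed
  ultimately show ?thesis
    using Y e k by (simp add: is_dual_def)
qed

text \<open>Of the snake identities only the diagonal entries of the first are retained, since the
  trace is compared with exactly these sums.\<close>

lemma is_dualD: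
  assumes X: "is_eobj X" and d: "is_dual D X Y e k"
  shows "is_eobj Y" "e \<in> chom (tensor D (und Y) (und X)) cunit"
    "k \<in> chom cunit (tensor D (und X) (und Y))" "k \<in> ehom eunit (etensor D X Y)"
    and "und X i = Some A \<Longrightarrow> (\<Sum>j\<in>dom (und Y). mat e (Atom 0) (Tens j i (Cob 0))
      * assoc_coeff D A (the (und Y j)) A (Cob 0) (Cob 0) A * mat k (Tens i j (Cob 0)) (Atom 0)) = 1"
proof -
  show Y: "is_eobj Y" and k: "k \<in> ehom eunit (etensor D X Y)"
    using d by (simp_all add: is_dual_def)
  have e: "e \<in> ehom (etensor D Y X) eunit"
    using d by (simp add: is_dual_def)
  show ec: "e \<in> chom (tensor D (und Y) (und X)) cunit" and kc: "k \<in> chom cunit (tensor D (und X) (und Y))"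
    using ehom_chom[OF e] ehom_chom[OF k] by simp_all
  assume i: "und X i = Some A"
  have "mat (runit D (und X) \<bullet> tensorm D (idm (und X)) e \<bullet> associator D (und X) (und Y) (und X)
       \<bullet> tensorm D k (idm (und X)) \<bullet> invm (lunit D (und X))) i i = mat (idm (und X)) i i"
    using d by (simp add: is_dual_def)
  then show "(\<Sum>j\<in>dom (und Y). mat e (Atom 0) (Tens j i (Cob 0))
      * assoc_coeff D A (the (und Y j)) A (Cob 0) (Cob 0) A * mat k (Tens i j (Cob 0)) (Atom 0)) = 1"
    using i unfolding snake1_entry[OF is_eobj_finite[OF X] is_eobj_finite[OF Y] ec kc i i] mat_idm
    by auto
qed

lemma scalar_arrow_iff:
  fixes f :: "'g::zero arrow"
  assumes "f \<in> chom cunit cunit"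
  shows "f = scalem d (idm cunit) \<longleftrightarrow> mat f (Atom 0) (Atom 0) = d"
proof
  have s: "scalem d (idm cunit) \<in> chom (cunit :: 'g cobj) cunit"
    by (auto simp: scalem_def chom_def mat_idm)
  have m: "mat (scalem d (idm (cunit :: 'g cobj))) (Atom 0) (Atom 0) = d"
    by (simp add: scalem_def mat_idm)
  show "f = scalem d (idm cunit) \<Longrightarrow> mat f (Atom 0) (Atom 0) = d"
    using m by simp
  assume d: "mat f (Atom 0) (Atom 0) = d"
  show "f = scalem d (idm cunit)"
  proof (rule arrow_eqI[OF assms s])
    fix w v :: "'g label"
    assume "v \<in> dom cunit" "cunit w = cunit v"
    then have "v = Atom 0" "w = Atom 0"
      by (auto simp: cunit_def split: if_splits)
    then show "mat f w v = mat (scalem d (idm cunit)) w v"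
      using d m by simp
  qed
qed

lemma etwist_chom:
  assumes X: "is_eobj X" and gr: "\<And>i A. und X i = Some A \<Longrightarrow> grade A = h"
  shows "etwist D X \<in> chom (und X) (und X)"
proof -
  have "etwist D X = eqv_at X h \<bullet> ctwist D h (und X)"
    by (rule etwist_homogeneous[OF X]) (rule gr)
  then show ?thesis
    by (simp add: compm_chom[OF ctwist_chom eqv_at_chom[OF X]])
qed

text \<open>The definite description in \<open>qdim\<close> asks for existence, given by the dual in
  \<open>ex\<close>, and for uniqueness, which follows because \<open>tr\<close> assigns the same
  value to every dual.\<close>

lemma qdimI:
  assumes X: "is_eobj X" and gr: "\<And>i A. und X i = Some A \<Longrightarrow> grade A = h"
    and tr: "\<And>Y e k. is_dual D X Y e k \<Longrightarrow>
      mat (e \<bullet> ebraid D X Y \<bullet> tensorm D (etwist D X) (idm (und Y)) \<bullet> k) (Atom 0) (Atom 0) = d"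
    and ex: "is_dual D X Y0 e0 k0"
  shows "qdim D X = d"
proof -
  have iff: "e \<bullet> ebraid D X Y \<bullet> tensorm D (etwist D X) (idm (und Y)) \<bullet> k = scalem d' (idm cunit) \<longleftrightarrow> d = d'"
    if dual: "is_dual D X Y e k" for Y e k d'
  proof -
    note Y = is_dualD(1)[OF X dual]
    have "ebraid D X Y = tensorm D (eqv_at Y h) (idm (und X)) \<bullet> cbraid D h (und X) (und Y)"
      by (rule ebraid_homogeneous[OF X Y]) (rule gr)
    then have b: "ebraid D X Y \<in> chom (tensor D (und X) (und Y)) (tensor D (und Y) (und X))"
      by (simp add: compm_chom[OF cbraid_chom tensorm_chom[OF eqv_at_chom[OF Y] idm_chom]])
    have t: "etwist D X \<in> chom (und X) (und X)"
      by (rule etwist_chom[OF X]) (rule gr)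
    have "e \<bullet> ebraid D X Y \<bullet> tensorm D (etwist D X) (idm (und Y)) \<bullet> k \<in> chom cunit cunit"
      by (rule compm_chom[OF compm_chom[OF compm_chom[OF is_dualD(3)[OF X dual]
              tensorm_chom[OF t idm_chom]] b] is_dualD(2)[OF X dual], unfolded compm_assoc])
    then show ?thesis
      using tr[OF dual] by (simp add: scalar_arrow_iff)
  qed
  show ?thesis
    unfolding qdim_def
  proof (rule the_equality)
    show "\<exists>Y e k. is_dual D X Y e k \<and>
        e \<bullet> ebraid D X Y \<bullet> tensorm D (etwist D X) (idm (und Y)) \<bullet> k = scalem d (idm cunit)"
      using ex iff[OF ex, of d] by blast
    show "d' = d" if "\<exists>Y e k. is_dual D X Y e k \<and>
        e \<bullet> ebraid D X Y \<bullet> tensorm D (etwist D X) (idm (und Y)) \<bullet> k = scalem d' (idm cunit)" for d'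
      using that iff[of _ _ _ d'] by auto
  qed
qed

lemma fus_unit_comm: "Cob 0 \<in> fus D A B \<longleftrightarrow> Cob 0 \<in> fus D B A"
  by (cases A; cases B) (auto simp: add.commute add.left_commute)

lemma tensor_unit_comm:
  "tensor D X Y (Tens i j (Cob 0)) = Some (Cob 0) \<longleftrightarrow> tensor D Y X (Tens j i (Cob 0)) = Some (Cob 0)"
  unfolding tensor_Some_iff using fus_unit_comm[of D] by blast

section \<open>Consequences of the axioms for the input data\<close>

lemma dbl_double [simp]: "a + a \<in> dbl"
  by (simp add: dbl_def)

lemma dbl_0 [simp]: "0 \<in> dbl"
  using dbl_double[of 0] by simp

lemma dbl_nonempty [simp]: "dbl \<noteq> {}"
  using dbl_0 by blast

lemma dbl_add:
  assumes "a \<in> dbl" "b \<in> dbl"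
  shows "a + b \<in> dbl"
proof -
  obtain x y where "a = x + x" "b = y + y"
    using assms by (auto simp: dbl_def)
  then have "a + b = (x + y) + (x + y)"
    by (simp add: algebra_simps)
  then show ?thesis
    by (simp only: dbl_double)
qed

lemma dbl_minus:
  assumes "a \<in> dbl"
  shows "- a \<in> dbl"
proof -
  obtain x where "a = x + x"
    using assms by (auto simp: dbl_def)
  then have "- a = (- x) + (- x)"
    by simp
  then show ?thesis
    by (simp only: dbl_double)
qed

lemma dbl_diff: "a \<in> dbl \<Longrightarrow> b \<in> dbl \<Longrightarrow> a - b \<in> dbl"
  using dbl_add[of a "- b"] dbl_minus[of b] by simp

lemma plus_dbl: "t \<in> dbl \<Longrightarrow> t +o dbl = dbl"
proof (intro set_eqI iffI)
  fix x
  assume t: "t \<in> dbl"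
  show "x \<in> t +o dbl \<Longrightarrow> x \<in> dbl"
    using t dbl_add by (auto simp: elt_set_plus_def)
  assume "x \<in> dbl"
  then have "x - t \<in> dbl" "x = t + (x - t)"
    using t dbl_diff by auto
  then show "x \<in> t +o dbl"
    unfolding elt_set_plus_def by blast
qed

lemma dbl_plus_dbl: "dbl + dbl = (dbl :: 'g::ab_group_add set)"
proof (intro set_eqI iffI)
  show "x \<in> dbl + dbl \<Longrightarrow> x \<in> dbl" for x :: 'g
    by (auto elim!: set_plus_elim intro: dbl_add)
  show "x \<in> dbl \<Longrightarrow> x \<in> dbl + dbl" for x :: 'g
    using set_plus_intro[of x dbl 0 dbl] by simp
qed

lemma coset_plus: "(a +o dbl) + (b +o dbl) = (a + b) +o (dbl :: 'g::ab_group_add set)"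
  by (simp add: set_plus_rearrange dbl_plus_dbl)

lemma cosets2_plus: "x \<in> cosets2 \<Longrightarrow> y \<in> cosets2 \<Longrightarrow> x + y \<in> cosets2"
  unfolding cosets2_def by (auto simp: coset_plus)

text \<open>Twice the class of a is the class of 2a. Applied to \<delta> + x, this puts the unit
  into the product of X^x with X^(\<delta>+x).\<close>

lemma cosets2_double:
  assumes "x \<in> cosets2"
  shows "x + x = dbl"
  using assms unfolding cosets2_def by (auto simp only: coset_plus plus_dbl dbl_double)

lemma dbl_plus_coset:
  assumes "t \<in> dbl" "x \<in> cosets2"
  shows "t +o x = x"
proof -
  obtain a where "x = a +o dbl"
    using assms(2) by (auto simp: cosets2_def)
  then show ?thesis
    using plus_dbl[OF assms(1)] by (metis add.commute set_plus_rearrange2)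
qed

locale crossed_input =
  fixes D :: "'g::{ab_group_add,finite} crossed_data"
  assumes valid: "valid_data D"
begin

section \<open>Identities for \<sigma>, \<omega> and q\<close>

lemma sigma_nonzero: "dsigma D a b \<noteq> 0"
  and om_pm: "domega D a b c = 1 \<or> domega D a b c = - 1"
  and sigma_diag: "dsigma D a a = dQ D a"
  and sigma_0 [simp]: "dsigma D a 0 = 1" "dsigma D 0 a = 1"
  and sigma_sym: "dsigma D a b = dsigma D b a"
  and om_eq: "domega D a b c = dsigma D a (b + c) / (dsigma D a b * dsigma D a c)"
  and om_add: "domega D (a + a') b c = domega D a b c * domega D a' b c"
  and delta_coset: "ddelta D \<in> cosets2"
  and eps_pm: "deps D = 1 \<or> deps D = - 1"
  and form: "discriminant_form (dQ D)"
  using valid unfolding valid_data_def by blast+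

lemma om_sq: "domega D a b c * domega D a b c = 1"
  using om_pm[of a b c] by auto

lemma om_swap: "domega D a b c = domega D a c b"
  by (simp add: om_eq add.commute)

lemma om_0_left: "domega D 0 b c = 1"
  using om_add[of 0 0 b c] om_pm[of 0 b c] by auto

lemma om_minus: "domega D (- a) b c = domega D a b c"
  using om_add[of a "- a" b c] om_pm[of a b c] om_pm[of "- a" b c] by (auto simp: om_0_left)

text \<open>By additivity, the value at 2a is the square of a sign.\<close>

lemma om_dbl: "r \<in> dbl \<Longrightarrow> domega D r b c = 1"
  using om_add om_sq by (auto simp: dbl_def)

text \<open>Since \<sigma>(a, 0) = 1 for every a, the representative picked in \<open>omc\<close>
  does not affect the value. It follows that \<tau> is 1 on the unit summand of two objects of
  degree g.\<close>

lemma omc_0: "omc D x 0 0 = 1"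
  by (simp add: omc_def om_eq)

lemma sigma_add: "dsigma D a (b + c) = domega D a b c * dsigma D a b * dsigma D a c"
  using sigma_nonzero by (simp add: om_eq)

text \<open>At a = b = 0 the relation between q and \<sigma> reads 1/q(0) = 1. So the braiding of
  two objects of degree g acts on the unit summand by \<alpha>.\<close>

lemma q_0: "dq D 0 = 1"
proof -
  have "dq D (0 + 0) / (dq D 0 * dq D 0) = dsigma D 0 0 * domega D (0 + 0) 0 0 * omc D (ddelta D) 0 0"
    and "dq D 0 \<noteq> 0"
    using valid unfolding valid_data_def by blast+
  then show ?thesis
    by (simp add: omc_0 om_0_left)
qed

text \<open>On \<open>2\<Gamma>\<close> the function \<open>\<sigma>\<close> is a bicharacter, and the relation
  \<open>\<sigma>(r, 2b) = \<sigma>(r, b)\<^sup>2 = B\<^sub>Q(r, b)\<close> makes it nondegenerate there.\<close>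

lemma sigma_dbl_add: "r \<in> dbl \<Longrightarrow> dsigma D r (b + c) = dsigma D r b * dsigma D r c"
  by (simp add: sigma_add om_dbl)

lemma sigma_add_dbl: "r \<in> dbl \<Longrightarrow> dsigma D (b + c) r = dsigma D b r * dsigma D c r"
  using sigma_dbl_add sigma_sym by metis

text \<open>Expand Q(r + b) = \<sigma>(r + b, r + b). Values of \<omega> with first argument in
  2\<Gamma> are 1, and the remaining sign \<omega>(b, r, b) occurs twice.\<close>

lemma polar_dbl:
  assumes r: "r \<in> dbl"
  shows "polar (dQ D) r b = dsigma D r (b + b)"
proof -
  have "dQ D (r + b) = domega D (r + b) r b * dsigma D (r + b) r * dsigma D (r + b) b"
    by (simp add: sigma_add flip: sigma_diag)
  also have "domega D (r + b) r b = domega D b r b"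
    by (simp add: om_add om_dbl[OF r])
  also have "dsigma D (r + b) r = dQ D r * dsigma D r b"
    using r by (simp add: sigma_add_dbl sigma_diag sigma_sym[of b r])
  also have "dsigma D (r + b) b = domega D b r b * dsigma D r b * dQ D b"
    by (simp add: sigma_sym[of "r + b" b] sigma_add sigma_diag sigma_sym[of b r])
  finally have "dQ D (r + b) = (domega D b r b * domega D b r b) * (dsigma D r b * dsigma D r b) * (dQ D r * dQ D b)"
    by (simp add: algebra_simps)
  moreover have "dQ D r \<noteq> 0" "dQ D b \<noteq> 0"
    using sigma_nonzero by (metis sigma_diag)+
  ultimately show ?thesis
    using r by (simp add: polar_def om_sq sigma_dbl_add)
qed

text \<open>Testing \<sigma>(t, .) on all doubles b + b is testing B_Q(t, .) on all of
  \<Gamma>.\<close>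

lemma sigma_nondegenerate:
  assumes "t \<in> dbl" "\<And>r. r \<in> dbl \<Longrightarrow> dsigma D t r = 1"
  shows "t = 0"
proof -
  have "polar (dQ D) t b = 1" for b
    using assms by (simp add: polar_dbl)
  then show ?thesis
    using form unfolding discriminant_form_def by blast
qed

text \<open>A nontrivial character sums to zero: translating by some r0 with \<sigma>(t, r0)
  \<noteq> 1 multiplies the sum by that value.\<close>

lemma sigma_sum_zero:
  assumes t: "t \<in> dbl" "t \<noteq> 0"
  shows "(\<Sum>r\<in>dbl. dsigma D t r) = 0"
proof -
  obtain r0 where r0: "r0 \<in> dbl" "dsigma D t r0 \<noteq> 1"
    using sigma_nondegenerate t by blast
  have "(\<Sum>r\<in>dbl. dsigma D t r) = (\<Sum>r\<in>dbl. dsigma D t (r0 + r))"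
    by (rule sum.reindex_bij_witness[of _ "\<lambda>r. r0 + r" "\<lambda>r. r - r0"])
      (use r0 dbl_add dbl_diff in auto)
  also have "\<dots> = dsigma D t r0 * (\<Sum>r\<in>dbl. dsigma D t r)"
    by (simp add: sigma_dbl_add[OF t(1)] sum_distrib_left)
  finally show ?thesis
    using r0(2) by (simp add: algebra_simps)
qed

text \<open>The quotient of the characters of t and t' is that of t - t', which is trivial only for
  t = t'.\<close>

lemma sigma_orthogonal:
  assumes "t \<in> dbl" "t' \<in> dbl"
  shows "(\<Sum>r\<in>dbl. dsigma D t r * inverse (dsigma D t' r)) =
    (if t = t' then of_nat (card (dbl :: 'g set)) else 0)"
proof -
  have "dsigma D t r * inverse (dsigma D t' r) = dsigma D (t - t') r" if "r \<in> dbl" for r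
    using sigma_add_dbl[OF that, of "t - t'" t'] sigma_nonzero[of t' r] by (simp add: field_simps)
  then have eq: "(\<Sum>r\<in>dbl. dsigma D t r * inverse (dsigma D t' r)) = (\<Sum>r\<in>dbl. dsigma D (t - t') r)"
    by (rule sum.cong[OF refl])
  show ?thesis
    unfolding eq using sigma_sum_zero[of "t - t'"] assms dbl_diff by auto
qed

lemma norm2_nonzero: "norm2 D \<noteq> 0"
  by (simp add: norm2_def)

lemma norm2_inverse: "inverse (norm2 D) = complex_of_real (sqrt (real (card (dbl :: 'g set))))"
  by (simp add: norm2_def field_simps)

lemma eps_norm2_sq:
  "(deps D * norm2 D) * (deps D * norm2 D) * of_nat (card (dbl :: 'g set)) = 1"
proof -
  have "deps D * deps D = 1"
    using eps_pm by auto
  moreover have "norm2 D * norm2 D * of_nat (card (dbl :: 'g set)) = 1"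
  proof -
    have "norm2 D * norm2 D = complex_of_real (1 / real (card (dbl :: 'g set)))"
      unfolding norm2_def by (simp flip: of_real_mult)
    then show ?thesis
      by (simp add: field_simps)
  qed
  ultimately show ?thesis
    by (simp add: algebra_simps)
qed

subsection \<open>Inverses of associators\<close>

text \<open>In degree 1 the intermediate summands a + b and b + c are determined by the factors, so
  labels on the two sides correspond one to one. The entries \<omega>(a, b, c) are signs, hence
  their own inverses.\<close>

lemma is_inverse_associator_Cob:
  assumes fin: "finite (dom U)" "finite (dom V)" "finite (dom W)"
    and U: "\<And>i A. U i = Some A \<Longrightarrow> grade A = One" and V: "\<And>i A. V i = Some A \<Longrightarrow> grade A = One"
    and W: "\<And>i A. W i = Some A \<Longrightarrow> grade A = One"
  shows "is_inverse (associator D U V W) (assoc_inv D U V W)"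
proof -
  have gC: "grade A = One \<Longrightarrow> \<exists>a. A = Cob a" for A :: "'g simple"
    by (cases A) auto
  have L: "\<exists>i j k a b c. v = Tens (Tens i j (Cob (a + b))) k (Cob (a + b + c)) \<and>
      U i = Some (Cob a) \<and> V j = Some (Cob b) \<and> W k = Some (Cob c)"
    if "v \<in> dom (tensor D (tensor D U V) W)" for v
    using that by (fastforce simp: tensor_Some_iff dest: gC[OF U] gC[OF V] gC[OF W])
  have R: "\<exists>i j k a b c. v = Tens i (Tens j k (Cob (b + c))) (Cob (a + b + c)) \<and>
      U i = Some (Cob a) \<and> V j = Some (Cob b) \<and> W k = Some (Cob c)"
    if "v \<in> dom (tensor D U (tensor D V W))" for v
    using that by (fastforce simp: tensor_Some_iff add.assoc dest: gC[OF U] gC[OF V] gC[OF W])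
  let ?l = "\<lambda>i j k a b c. Tens (Tens i j (Cob (a + b))) k (Cob (a + b + c))"
  let ?r = "\<lambda>i j k a b c. Tens i (Tens j k (Cob (b + c))) (Cob (a + b + c))"
  have fl: "finite (dom (tensor D (tensor D U V) W))" and fr: "finite (dom (tensor D U (tensor D V W)))"
    using fin by simp_all
  have A: "mat (associator D U V W) (?r i j k a b c) (?l i j k a b c) = domega D a b c"
    and A': "mat (assoc_inv D U V W) (?l i j k a b c) (?r i j k a b c) = domega D a b c"
    if "U i = Some (Cob a)" "V j = Some (Cob b)" "W k = Some (Cob c)" for i j k a b c
    using that by (simp_all add: mat_associator mat_assoc_inv tensor_Some_iff add.assoc)
  have A0: "w = ?r i j k a b c"
    if nz: "mat (associator D U V W) w (?l i j k a b c) \<noteq> 0"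
      and c: "U i = Some (Cob a)" "V j = Some (Cob b)" "W k = Some (Cob c)" for w i j k a b c
  proof -
    obtain r where w: "w = Tens i (Tens j k r) (Cob (a + b + c))"
      by (rule mat_associator_nonzero[OF nz]) auto
    have "w \<in> dom (tensor D U (tensor D V W))"
      using chom_nonzero(3)[OF associator_chom nz] .
    then show ?thesis
      using c unfolding w by (auto dest!: R)
  qed
  have A0': "v = ?l i j k a b c"
    if nz: "mat (assoc_inv D U V W) v (?r i j k a b c) \<noteq> 0"
      and c: "U i = Some (Cob a)" "V j = Some (Cob b)" "W k = Some (Cob c)" for v i j k a b c
  proof -
    obtain t where v: "v = Tens (Tens i j t) k (Cob (a + b + c))"
      by (rule mat_assoc_inv_nonzero[OF nz]) auto
    have "v \<in> dom (tensor D (tensor D U V) W)"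
      using chom_nonzero(3)[OF assoc_inv_chom nz] .
    then show ?thesis
      using c unfolding v by (auto dest!: L)
  qed
  have "assoc_inv D U V W \<bullet> associator D U V W = idm (tensor D (tensor D U V) W)"
  proof (rule arrow_eqI[OF compm_chom[OF associator_chom assoc_inv_chom] idm_chom])
    fix w v
    assume dv: "v \<in> dom (tensor D (tensor D U V) W)"
    then obtain i j k a b c where v: "v = ?l i j k a b c"
      and c: "U i = Some (Cob a)" "V j = Some (Cob b)" "W k = Some (Cob c)"
      using L by blast
    have "mat (assoc_inv D U V W \<bullet> associator D U V W) w v =
        mat (assoc_inv D U V W) w (?r i j k a b c) * domega D a b c"
      unfolding v A[OF c, symmetric] using A0[OF _ c]
      by (intro mat_compm_single[OF associator_chom fr]) (metis mult_zero_right)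
    also have "\<dots> = mat (idm (tensor D (tensor D U V) W)) w v"
      using A0'[OF _ c, of w] A'[OF c] om_sq[of a b c] dv unfolding v by (auto simp: mat_idm)
    finally show "mat (assoc_inv D U V W \<bullet> associator D U V W) w v =
      mat (idm (tensor D (tensor D U V) W)) w v" .
  qed
  moreover have "associator D U V W \<bullet> assoc_inv D U V W = idm (tensor D U (tensor D V W))"
  proof (rule arrow_eqI[OF compm_chom[OF assoc_inv_chom associator_chom] idm_chom])
    fix w v
    assume dv: "v \<in> dom (tensor D U (tensor D V W))"
    then obtain i j k a b c where v: "v = ?r i j k a b c"
      and c: "U i = Some (Cob a)" "V j = Some (Cob b)" "W k = Some (Cob c)"
      using R by blast
    have "mat (associator D U V W \<bullet> assoc_inv D U V W) w v =
        mat (associator D U V W) w (?l i j k a b c) * domega D a b c"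
      unfolding v A'[OF c, symmetric] using A0'[OF _ c]
      by (intro mat_compm_single[OF assoc_inv_chom fl]) (metis mult_zero_right)
    also have "\<dots> = mat (idm (tensor D U (tensor D V W))) w v"
      using A0[OF _ c, of w] A[OF c] om_sq[of a b c] dv unfolding v by (auto simp: mat_idm)
    finally show "mat (associator D U V W \<bullet> assoc_inv D U V W) w v =
      mat (idm (tensor D U (tensor D V W))) w v" .
  qed
  ultimately show ?thesis
    by (simp add: is_inverse_def chom_src[OF associator_chom] chom_tgt[OF associator_chom] assoc_inv_chom)
qed

text \<open>The assumptions let both intermediate summands run through 2\<Gamma>, and t + y = y for
  t in 2\<Gamma> makes every resulting summand X^y. So one square matrix over 2\<Gamma> has to be
  inverted, and orthogonality does it.\<close>

lemma is_inverse_associator_Xob: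
  assumes yx: "ddelta D + y + x = dbl" and xy: "ddelta D + x + y = dbl" and y: "y \<in> cosets2"
  defines "U \<equiv> [Atom 0 \<mapsto> Xob y]" and "V \<equiv> [Atom 0 \<mapsto> Xob x]"
  shows "is_inverse (associator D U V U) (assoc_inv D U V U)"
proof -
  let ?l = "\<lambda>t. Tens (Tens (Atom 0) (Atom 0) (Cob t)) (Atom 0) (Xob y)"
  let ?r = "\<lambda>t. Tens (Atom 0) (Tens (Atom 0) (Atom 0) (Cob t)) (Xob y)"
  have U: "U i = Some A \<longleftrightarrow> i = Atom 0 \<and> A = Xob y" and V: "V i = Some A \<longleftrightarrow> i = Atom 0 \<and> A = Xob x" for i A
    by (auto simp: U_def V_def)
  have UV: "tensor D U V p = Some A \<longleftrightarrow> (\<exists>t\<in>dbl. p = Tens (Atom 0) (Atom 0) (Cob t) \<and> A = Cob t)"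
    and VU: "tensor D V U p = Some A \<longleftrightarrow> (\<exists>t\<in>dbl. p = Tens (Atom 0) (Atom 0) (Cob t) \<and> A = Cob t)" for p A
    by (auto simp: tensor_Some_iff U V yx xy)
  have L: "tensor D (tensor D U V) U v = Some s \<longleftrightarrow> (\<exists>t\<in>dbl. v = ?l t) \<and> s = Xob y" for v s
    unfolding tensor_Some_iff[of D "tensor D U V"] UV U by (auto simp: dbl_plus_coset[OF _ y])
  have R: "tensor D U (tensor D V U) v = Some s \<longleftrightarrow> (\<exists>t\<in>dbl. v = ?r t) \<and> s = Xob y" for v s
    unfolding tensor_Some_iff[of D _ "tensor D V U"] VU U by (auto simp: dbl_plus_coset[OF _ y])
  have fl: "finite (dom (tensor D (tensor D U V) U))" and fr: "finite (dom (tensor D U (tensor D V U)))"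
    by (simp_all add: U_def V_def)
  have A: "mat (associator D U V U) (?r r) (?l t) = deps D * norm2 D * inverse (dsigma D t r)"
    and A': "mat (assoc_inv D U V U) (?l t) (?r r) = deps D * norm2 D * dsigma D t r"
    if "r \<in> dbl" "t \<in> dbl" for r t
    using that L R by (auto simp: mat_associator mat_assoc_inv U_def V_def)
  have A0: "w \<in> ?r ` dbl" if "mat (associator D U V U) w v \<noteq> 0" for w v
    using chom_nonzero(3)[OF associator_chom that] R by auto
  have A0': "w \<in> ?l ` dbl" if "mat (assoc_inv D U V U) w v \<noteq> 0" for w v
    using chom_nonzero(3)[OF assoc_inv_chom that] L by auto
  have "assoc_inv D U V U \<bullet> associator D U V U = idm (tensor D (tensor D U V) U)"
  proof (rule arrow_eqI[OF compm_chom[OF associator_chom assoc_inv_chom] idm_chom])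
    fix w v
    assume dv: "v \<in> dom (tensor D (tensor D U V) U)"
      and wv: "tensor D (tensor D U V) U w = tensor D (tensor D U V) U v"
    obtain s where "tensor D (tensor D U V) U v = Some s" "tensor D (tensor D U V) U w = Some s"
      using dv wv by auto
    then obtain t t' where t: "t \<in> dbl" "v = ?l t" "t' \<in> dbl" "w = ?l t'"
      unfolding L by blast
    have "mat (assoc_inv D U V U \<bullet> associator D U V U) w v =
        (\<Sum>r\<in>dbl. mat (assoc_inv D U V U) w (?r r) * mat (associator D U V U) (?r r) v)"
      by (rule mat_compm_reindex[OF associator_chom fr]) (auto simp: inj_on_def dest: A0)
    also have "\<dots> = (deps D * norm2 D) * (deps D * norm2 D) *
        (\<Sum>r\<in>dbl. dsigma D t' r * inverse (dsigma D t r))"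
      using t by (simp add: A A' sum_distrib_left algebra_simps)
    also have "\<dots> = mat (idm (tensor D (tensor D U V) U)) w v"
      using t eps_norm2_sq dv by (simp add: sigma_orthogonal mat_idm)
    finally show "mat (assoc_inv D U V U \<bullet> associator D U V U) w v =
      mat (idm (tensor D (tensor D U V) U)) w v" .
  qed
  moreover have "associator D U V U \<bullet> assoc_inv D U V U = idm (tensor D U (tensor D V U))"
  proof (rule arrow_eqI[OF compm_chom[OF assoc_inv_chom associator_chom] idm_chom])
    fix w v
    assume dv: "v \<in> dom (tensor D U (tensor D V U))"
      and wv: "tensor D U (tensor D V U) w = tensor D U (tensor D V U) v"
    obtain s where "tensor D U (tensor D V U) v = Some s" "tensor D U (tensor D V U) w = Some s"
      using dv wv by auto
    then obtain r r' where r: "r \<in> dbl" "v = ?r r" "r' \<in> dbl" "w = ?r r'"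
      unfolding R by blast
    have "mat (associator D U V U \<bullet> assoc_inv D U V U) w v =
        (\<Sum>t\<in>dbl. mat (associator D U V U) w (?l t) * mat (assoc_inv D U V U) (?l t) v)"
      by (rule mat_compm_reindex[OF assoc_inv_chom fl]) (auto simp: inj_on_def dest: A0')
    \<comment> \<open>Here the summation runs over the first argument of \<sigma>; its symmetry
      brings the sum into the form required by orthogonality.\<close>
    also have "\<dots> = (deps D * norm2 D) * (deps D * norm2 D) *
        (\<Sum>t\<in>dbl. dsigma D r t * inverse (dsigma D r' t))"
      using r by (simp add: A A' sum_distrib_left algebra_simps sigma_sym[of _ r] sigma_sym[of _ r'])
    also have "\<dots> = mat (idm (tensor D U (tensor D V U))) w v"
      using r eps_norm2_sq dv by (auto simp: sigma_orthogonal mat_idm)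
    finally show "mat (associator D U V U \<bullet> assoc_inv D U V U) w v =
      mat (idm (tensor D U (tensor D V U))) w v" .
  qed
  ultimately show ?thesis
    by (simp add: is_inverse_def chom_src[OF associator_chom] chom_tgt[OF associator_chom] assoc_inv_chom)
qed

subsection \<open>The trace of the identity\<close>

text \<open>Expanding \<sigma>(a, -a + a) = 1 shows that \<omega>(a, -a, a) is inverse to the
  right-hand side, and a sign is its own inverse.\<close>

lemma om_inv: "domega D a (- a) a = dsigma D a (- a) * dsigma D a a"
proof -
  have "1 = domega D a (- a) a * (dsigma D a (- a) * dsigma D a a)"
    using sigma_add[of a "- a" a] by (simp add: mult.assoc)
  then have "domega D a (- a) a = (domega D a (- a) a * domega D a (- a) a) * (dsigma D a (- a) * dsigma D a a)"
    by (metis mult.assoc mult.right_neutral)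
  then show ?thesis
    by (simp add: om_sq)
qed

lemma trace_Cob:
  assumes X: "is_eobj X" and gr: "\<And>i A. und X i = Some A \<Longrightarrow> grade A = One"
    and dual: "is_dual D X Y e k"
  shows "mat (e \<bullet> ebraid D X Y \<bullet> tensorm D (etwist D X) (idm (und Y)) \<bullet> k) (Atom 0) (Atom 0)
    = of_nat (card (dom (und X)))"
proof -
  note Y = is_dualD(1)[OF X dual] and ec = is_dualD(2)[OF X dual] and kc = is_dualD(3)[OF X dual]
  note fX = is_eobj_finite[OF X] and fY = is_eobj_finite[OF Y]
  let ?\<theta> = "\<lambda>i. twist_coeff D (the (und X i))"
  let ?E = "\<lambda>j i. mat e (Atom 0) (Tens j i (Cob 0))"
  let ?K = "\<lambda>i j. mat k (Tens i j (Cob 0)) (Atom 0)"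
  have b: "ebraid D X Y = tensorm D (eqv_at Y One) (idm (und X)) \<bullet> cbraid D One (und X) (und Y)"
    by (rule ebraid_homogeneous[OF X Y]) (rule gr)
  have "etwist D X = eqv_at X One \<bullet> ctwist D One (und X)"
    by (rule etwist_homogeneous[OF X]) (rule gr)
  then have t: "etwist D X = ctwist D One (und X)"
    using compm_idm_left[OF ctwist_chom[of D One "und X"]] fX by simp
  have td: "mat (etwist D X) i' i = (if i' = i \<and> i \<in> dom (und X) then ?\<theta> i else 0)" for i' i
    by (auto simp: t ctwist_def mat_arr)
  have "mat (e \<bullet> ebraid D X Y \<bullet> tensorm D (etwist D X) (idm (und Y)) \<bullet> k) (Atom 0) (Atom 0) =
    (\<Sum>j'\<in>dom (und Y). \<Sum>i\<in>dom (und X). ?E j' i * (\<Sum>j\<in>dom (und Y). mat (eqv_at Y One) j' j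
      * (braid_coeff D (the (und X i)) (the (und Y j)) (Cob 0) * (?\<theta> i * ?K i j))))"
    unfolding b
  proof (rule trace_entry[OF fX fY _ ec kc _ td eqv_at_chom[OF Y]])
    show "etwist D X \<in> chom (und X) (und X)"
      by (rule etwist_chom[OF X]) (rule gr)
  qed (rule gr)
  also have "\<dots> = (\<Sum>j\<in>dom (und Y). \<Sum>i\<in>dom (und X).
      ?E j i * (braid_coeff D (the (und X i)) (the (und Y j)) (Cob 0) * (?\<theta> i * ?K i j)))"
    by (simp add: sum_idm[OF fY])
  also have "\<dots> = (\<Sum>i\<in>dom (und X). \<Sum>j\<in>dom (und Y).
      ?E j i * (braid_coeff D (the (und X i)) (the (und Y j)) (Cob 0) * (?\<theta> i * ?K i j)))"
    by (rule sum.swap)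
  also have "\<dots> = (\<Sum>i\<in>dom (und X). 1)"
  proof (rule sum.cong[OF refl])
    fix i
    assume "i \<in> dom (und X)"
    then obtain A where A: "und X i = Some A"
      by auto
    then obtain a where a: "und X i = Some (Cob a)"
      using gr[OF A] by (cases A) auto
    \<comment> \<open>The two coefficients need to agree only where \<open>k\<close> has a nonzero
      entry, and there the partner of \<complex>_a is \<complex>_(-a).\<close>
    have eq: "?E j i * (braid_coeff D (the (und X i)) (the (und Y j)) (Cob 0) * (?\<theta> i * ?K i j)) =
        ?E j i * assoc_coeff D (Cob a) (the (und Y j)) (Cob a) (Cob 0) (Cob 0) (Cob a) * ?K i j" for j
    proof (cases "?K i j = 0")
      case False
      then have "tensor D (und X) (und Y) (Tens i j (Cob 0)) = Some (Cob 0)"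
        by (auto elim: coev_support[OF kc])
      then obtain B where "und Y j = Some B" "Cob 0 \<in> fus D (Cob a) B"
        using a by (auto simp: tensor_Some_iff)
      then have "und Y j = Some (Cob (- a))"
        by (cases B) (auto simp: eq_neg_iff_add_eq_0 add.commute)
      then show ?thesis
        by (simp add: a om_inv)
    qed simp
    show "(\<Sum>j\<in>dom (und Y). ?E j i * (braid_coeff D (the (und X i)) (the (und Y j)) (Cob 0)
        * (?\<theta> i * ?K i j))) = 1"
      unfolding eq by (rule is_dualD(5)[OF X dual a])
  qed
  finally show ?thesis
    by simp
qed

lemma trace_Xob:
  assumes x: "x \<in> cosets2" and s: "s \<in> {1, -1}" and dual: "is_dual D (Sobj (Xob x) s) Y e k"
  defines "X \<equiv> Sobj (Xob x) s"
  shows "mat (e \<bullet> ebraid D X Y \<bullet> tensorm D (etwist D X) (idm (und Y)) \<bullet> k) (Atom 0) (Atom 0)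
    = dalpha D * dbeta D * deps D * complex_of_real (sqrt (real (card (dbl :: 'g set))))"
    (is "?tr = _")
proof -
  have X: "is_eobj X"
    unfolding X_def using x s by (intro is_eobj_Sobj) auto
  have uX: "und X = [Atom 0 \<mapsto> Xob x]"
    by (simp add: X_def)
  have gr: "und X i = Some A \<Longrightarrow> grade A = Gen" for i A
    by (auto simp: uX split: if_splits)
  note dual' = dual[folded X_def]
  note Y = is_dualD(1)[OF X dual'] and ec = is_dualD(2)[OF X dual'] and kc = is_dualD(3)[OF X dual']
  note fX = is_eobj_finite[OF X] and fY = is_eobj_finite[OF Y]
  let ?\<theta> = "\<lambda>i. s * dbeta D"
  let ?E = "\<lambda>j. mat e (Atom 0) (Tens j (Atom 0) (Cob 0))"
  let ?K = "\<lambda>j. mat k (Tens (Atom 0) j (Cob 0)) (Atom 0)"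
  have eX: "mat (eqv X) w v = (if w = Atom 0 \<and> v = Atom 0 then s else 0)" for w v
    unfolding X_def by (rule mat_eqv_Sobj) simp
  have KY: "\<exists>y. und Y j = Some (Xob y)"
    if v: "tensor D (und X) (und Y) (Tens (Atom 0) j (Cob 0)) = Some (Cob 0)" for j
  proof -
    obtain B where "und Y j = Some B" "Cob 0 \<in> fus D (Xob x) B"
      using v by (auto simp: tensor_Some_iff uX)
    then show ?thesis
      by (cases B) auto
  qed
  have K0: "?K j = 0 \<or> (\<exists>y. und Y j = Some (Xob y))" for j
    using KY[of j] by (auto elim: coev_support[OF kc])
  have b: "ebraid D X Y = tensorm D (eqv_at Y Gen) (idm (und X)) \<bullet> cbraid D Gen (und X) (und Y)"
    by (rule ebraid_homogeneous[OF X Y]) (rule gr)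
  have t: "etwist D X = eqv_at X Gen \<bullet> ctwist D Gen (und X)"
    by (rule etwist_homogeneous[OF X]) (rule gr)
  have ct: "mat (ctwist D Gen (und X)) (Atom 0) i = (if i = Atom 0 then dbeta D else 0)" for i
    by (auto simp: ctwist_def mat_arr uX act_def)
  have td: "mat (etwist D X) i' i = (if i' = i \<and> i \<in> dom (und X) then ?\<theta> i else 0)" for i' i
    by (auto simp: t mat_compm chom_tgt[OF ctwist_chom] uX eX ct[unfolded uX])
  have "?tr =
    (\<Sum>j'\<in>dom (und Y). \<Sum>i\<in>dom (und X). mat e (Atom 0) (Tens j' i (Cob 0)) *
      (\<Sum>j\<in>dom (und Y). mat (eqv_at Y Gen) j' j
      * (braid_coeff D (the (und X i)) (the (und Y j)) (Cob 0)
        * (?\<theta> i * mat k (Tens i j (Cob 0)) (Atom 0)))))"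
    unfolding b
  proof (rule trace_entry[OF fX fY _ ec kc _ td eqv_at_chom[OF Y]])
    show "etwist D X \<in> chom (und X) (und X)"
      by (rule etwist_chom[OF X]) (rule gr)
  qed (rule gr)
  also have "\<dots> = (\<Sum>j'\<in>dom (und Y). dalpha D * dbeta D * (?E j' * ?K j'))"
  proof (rule sum.cong[OF refl])
    fix j'
    show "(\<Sum>i\<in>dom (und X). mat e (Atom 0) (Tens j' i (Cob 0)) *
      (\<Sum>j\<in>dom (und Y). mat (eqv_at Y Gen) j' j
      * (braid_coeff D (the (und X i)) (the (und Y j)) (Cob 0)
        * (?\<theta> i * mat k (Tens i j (Cob 0)) (Atom 0))))) = dalpha D * dbeta D * (?E j' * ?K j')"
    \<comment> \<open>Equivariance of \<open>k\<close> can be used only at labels present in the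
      product. A nonzero entry of \<open>e\<close> guarantees the presence; otherwise both sides
      vanish.\<close>
    proof (cases "?E j' = 0")
      case False
      then have "tensor D (und Y) (und X) (Tens j' (Atom 0) (Cob 0)) = Some (Cob 0)"
        by (auto elim: ev_support[OF ec])
      then have v: "tensor D (und X) (und Y) (Tens (Atom 0) j' (Cob 0)) = Some (Cob 0)"
        using tensor_unit_comm by blast
      have tau: "s * mat (eqv Y) j' j * tau_coeff D (Xob x) (the (und Y j)) (Cob 0) * ?K j =
          s * mat (eqv Y) j' j * ?K j" for j
        using K0[of j] by (auto simp: omc_0)
      have br: "mat (eqv Y) j' j * (braid_coeff D (Xob x) (the (und Y j)) (Cob 0) * (s * dbeta D * ?K j)) =
          dalpha D * dbeta D * (s * mat (eqv Y) j' j * ?K j)" for j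
        using K0[of j] by (auto simp: q_0)
      \<comment> \<open>This is equivariance of \<open>k\<close> at j'. The factor s from the twist
        and the structure of \<open>Y\<close> from the braiding together form precisely this action,
        which fixes \<open>k\<close>.\<close>
      have "(\<Sum>j\<in>dom (und Y). s * mat (eqv Y) j' j * tau_coeff D (Xob x) (the (und Y j)) (Cob 0) * ?K j)
          = ?K j'"
        using is_dualD(4)[OF X dual', unfolded coev_ehom_iff[OF X Y kc], rule_format, OF v]
        by (simp add: uX eX)
      then have "(\<Sum>j\<in>dom (und Y). s * mat (eqv Y) j' j * ?K j) = ?K j'"
        unfolding tau .
      then show ?thesis
        by (simp add: uX br sum_distrib_left[symmetric])
    qed (simp add: uX)
  qed
  also have "\<dots> = dalpha D * dbeta D * (\<Sum>j\<in>dom (und Y). ?E j * ?K j)"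
    by (simp add: sum_distrib_left)
  finally have tr: "?tr = dalpha D * dbeta D * (\<Sum>j\<in>dom (und Y). ?E j * ?K j)" .
  have eq: "?E j * assoc_coeff D (Xob x) (the (und Y j)) (Xob x) (Cob 0) (Cob 0) (Xob x) * ?K j =
      deps D * norm2 D * (?E j * ?K j)" for j
    using K0[of j] by auto
  have "und X (Atom 0) = Some (Xob x)"
    by (simp add: uX)
  \<comment> \<open>The associator entry at t = r = 0 does not depend on \<open>j\<close>, so the
    snake identity determines the whole sum of products of entries of \<open>e\<close> and
    \<open>k\<close>.\<close>
  from is_dualD(5)[OF X dual' this]
  have "deps D * norm2 D * (\<Sum>j\<in>dom (und Y). ?E j * ?K j) = 1"
    unfolding eq sum_distrib_left .
  then have "inverse (deps D * norm2 D) = (\<Sum>j\<in>dom (und Y). ?E j * ?K j)"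
    by (rule inverse_unique)
  moreover have "inverse (deps D * norm2 D) = deps D * complex_of_real (sqrt (real (card (dbl :: 'g set))))"
    using eps_pm by (auto simp: norm2_inverse)
  ultimately have "(\<Sum>j\<in>dom (und Y). ?E j * ?K j) = deps D * complex_of_real (sqrt (real (card (dbl :: 'g set))))"
    by simp
  then show ?thesis
    by (simp add: tr)
qed

subsection \<open>Existence of duals\<close>

text \<open>Between one-summand objects \<open>e\<close> and \<open>k\<close> are scalars. With
  \<open>e\<close> normalised to 1, both snake identities prescribe the value c of \<open>k\<close>,
  and \<tau> ties the two signs together.\<close>

lemma is_dual_Sobj:
  assumes A: "sact Gen A = A" "csimple A" "s \<in> {1, -1}"
    and B: "sact Gen B = B" "csimple B" "t \<in> {1, -1}"
    and AB: "Cob 0 \<in> fus D A B"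
    and inv: "is_inverse (associator D [Atom 0 \<mapsto> B] [Atom 0 \<mapsto> A] [Atom 0 \<mapsto> B])
      (assoc_inv D [Atom 0 \<mapsto> B] [Atom 0 \<mapsto> A] [Atom 0 \<mapsto> B])"
    and tau1: "s * t * tau_coeff D A B (Cob 0) = 1" and tau2: "t * s * tau_coeff D B A (Cob 0) = 1"
    and c1: "assoc_coeff D A B A (Cob 0) (Cob 0) A * c = 1"
    and c2: "assoc_inv_coeff D B A B (Cob 0) (Cob 0) * c = 1"
  shows "\<exists>e k. is_dual D (Sobj A s) (Sobj B t) e k"
proof -
  let ?X = "Sobj A s" and ?Y = "Sobj B t"
  have BA: "Cob 0 \<in> fus D B A"
    using AB fus_unit_comm by blast
  define e where "e = arr (tensor D (und ?Y) (und ?X)) cunit (\<lambda>_ _. 1)"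
  define k where "k = arr cunit (tensor D (und ?X) (und ?Y)) (\<lambda>_ _. c)"
  have ec: "e \<in> chom (tensor D (und ?Y) (und ?X)) cunit" and kc: "k \<in> chom cunit (tensor D (und ?X) (und ?Y))"
    by (simp_all add: e_def k_def)
  have X: "is_eobj ?X" and Y: "is_eobj ?Y"
    using A B by (auto intro: is_eobj_Sobj)
  have me: "mat e (Atom 0) (Tens (Atom 0) (Atom 0) (Cob 0)) = 1"
    using BA by (simp add: e_def mat_arr tensor_Some_iff domIff) (simp add: tensor_def cunit_def)
  have mk: "mat k (Tens (Atom 0) (Atom 0) (Cob 0)) (Atom 0) = c"
    using AB by (simp add: k_def mat_arr tensor_Some_iff domIff) (simp add: tensor_def cunit_def)
  have v: "tensor D (und (Sobj P p)) (und (Sobj Q q)) (Tens i j (Cob 0)) = Some (Cob 0) \<Longrightarrow> i = Atom 0 \<and> j = Atom 0"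
    for P p Q q i j
    by (auto simp: tensor_Some_iff split: if_splits)
  have "e \<in> ehom (etensor D ?Y ?X) eunit"
    unfolding ev_ehom_iff[OF X Y ec]
  proof (intro allI impI)
    fix i j
    assume "tensor D (und ?Y) (und ?X) (Tens j i (Cob 0)) = Some (Cob 0)"
    then have "i = Atom 0" "j = Atom 0"
      using v by blast+
    then show "mat e (Atom 0) (Tens j i (Cob 0)) =
      (\<Sum>j'\<in>dom (und ?Y). \<Sum>i'\<in>dom (und ?X). mat e (Atom 0) (Tens j' i' (Cob 0))
        * (mat (eqv ?Y) j' j * mat (eqv ?X) i' i
        * tau_coeff D (the (und ?Y j)) (the (und ?X i)) (Cob 0)))"
      using tau2 by (simp add: me mat_eqv_Sobj A B)
  qed
  moreover have "k \<in> ehom eunit (etensor D ?X ?Y)"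
    unfolding coev_ehom_iff[OF X Y kc]
  proof (intro allI impI)
    fix i j
    assume "tensor D (und ?X) (und ?Y) (Tens i j (Cob 0)) = Some (Cob 0)"
    then have "i = Atom 0" "j = Atom 0"
      using v by blast+
    then show "(\<Sum>i'\<in>dom (und ?X). \<Sum>j'\<in>dom (und ?Y). mat (eqv ?X) i i' * mat (eqv ?Y) j j'
        * tau_coeff D (the (und ?X i')) (the (und ?Y j')) (Cob 0) * mat k (Tens i' j' (Cob 0)) (Atom 0))
      = mat k (Tens i j (Cob 0)) (Atom 0)"
      using tau1 by (simp add: mk mat_eqv_Sobj A B)
  qed
  ultimately have "is_dual D ?X ?Y e k"
  proof (rule is_dualI[OF X Y])
    show "is_inverse (associator D (und ?Y) (und ?X) (und ?Y)) (assoc_inv D (und ?Y) (und ?X) (und ?Y))"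
      using inv by simp
    show "(\<Sum>j\<in>dom (und ?Y). mat e (Atom 0) (Tens j i (Cob 0))
      * assoc_coeff D P (the (und ?Y j)) P (Cob 0) (Cob 0) P * mat k (Tens i' j (Cob 0)) (Atom 0))
      = (if i' = i then 1 else 0)" if "und ?X i = Some P" "und ?X i' = Some P" for i i' P
      using that c1 by (auto simp: me mk split: if_splits)
    show "(\<Sum>i\<in>dom (und ?X). mat e (Atom 0) (Tens j i (Cob 0))
      * assoc_inv_coeff D P (the (und ?X i)) P (Cob 0) (Cob 0) * mat k (Tens i j' (Cob 0)) (Atom 0))
      = (if j' = j then 1 else 0)" if "und ?Y j = Some P" "und ?Y j' = Some P" for j j' P
      using that c2 by (auto simp: me mk split: if_splits)
  qed
  then show ?thesis
    by blast
qed

lemma tors2_neg: "a \<in> tors2 \<Longrightarrow> - a = a"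
  using not_tors2_iff by blast

lemma sign_cases:
  assumes "s \<in> {1, - 1 :: complex}"
  shows "s * s = 1" "s * domega D a b c \<in> {1, -1}"
  using assms om_pm[of a b c] by auto

lemma exists_dual_X:
  assumes a: "a \<in> tors2" and s: "s \<in> {1, -1}"
  shows "\<exists>Y e k. is_dual D (Sobj (Cob a) s) Y e k"
proof -
  let ?w = "domega D a a a"
  have na: "- a = a"
    using a by (rule tors2_neg)
  have aa: "a + a = 0"
    using a by (simp add: tors2_def)
  have w: "s * (s * ?w) * ?w = 1"
    using sign_cases(1)[OF s] om_sq[of a a a] by (metis mult.assoc mult.right_neutral)
  \<comment> \<open>As -a = a, \<tau> on the product is \<omega>(a, a, a), and the sign of the dual
    has to cancel it. The same number is the associator entry, which c compensates.\<close>
  have "\<exists>e k. is_dual D (Sobj (Cob a) s) (Sobj (Cob a) (s * ?w)) e k"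
  proof (rule is_dual_Sobj[where c = ?w])
    show "is_inverse (associator D [Atom 0 \<mapsto> Cob a] [Atom 0 \<mapsto> Cob a] [Atom 0 \<mapsto> Cob a])
        (assoc_inv D [Atom 0 \<mapsto> Cob a] [Atom 0 \<mapsto> Cob a] [Atom 0 \<mapsto> Cob a])"
      by (rule is_inverse_associator_Cob) (auto split: if_splits)
    show "s * (s * ?w) * tau_coeff D (Cob a) (Cob a) (Cob 0) = 1"
      using w na by simp
    show "s * ?w * s * tau_coeff D (Cob a) (Cob a) (Cob 0) = 1"
      using w na by (simp add: mult.commute mult.left_commute)
    show "s * ?w \<in> {1, -1}"
      by (rule sign_cases(2)[OF s])
  qed (use s na aa om_sq in simp_all)
  then show ?thesis
    by blast
qed

lemma exists_dual_Z:
  assumes x: "x \<in> cosets2" and s: "s \<in> {1, -1}"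
  shows "\<exists>Y e k. is_dual D (Sobj (Xob x) s) Y e k"
proof -
  let ?y = "ddelta D + x"
  have y: "?y \<in> cosets2"
    by (rule cosets2_plus[OF delta_coset x])
  have xy: "ddelta D + x + ?y = dbl"
    by (rule cosets2_double[OF y])
  then have yx: "ddelta D + ?y + x = dbl"
    by (simp add: add.commute add.left_commute)
  have n: "deps D * norm2 D * inverse (deps D * norm2 D) = 1"
    using norm2_nonzero eps_pm by auto
  have "\<exists>e k. is_dual D (Sobj (Xob x) s) (Sobj (Xob ?y) s) e k"
  \<comment> \<open>At t = r = 0 both the associator and its inverse have the entry \<epsilon>
    |2\<Gamma>|^(-1/2), so one constant serves both snake identities.\<close>
  proof (rule is_dual_Sobj[where c = "inverse (deps D * norm2 D)"])
    show "is_inverse (associator D [Atom 0 \<mapsto> Xob ?y] [Atom 0 \<mapsto> Xob x] [Atom 0 \<mapsto> Xob ?y])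
        (assoc_inv D [Atom 0 \<mapsto> Xob ?y] [Atom 0 \<mapsto> Xob x] [Atom 0 \<mapsto> Xob ?y])"
      by (rule is_inverse_associator_Xob[OF yx xy y])
    show "Cob 0 \<in> fus D (Xob x) (Xob ?y)"
      by (simp add: xy)
  qed (use x y s n sign_cases(1)[OF s] in \<open>simp_all add: omc_0\<close>)
  then show ?thesis
    by blast
qed

lemma exists_dual_Y:
  assumes a: "a \<notin> tors2"
  shows "\<exists>Y e k. is_dual D (Yobj a) Y e k"
proof -
  let ?X = "Yobj a" and ?Y = "Yobj (- a)" and ?w = "domega D a (- a) a"
  let ?L0 = "Tens (Atom 0) (Atom 0) (Cob 0)"
  have na: "- a \<noteq> a" "a \<noteq> - a"
    using a by (auto simp: not_tors2_iff)
  then have aa: "a + a \<noteq> 0" "- a + - a \<noteq> 0" "- a - a \<noteq> 0"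
    by (simp_all add: add_eq_0_iff)
  \<comment> \<open>Interchanging the summands costs the sign \<open>?w\<close> from \<tau>, so the
    two entries of \<open>e\<close>, and those of \<open>k\<close>, differ by this factor. At each
    pair the entries of \<open>e\<close> and \<open>k\<close> multiply to \<open>?w\<close>, which
    the associator cancels.\<close>
  define e where "e = arr (tensor D (und ?Y) (und ?X)) cunit (\<lambda>_ v. if v = ?L0 then 1 else ?w)"
  define k where "k = arr cunit (tensor D (und ?X) (und ?Y)) (\<lambda>v _. if v = ?L0 then ?w else 1)"
  have ec: "e \<in> chom (tensor D (und ?Y) (und ?X)) cunit" and kc: "k \<in> chom cunit (tensor D (und ?X) (und ?Y))"
    by (simp_all add: e_def k_def)
  have X: "is_eobj ?X" and Y: "is_eobj ?Y"
    by (rule is_eobj_Yobj)+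
  have tYX: "tensor D (und ?Y) (und ?X) (Tens j i (Cob 0)) = Some (Cob 0) \<longleftrightarrow>
      i = Atom 0 \<and> j = Atom 0 \<or> i = Atom 1 \<and> j = Atom 1" for i j
    using aa by (auto simp: tensor_Some_iff und_Yobj_Some_iff)
  have tXY: "tensor D (und ?X) (und ?Y) (Tens i j (Cob 0)) = Some (Cob 0) \<longleftrightarrow>
      i = Atom 0 \<and> j = Atom 0 \<or> i = Atom 1 \<and> j = Atom 1" for i j
    by (subst tensor_unit_comm) (rule tYX)
  have me: "mat e (Atom 0) (Tens j i (Cob 0)) = (if i = Atom 0 \<and> j = Atom 0 then 1
      else if i = Atom 1 \<and> j = Atom 1 then ?w else 0)" for i j
  proof -
    have "cunit (Atom 0) = tensor D (und ?Y) (und ?X) (Tens j i (Cob 0)) \<longleftrightarrow>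
      i = Atom 0 \<and> j = Atom 0 \<or> i = Atom 1 \<and> j = Atom 1"
      unfolding tYX[symmetric] by (auto simp: cunit_def)
    then show ?thesis
      using tYX[of j i] by (auto simp: e_def mat_arr)
  qed
  have mk: "mat k (Tens i j (Cob 0)) (Atom 0) = (if i = Atom 0 \<and> j = Atom 0 then ?w
      else if i = Atom 1 \<and> j = Atom 1 then 1 else 0)" for i j
  proof -
    have "tensor D (und ?X) (und ?Y) (Tens i j (Cob 0)) = cunit (Atom 0) \<longleftrightarrow>
      i = Atom 0 \<and> j = Atom 0 \<or> i = Atom 1 \<and> j = Atom 1"
      unfolding tXY[symmetric] by (auto simp: cunit_def)
    then show ?thesis
      by (auto simp: k_def mat_arr)
  qed
  have w: "domega D a a (- a) = ?w" "?w * ?w = 1"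
    by (rule om_swap) (rule om_sq)
  have "e \<in> ehom (etensor D ?Y ?X) eunit"
    unfolding ev_ehom_iff[OF X Y ec] tYX by (auto simp: me mat_eqv_Yobj om_minus w)
  moreover have "k \<in> ehom eunit (etensor D ?X ?Y)"
    unfolding coev_ehom_iff[OF X Y kc] tXY by (auto simp: mk mat_eqv_Yobj om_minus w)
  ultimately have "is_dual D ?X ?Y e k"
  proof (rule is_dualI[OF X Y])
    show "is_inverse (associator D (und ?Y) (und ?X) (und ?Y)) (assoc_inv D (und ?Y) (und ?X) (und ?Y))"
      by (rule is_inverse_associator_Cob) (auto simp: und_Yobj_Some_iff)
    show "(\<Sum>j\<in>dom (und ?Y). mat e (Atom 0) (Tens j i (Cob 0))
      * assoc_coeff D P (the (und ?Y j)) P (Cob 0) (Cob 0) P * mat k (Tens i' j (Cob 0)) (Atom 0))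
      = (if i' = i then 1 else 0)" if "und ?X i = Some P" "und ?X i' = Some P" for i i' P
      using that na by (auto simp: me mk und_Yobj_Some_iff om_minus w)
    show "(\<Sum>i\<in>dom (und ?X). mat e (Atom 0) (Tens j i (Cob 0))
      * assoc_inv_coeff D P (the (und ?X i)) P (Cob 0) (Cob 0) * mat k (Tens i j' (Cob 0)) (Atom 0))
      = (if j' = j then 1 else 0)" if "und ?Y j = Some P" "und ?Y j' = Some P" for j j' P
      using that na by (auto simp: me mk und_Yobj_Some_iff om_minus w)
  qed
  then show ?thesis
    by blast
qed

subsection \<open>Quantum dimensions and invertibility\<close>

lemma qdim_Cob:
  assumes "is_eobj X" "\<And>i A. und X i = Some A \<Longrightarrow> grade A = One" "\<exists>Y e k. is_dual D X Y e k"
  shows "qdim D X = of_nat (card (dom (und X)))"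
proof -
  obtain Y e k where d: "is_dual D X Y e k"
    using assms(3) by blast
  show ?thesis
    by (rule qdimI[OF assms(1) _ _ d]) (rule assms(2) trace_Cob[OF assms(1) assms(2)]; assumption)+
qed

lemma qdim_Xobj:
  assumes "a \<in> tors2" "s \<in> {1, -1}"
  shows "qdim D (Xobj a s) = 1"
proof -
  have "is_eobj (Sobj (Cob a) s)"
    using assms by (intro is_eobj_Sobj) (simp_all add: tors2_neg)
  then have "qdim D (Sobj (Cob a) s) = of_nat (card (dom (und (Sobj (Cob a) s))))"
    by (rule qdim_Cob[OF _ _ exists_dual_X[OF assms]]) (auto split: if_splits)
  then show ?thesis
    by (simp add: Xobj_eq)
qed

lemma qdim_Yobj:
  assumes "a \<notin> tors2"
  shows "qdim D (Yobj a) = 2"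
proof -
  have "qdim D (Yobj a) = of_nat (card (dom (und (Yobj a))))"
    by (rule qdim_Cob[OF is_eobj_Yobj _ exists_dual_Y[OF assms]]) (auto simp: und_Yobj_Some_iff)
  then show ?thesis
    by simp
qed

lemma qdim_Zobj:
  assumes x: "x \<in> cosets2" and s: "s \<in> {1, -1}"
  shows "qdim D (Zobj x s) =
    dalpha D * dbeta D * deps D * complex_of_real (sqrt (real (card (dbl :: 'g set))))"
proof -
  obtain Y e k where d: "is_dual D (Sobj (Xob x) s) Y e k"
    using exists_dual_Z[OF assms] by blast
  have "is_eobj (Sobj (Xob x) s)"
    using assms by (intro is_eobj_Sobj) simp_all
  then show ?thesis
    unfolding Zobj_eq
    by (rule qdimI[where h = Gen, OF _ _ trace_Xob[OF x s] d]) (auto split: if_splits)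
qed

text \<open>The product is \<complex>_0 with the scalar s t \<omega>(a, a, -a) as equivariant
  structure, and -a = a.\<close>

lemma etensor_unit:
  assumes a: "a \<in> tors2" and s: "s \<in> {1, -1}" and t: "t \<in> {1, -1}"
    and st: "s * t * domega D a a a = 1"
  shows "eisomorphic (etensor D (Sobj (Cob a) s) (Sobj (Cob a) t)) eunit"
proof -
  let ?X = "Sobj (Cob a) s" and ?Y = "Sobj (Cob a) t"
  let ?T = "tensor D (und ?X) (und ?Y)" and ?l = "Tens (Atom 0) (Atom 0) (Cob (0 :: 'g))"
  have na: "- a = a"
    using a by (rule tors2_neg)
  have aa: "a + a = 0"
    using a by (simp add: tors2_def)
  have X: "is_eobj ?X" and Y: "is_eobj ?Y"
    using s t na by (auto intro!: is_eobj_Sobj)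
  have T: "?T v = Some A \<longleftrightarrow> v = ?l \<and> A = Cob 0" for v A
    by (auto simp: tensor_Some_iff aa)
  define f where "f = arr ?T cunit (\<lambda>_ _. 1)"
  define g where "g = arr cunit ?T (\<lambda>_ _. 1)"
  have fc: "f \<in> chom ?T cunit" and gc: "g \<in> chom cunit ?T"
    by (simp_all add: f_def g_def)
  have dT: "dom ?T = {?l}" and Tl: "?T ?l = cunit (Atom 0)"
    using T[of ?l "Cob 0"] by (auto simp: T dom_def cunit_def simp del: und_Sobj)
  have mf: "mat f w v = (if w = Atom 0 \<and> v = ?l then 1 else 0)" for w v
    using Tl by (auto simp: f_def mat_arr dT cunit_def simp del: und_Sobj)
  have mg: "mat g w v = (if w = ?l \<and> v = Atom 0 then 1 else 0)" for w v
    using T[of w "Cob 0"] by (auto simp: g_def mat_arr cunit_def simp del: und_Sobj)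
  have eX: "mat (eqv ?X) w v = (if w = Atom 0 \<and> v = Atom 0 then s else 0)"
    and eY: "mat (eqv ?Y) w v = (if w = Atom 0 \<and> v = Atom 0 then t else 0)" for w v
    by (rule mat_eqv_Sobj; simp add: na)+
  \<comment> \<open>A morphism from the product to the unit satisfies the equations of an
    evaluation, and one from the unit to the product those of a coevaluation, so both criteria
    apply.\<close>
  have fe: "f \<in> ehom (etensor D ?X ?Y) eunit"
    unfolding ev_ehom_iff[OF Y X fc] T using st na by (auto simp: mf eX eY)
  have ge: "g \<in> ehom eunit (etensor D ?X ?Y)"
    unfolding coev_ehom_iff[OF X Y gc] T using st na by (auto simp: mg eX eY)
  have "g \<bullet> f = idm ?T"
    by (rule arrow_eqI[OF compm_chom[OF fc gc] idm_chom])
      (auto simp: mat_compm chom_tgt[OF fc] mf mg mat_idm dT simp del: und_Sobj)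
  moreover have "f \<bullet> g = idm cunit"
    by (rule arrow_eqI[OF compm_chom[OF gc fc] idm_chom])
      (auto simp: mat_compm chom_tgt[OF gc] mf mg mat_idm dT simp del: und_Sobj)
  ultimately have "is_eiso (etensor D ?X ?Y) eunit f"
    by (intro is_eisoI[OF fe ge]) simp_all
  then show ?thesis
    unfolding eisomorphic_def by blast
qed

lemma einvertible_Xobj:
  assumes a: "a \<in> tors2" and s: "s \<in> {1, -1}"
  shows "einvertible D (Xobj a s)"
proof -
  \<comment> \<open>The tensor inverse carries the same sign correction as the dual.\<close>
  let ?t = "s * domega D a a a"
  have t: "?t \<in> {1, -1}"
    by (rule sign_cases(2)[OF s])
  have "is_eobj (Sobj (Cob a) ?t)"
    using t a by (intro is_eobj_Sobj) (simp_all add: tors2_neg)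
  moreover have "s * ?t * domega D a a a = 1"
    using sign_cases(1)[OF s] om_sq[of a a a] by (metis mult.assoc mult.right_neutral)
  moreover from this have "?t * s * domega D a a a = 1"
    by (simp only: mult.commute[of s])
  ultimately show ?thesis
    unfolding einvertible_def Xobj_eq using etensor_unit[OF a s t] etensor_unit[OF a t s] by blast
qed

end

section \<open>Counting\<close>

lemma tors2_nonempty [simp]: "tors2 \<noteq> {}"
proof -
  have "0 \<in> tors2"
    by (simp add: tors2_def)
  then show ?thesis
    by blast
qed

lemma card_fibres:
  assumes "finite S" "\<And>y. y \<in> f ` S \<Longrightarrow> card {x \<in> S. f x = y} = n"
  shows "card S = card (f ` S) * n"
proof -
  have "card S = (\<Sum>y\<in>f ` S. card {x \<in> S. f x = y})"
    using sum.image_gen[OF assms(1), of "\<lambda>_. 1 :: nat" f] by simp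
  then show ?thesis
    using assms(2) by simp
qed

text \<open>Doubling is an endomorphism with image 2\<Gamma>, and each of its fibres is a translate
  of the kernel \<Gamma>_2.\<close>

lemma card_tors2_dbl:
  "CARD('g::{ab_group_add,finite}) = card (dbl :: 'g set) * card (tors2 :: 'g set)"
  unfolding dbl_def
proof (rule card_fibres)
  fix y :: 'g
  assume "y \<in> range (\<lambda>a. a + a)"
  then obtain b where b: "y = b + b"
    by blast
  have "{x \<in> UNIV. x + x = y} = (+) b ` tors2"
  proof (intro set_eqI iffI)
    fix x
    assume "x \<in> {x \<in> UNIV. x + x = y}"
    then have "x - b \<in> tors2"
      by (simp add: b tors2_def algebra_simps)
    then show "x \<in> (+) b ` tors2"
      by (rule rev_image_eqI) simp
  next
    fix x
    assume "x \<in> (+) b ` tors2"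
    then obtain c where c: "c + c = 0" "x = b + c"
      by (auto simp: tors2_def)
    have "x + x = (b + b) + (c + c)"
      by (simp add: c(2) algebra_simps)
    then show "x \<in> {x \<in> UNIV. x + x = y}"
      by (simp add: b c(1))
  qed
  then show "card {x \<in> UNIV. x + x = y} = card (tors2 :: 'g set)"
    by (simp add: card_image)
qed simp

text \<open>|\<Gamma>| is |\<Gamma>/2\<Gamma>| |2\<Gamma>| by counting cosets and |2\<Gamma>|
  |\<Gamma>_2| by counting fibres of doubling; cancel |2\<Gamma>|.\<close>

lemma card_cosets2: "card (cosets2 :: 'g::{ab_group_add,finite} set set) = card (tors2 :: 'g set)"
proof -
  have "CARD('g) = card (cosets2 :: 'g set set) * card (dbl :: 'g set)"
    unfolding cosets2_def
  proof (rule card_fibres)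
    fix y :: "'g set"
    assume "y \<in> range (\<lambda>a. a +o dbl)"
    then obtain b where b: "y = b +o dbl"
      by blast
    have "{x \<in> UNIV. x +o dbl = y} = (+) b ` dbl"
    proof (intro set_eqI iffI)
      fix x
      assume "x \<in> {x \<in> UNIV. x +o dbl = y}"
      then have "x \<in> b +o dbl"
        using set_plus_intro2[of 0 dbl x] by (simp add: b)
      then show "x \<in> (+) b ` dbl"
        by (auto simp: elt_set_plus_def)
    next
      fix x
      assume "x \<in> (+) b ` dbl"
      then obtain c where c: "c \<in> dbl" "x = b + c"
        by auto
      then show "x \<in> {x \<in> UNIV. x +o dbl = y}"
        using plus_dbl[OF c(1)] by (simp add: b flip: set_plus_rearrange2)
    qed
    then show "card {x \<in> UNIV. x +o dbl = y} = card (dbl :: 'g set)"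
      by (simp add: card_image)
  qed simp
  then show ?thesis
    using card_tors2_dbl[where 'g = 'g] by simp
qed

section \<open>Isomorphism classes of the listed objects\<close>

lemma csimple_fixed_iff:
  "sact Gen A = A \<and> csimple A \<longleftrightarrow> A \<in> Cob ` tors2 \<union> Xob ` cosets2"
proof (cases A)
  case (Cob a)
  then show ?thesis
    using not_tors2_iff[of a] by auto
qed auto

lemma iso_class_Sobj_eq_iff:
  assumes "sact Gen A = A \<and> csimple A" "s \<in> {1, -1}" "sact Gen B = B \<and> csimple B" "t \<in> {1, -1}"
  shows "iso_class (Sobj A s) = iso_class (Sobj B t) \<longleftrightarrow> A = B \<and> s = t"
  using assms by (subst iso_class_eq_iff) (auto simp: is_eobj_Sobj eisomorphic_Sobj_iff)

lemma iso_class_Sobj_neq_Yobj: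
  assumes "sact Gen A = A \<and> csimple A" "s \<in> {1, -1}" "a \<notin> tors2"
  shows "iso_class (Sobj A s) \<noteq> iso_class (Yobj a)"
  using assms not_eisomorphic_Sobj_Yobj[of A s a]
  by (subst iso_class_eq_iff) (auto simp: is_eobj_Sobj is_eobj_Yobj)

lemma iso_class_Yobj_eq_iff:
  assumes "a \<notin> tors2"
  shows "iso_class (Yobj a) = iso_class (Yobj b) \<longleftrightarrow> b = a \<or> b = - a"
  using assms by (subst iso_class_eq_iff) (auto simp: is_eobj_Yobj eisomorphic_Yobj_iff)

lemma iso_classes_esimple:
  "iso_class ` {V :: 'g::ab_group_add eobj. esimple V} = X_classes \<union> Y_classes \<union> Z_classes"
proof -
  \<comment> \<open>The two families together are the classes of all \<open>Sobj A s\<close> with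
    \<open>A\<close> fixed by the action, matching the first clause of
    \<open>elementary\<close>.\<close>
  have XZ: "X_classes \<union> (Z_classes :: 'g eobj set set) = (\<lambda>(A, s). iso_class (Sobj A s)) ` ((Cob ` tors2 \<union> Xob ` cosets2) \<times> {1, -1})"
    unfolding X_classes_def Z_classes_def Xobj_eq Zobj_eq by force
  have el: "iso_class ` {T :: 'g eobj. elementary T} = X_classes \<union> Y_classes \<union> Z_classes"
  proof (intro set_eqI iffI)
    fix C :: "'g eobj set"
    assume "C \<in> iso_class ` {T. elementary T}"
    then obtain T where T: "C = iso_class T" "elementary T"
      by blast
    from T(2) show "C \<in> X_classes \<union> Y_classes \<union> Z_classes"
    proof cases
      case (Sobj A s)
      then have "(A, s) \<in> (Cob ` tors2 \<union> Xob ` cosets2) \<times> {1, -1}"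
        using csimple_fixed_iff[of A] by blast
      then have "C \<in> X_classes \<union> Z_classes"
        unfolding XZ using T(1) Sobj(1) by (intro image_eqI) auto
      then show ?thesis
        by blast
    next
      case (Yobj a)
      then show ?thesis
        using T(1) by (auto simp: Y_classes_def)
    qed
  next
    fix C :: "'g eobj set"
    assume "C \<in> X_classes \<union> Y_classes \<union> Z_classes"
    then consider "C \<in> X_classes \<union> Z_classes" | "C \<in> Y_classes"
      by blast
    then show "C \<in> iso_class ` {T. elementary T}"
    proof cases
      case 1
      then obtain A s where "C = iso_class (Sobj A s)" "A \<in> Cob ` tors2 \<union> Xob ` cosets2" "s \<in> {1, -1}"
        unfolding XZ by auto
      then show ?thesis
        using csimple_fixed_iff[of A] elementary.Sobj[of A s] by blast
    next
      case 2
      then show ?thesis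
        using elementary.Yobj by (auto simp: Y_classes_def)
    qed
  qed
  have "iso_class ` {V :: 'g eobj. esimple V} = iso_class ` {T. elementary T}"
  proof (intro subset_antisym image_subsetI)
    show "iso_class T \<in> iso_class ` {V. esimple V}" if "T \<in> {T. elementary T}" for T :: "'g eobj"
      using that elementary_esimple by blast
    show "iso_class V \<in> iso_class ` {T. elementary T}" if "V \<in> {V. esimple V}" for V :: "'g eobj"
    proof -
      have V: "esimple V" "is_eobj V"
        using that by (simp_all add: esimple_def)
      obtain T where T: "elementary T" "eisomorphic T V"
        using esimple_elementary[OF V(1)] by blast
      then have "iso_class T = iso_class V"
        using iso_class_eq_iff[OF elementary_is_eobj V(2)] by blast
      then show ?thesis
        using T(1) by blast
    qed
  qed
  then show ?thesis
    using el by simp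
qed

text \<open>Every fibre of the map from a to the class of \<open>Yobj a\<close> is a pair {b, -b} of
  distinct elements.\<close>

lemma card_Y_classes:
  "2 * card (Y_classes :: 'g::{ab_group_add,finite} eobj set set) = CARD('g) - card (tors2 :: 'g set)"
proof -
  have "card (- tors2 :: 'g set) = card ((\<lambda>a. iso_class (Yobj a)) ` (- tors2 :: 'g set)) * 2"
  proof (rule card_fibres)
    fix C
    assume "C \<in> (\<lambda>a. iso_class (Yobj a)) ` (- tors2 :: 'g set)"
    then obtain b where b: "C = iso_class (Yobj b)" "b \<notin> tors2"
      by blast
    have nb: "- b \<noteq> b"
      using b(2) not_tors2_iff by blast
    have "{a \<in> - tors2. iso_class (Yobj a) = C} = {b, - b}"
      using iso_class_Yobj_eq_iff[OF b(2)] b not_tors2_iff[of b] not_tors2_iff[of "- b"] by auto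
    then show "card {a \<in> - tors2. iso_class (Yobj a) = C} = 2"
      using nb by simp
  qed simp
  then show ?thesis
    by (simp add: Y_classes_def Compl_eq_Diff_UNIV card_Diff_subset)
qed

text \<open>The trace gives \<alpha>\<beta>\<epsilon> |2\<Gamma>|^(1/2) for the third family. Its
  sign depends on the chosen ribbon structure, so both cases are recorded; \<alpha>\<beta> =
  \<epsilon> is the one with positive dimensions.\<close>

theorem proposition5p15:
  fixes D :: "'g::{ab_group_add,finite} crossed_data"
  assumes "valid_data D"
  shows
    \<comment> \<open>the isomorphism classes of simple objects\<close>
    "iso_class ` {V :: 'g eobj. esimple V} = X_classes \<union> Y_classes \<union> Z_classes
     \<and> X_classes \<inter> (Y_classes :: 'g eobj set set) = {}
     \<and> X_classes \<inter> (Z_classes :: 'g eobj set set) = {}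
     \<and> Y_classes \<inter> (Z_classes :: 'g eobj set set) = {}
     \<comment> \<open>(1)\<close>
     \<and> (\<forall>a \<in> (tors2 :: 'g set). \<forall>s \<in> {1, -1}.
          esimple (Xobj a s) \<and> einvertible D (Xobj a s) \<and> qdim D (Xobj a s) = 1)
     \<and> inj_on (\<lambda>(a, s). iso_class (Xobj a s)) ((tors2 :: 'g set) \<times> {1, -1})
     \<and> card (X_classes :: 'g eobj set set) = 2 * card (tors2 :: 'g set)
     \<comment> \<open>(2)\<close>
     \<and> (\<forall>a \<in> - (tors2 :: 'g set). esimple (Yobj a) \<and> qdim D (Yobj a) = 2)
     \<and> (\<forall>a \<in> - (tors2 :: 'g set). \<forall>b \<in> - tors2.
          eisomorphic (Yobj a) (Yobj b) \<longleftrightarrow> {a, - a} = {b, - b})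
     \<and> real (card (Y_classes :: 'g eobj set set))
          = (real CARD('g) - real (card (tors2 :: 'g set))) / 2
     \<and> (real CARD('g) - real (card (tors2 :: 'g set))) / 2
          = real CARD('g) / 2 * (1 - 1 / real (card (dbl :: 'g set)))
     \<comment> \<open>(3)\<close>
     \<and> (\<forall>x \<in> (cosets2 :: 'g set set). \<forall>s \<in> {1, -1}.
          esimple (Zobj x s)
          \<and> (dalpha D * dbeta D = deps D \<longrightarrow>
               qdim D (Zobj x s) = sqrt (real CARD('g) / real (card (tors2 :: 'g set))))
          \<and> (dalpha D * dbeta D = - deps D \<longrightarrow>
               qdim D (Zobj x s) = - sqrt (real CARD('g) / real (card (tors2 :: 'g set)))))
     \<and> sqrt (real CARD('g) / real (card (tors2 :: 'g set))) = sqrt (real (card (dbl :: 'g set)))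
     \<and> inj_on (\<lambda>(x, s). iso_class (Zobj x s)) ((cosets2 :: 'g set set) \<times> {1, -1})
     \<and> card (Z_classes :: 'g eobj set set) = 2 * card (tors2 :: 'g set)"
proof -
  interpret crossed_input D
    by unfold_locales (rule assms)
  have fixed_X: "sact Gen (Cob a) = Cob a \<and> csimple (Cob a)" if "a \<in> tors2" for a :: 'g
    using csimple_fixed_iff that by blast
  have fixed_Z: "sact Gen (Xob x) = Xob x \<and> csimple (Xob x)" if "x \<in> cosets2" for x :: "'g set"
    using csimple_fixed_iff that by blast
  have XY: "X_classes \<inter> (Y_classes :: 'g eobj set set) = {}"
    unfolding X_classes_def Y_classes_def Xobj_eq
    using iso_class_Sobj_neq_Yobj[OF fixed_X] by (auto 0 3)
  have ZY: "Y_classes \<inter> (Z_classes :: 'g eobj set set) = {}"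
    unfolding Z_classes_def Y_classes_def Zobj_eq
    using iso_class_Sobj_neq_Yobj[OF fixed_Z] by (auto 0 3 dest: sym)
  have XZ: "X_classes \<inter> (Z_classes :: 'g eobj set set) = {}"
    unfolding X_classes_def Z_classes_def Xobj_eq Zobj_eq
    using iso_class_Sobj_eq_iff[OF fixed_X _ fixed_Z] by (auto 0 3)
  have injX: "inj_on (\<lambda>(a, s). iso_class (Xobj a s)) ((tors2 :: 'g set) \<times> {1, -1})"
    unfolding Xobj_eq using iso_class_Sobj_eq_iff[OF fixed_X _ fixed_X] by (intro inj_onI) auto
  have injZ: "inj_on (\<lambda>(x, s). iso_class (Zobj x s)) ((cosets2 :: 'g set set) \<times> {1, -1})"
    unfolding Zobj_eq using iso_class_Sobj_eq_iff[OF fixed_Z _ fixed_Z] by (intro inj_onI) auto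
  have signs: "card {1, - 1 :: complex} = 2"
    by simp
  have cardX: "card (X_classes :: 'g eobj set set) = 2 * card (tors2 :: 'g set)"
    unfolding X_classes_def card_image[OF injX] card_cartesian_product signs by simp
  have cardZ: "card (Z_classes :: 'g eobj set set) = 2 * card (tors2 :: 'g set)"
    unfolding Z_classes_def card_image[OF injZ] card_cartesian_product signs card_cosets2 by simp
  have G: "real CARD('g) = real (card (dbl :: 'g set)) * real (card (tors2 :: 'g set))"
    using card_tors2_dbl[where 'g = 'g] by simp
  have quot: "real CARD('g) / real (card (tors2 :: 'g set)) = real (card (dbl :: 'g set))"
    by (simp add: G)
  have "card (tors2 :: 'g set) \<le> CARD('g)"
    by (rule card_mono) simp_all
  then have cardY: "real (card (Y_classes :: 'g eobj set set))
      = (real CARD('g) - real (card (tors2 :: 'g set))) / 2"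
    using card_Y_classes[where 'g = 'g] by (simp add: of_nat_diff field_simps)
  have half: "(real CARD('g) - real (card (tors2 :: 'g set))) / 2
      = real CARD('g) / 2 * (1 - 1 / real (card (dbl :: 'g set)))"
    unfolding G by (simp add: field_simps)
  have simX: "esimple (Xobj a s)" if "a \<in> tors2" "s \<in> {1, -1}" for a :: 'g and s
    unfolding Xobj_eq using fixed_X[OF that(1)] that(2) by (intro elementary_esimple elementary.Sobj) auto
  have simZ: "esimple (Zobj x s)" if "x \<in> cosets2" "s \<in> {1, -1}" for x :: "'g set" and s
    unfolding Zobj_eq using fixed_Z[OF that(1)] that(2) by (intro elementary_esimple elementary.Sobj) auto
  have simY: "esimple (Yobj a)" if "a \<notin> tors2" for a :: 'g
    using that by (intro elementary_esimple elementary.Yobj)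
  have isoY: "eisomorphic (Yobj a) (Yobj b) \<longleftrightarrow> {a, - a} = {b, - b}" if "a \<notin> tors2" for a b :: 'g
    unfolding eisomorphic_Yobj_iff[OF that] by (auto simp: doubleton_eq_iff)
  \<comment> \<open>Substituting \<alpha>\<beta> = \<epsilon> or \<alpha>\<beta> = -\<epsilon>
    leaves \<epsilon> squared up to sign in the formula for the dimension.\<close>
  have "deps D * deps D = 1"
    using eps_pm by auto
  then have dimZ: "dalpha D * dbeta D = deps D \<Longrightarrow>
        qdim D (Zobj x s) = complex_of_real (sqrt (real (card (dbl :: 'g set))))"
      "dalpha D * dbeta D = - deps D \<Longrightarrow>
        qdim D (Zobj x s) = complex_of_real (- sqrt (real (card (dbl :: 'g set))))"
    if "x \<in> cosets2" "s \<in> {1, -1}" for x s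
    unfolding qdim_Zobj[OF that] by simp_all
  show ?thesis
    by (intro conjI ballI impI; (rule iso_classes_esimple XY XZ ZY injX injZ cardX cardZ cardY half)?)
      (simp_all only: simX simY simZ einvertible_Xobj qdim_Xobj qdim_Yobj isoY dimZ quot Compl_iff simp_thms)
qed

end
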